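(* Let $T[1..n]$ be a text over the alphabet $[1..\sigma]$ whose $\Psi$ function has $r$ $\Psi$-runs. Then $T$ can be represented (the $r$-CSA) in $O(r\log n)$ bits of space so that, for any pattern $P[1..m]$, the number of occurrences of $P$ in $T$ can be counted in $O(m\log\log_w(\sigma n/r))$ time, where $w$ is the computer word size.
   Context: Model: word RAM with word size $w$ bits. $T[n]=\$$ is a unique terminator smaller than every other symbol. The suffix array $SA[1..n]$ lists the starting positions of the suffixes of $T$ in lexicographic order, and $SA^{-1}$ is its inverse permutation. $\Psi$ is the permutation of $[1..n]$ given by $\Psi(i)=SA^{-1}[(SA[i]\bmod n)+1]$. For each symbol $c$, let $\Psi_c$ be the restriction of $\Psi$ to the maximal interval of suffix-array positions whose suffixes start with $c$. A $\Psi$-run is a maximal interval $[i..i+l]$ of positions contained in a single such interval with $\Psi(k+1)=\Psi(k)+1$ for all $i\le k<i+l$; $r$ denotes the number of $\Psi$-runs (it equals the number of maximal equal-letter runs of the Burrows–Wheeler transform $BWT[i]=T[SA[i]-1]$, with $BWT[i]=T[n]$ if $SA[i]=1$). Counting means computing the number $occ=ep-sp+1$ where $SA[sp..ep]$ is the interval of suffixes prefixed by $P$.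
   Formalization: Assumes σ ≤ n^k for a fixed k (constants depend on k): for T = x$ with unbounded σ, O(r log n) bits cannot distinguish the symbols x. Also n, σ and m are below 2^w, m ≥ 1, and logarithms in the bounds are taken to be at least 1. *)

theory Defs
  imports Complex_Main "HOL-Library.List_Lexorder" "HOL-Library.Sublist"
begin

unbundle bit_operations_syntax

section \<open>Texts, suffix arrays and the function \<open>\<Psi>\<close>\<close>

text \<open>
  A text \<open>T[1..n]\<close> is a list of length \<open>n\<close>, so that \<open>T[i]\<close> is \<open>T ! (i - 1)\<close>.
  All positions in the text and in the suffix array are counted from 1. The order on lists
  is the lexicographic one, in which a proper prefix is smaller.
\<close>

definition is_text :: "nat \<Rightarrow> nat list \<Rightarrow> bool" where
  "is_text \<sigma> T \<longleftrightarrow> T \<noteq> [] \<and> set T \<subseteq> {1..\<sigma>} \<and> (\<forall>c \<in> set (butlast T). last T < c)"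

definition suffix_at :: "nat list \<Rightarrow> nat \<Rightarrow> nat list" where
  "suffix_at T i = drop (i - 1) T"

definition SA :: "nat list \<Rightarrow> nat \<Rightarrow> nat" where
  "SA T i = sort_key (suffix_at T) [1..<length T + 1] ! (i - 1)"

definition SA_inv :: "nat list \<Rightarrow> nat \<Rightarrow> nat" where
  "SA_inv T = inv_into {1..length T} (SA T)"

definition Psi :: "nat list \<Rightarrow> nat \<Rightarrow> nat" where
  "Psi T i = SA_inv T ((SA T i mod length T) + 1)"

definition symbol_range :: "nat list \<Rightarrow> nat \<Rightarrow> nat set" where
  "symbol_range T c = {i \<in> {1..length T}. hd (suffix_at T (SA T i)) = c}"

definition psi_segment :: "nat list \<Rightarrow> nat set \<Rightarrow> bool" where
  "psi_segment T A \<longleftrightarrow> (\<exists>i j c. i \<le> j \<and> A = {i..j} \<and> A \<subseteq> symbol_range T c \<and>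
     (\<forall>k. i \<le> k \<and> k < j \<longrightarrow> Psi T (k + 1) = Psi T k + 1))"

definition psi_run :: "nat list \<Rightarrow> nat set \<Rightarrow> bool" where
  "psi_run T A \<longleftrightarrow> psi_segment T A \<and> (\<forall>B. psi_segment T B \<and> A \<subseteq> B \<longrightarrow> B = A)"

definition num_psi_runs :: "nat list \<Rightarrow> nat" where
  "num_psi_runs T = card {A. psi_run T A}"

definition pattern_range :: "nat list \<Rightarrow> nat list \<Rightarrow> nat set" where
  "pattern_range T P = {i \<in> {1..length T}. prefix P (suffix_at T (SA T i))}"

text \<open>\<open>ep - sp + 1\<close>, where \<open>SA[sp..ep]\<close> are the suffixes prefixed by \<open>P\<close>; 0 if there are none.\<close>

definition occ :: "nat list \<Rightarrow> nat list \<Rightarrow> nat" where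
  "occ T P = (if pattern_range T P = {} then 0
     else Max (pattern_range T P) - Min (pattern_range T P) + 1)"

lemma prefix_between:
  assumes "prefix P (xs::nat list)" "prefix P zs" "xs \<le> ys" "ys \<le> zs" shows "prefix P ys"
  using assms
proof (induction P arbitrary: xs ys zs)
  case Nil
  show ?case by simp
next
  case (Cons p P)
  from Cons.prems obtain xs' zs' where x: "xs = p # xs'" "prefix P xs'"
    and z: "zs = p # zs'" "prefix P zs'"
    by (auto simp: prefix_Cons prefix_def)
  have "ys \<noteq> []"
    using Cons.prems(3) x(1) by auto
  then obtain y ys' where y: "ys = y # ys'"
    by (cases ys) auto
  have "y = p" "xs' \<le> ys'" "ys' \<le> zs'"
    using Cons.prems(3,4) unfolding x(1) y z(1) Cons_le_Cons by auto
  then show ?case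
    using Cons.IH[OF x(2) z(2)] y by simp
qed

lemma SA_bij: "bij_betw (SA T) {1..length T} {1..length T}"
proof -
  let ?s = "sort_key (suffix_at T) [1..<length T + 1]"
  have "bij_betw ((!) ?s) {..<length ?s} (set ?s)"
    by (rule bij_betw_nth) auto
  moreover have "bij_betw (\<lambda>i. i - 1) {1..length T} {..<length ?s}"
    by (rule bij_betw_byWitness[where f' = Suc]) auto
  ultimately have "bij_betw ((!) ?s \<circ> (\<lambda>i. i - 1)) {1..length T} (set ?s)"
    by (rule bij_betw_trans[rotated])
  moreover have "(!) ?s \<circ> (\<lambda>i. i - 1) = SA T"
    by (auto simp: SA_def)
  moreover have "set ?s = {1..length T}" by auto
  ultimately show ?thesis by simp
qed

lemma SA_sorted:
  assumes "1 \<le> i" "i \<le> j" "j \<le> length T"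
  shows "suffix_at T (SA T i) \<le> suffix_at T (SA T j)"
proof -
  let ?s = "sort_key (suffix_at T) [1..<length T + 1]"
  have "sorted (map (suffix_at T) ?s)" by (rule sorted_sort_key)
  from sorted_nth_mono[OF this, of "i - 1" "j - 1"] assms
  show ?thesis by (simp add: SA_def del: upt_Suc)
qed

lemma occ_eq_card:
  "occ T P = card {i \<in> {1..length T}. prefix P (suffix_at T i)}"
proof -
  let ?R = "pattern_range T P"
  have "bij_betw (SA T) ?R {i \<in> {1..length T}. prefix P (suffix_at T i)}"
    unfolding pattern_range_def bij_betw_def
  proof
    show "inj_on (SA T) {i \<in> {1..length T}. prefix P (suffix_at T (SA T i))}"
      using SA_bij[of T] by (auto simp: bij_betw_def intro: inj_on_subset)
    have "SA T ` {1..length T} = {1..length T}"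
      using SA_bij[of T] by (simp add: bij_betw_def)
    then show "SA T ` {i \<in> {1..length T}. prefix P (suffix_at T (SA T i))} =
        {i \<in> {1..length T}. prefix P (suffix_at T i)}"
      by (auto simp: set_eq_iff image_iff) (metis atLeastAtMost_iff)+
  qed
  then have card: "card ?R = card {i \<in> {1..length T}. prefix P (suffix_at T i)}"
    by (rule bij_betw_same_card)
  have fin: "finite ?R" by (simp add: pattern_range_def)
  show ?thesis
  proof (cases "?R = {}")
    case True
    then show ?thesis using card by (simp add: occ_def)
  next
    case False
    have mem: "Min ?R \<in> ?R" "Max ?R \<in> ?R" using fin False by auto
    have "?R = {Min ?R..Max ?R}"
    proof (intro equalityI subsetI)
      fix i assume "i \<in> ?R"
      then show "i \<in> {Min ?R..Max ?R}" using fin by auto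
    next
      fix i assume i: "i \<in> {Min ?R..Max ?R}"
      have b: "1 \<le> Min ?R" "Max ?R \<le> length T"
        and p: "prefix P (suffix_at T (SA T (Min ?R)))" "prefix P (suffix_at T (SA T (Max ?R)))"
        using mem by (simp_all add: pattern_range_def)
      have "prefix P (suffix_at T (SA T i))"
        using p SA_sorted[of "Min ?R" i T] SA_sorted[of i "Max ?R" T] b i
        by (intro prefix_between[OF p]) auto
      then show "i \<in> ?R" using i b by (auto simp: pattern_range_def)
    qed
    then have "card ?R = Max ?R - Min ?R + 1"
      using mem fin by (metis Max_ge Suc_diff_le card_atLeastAtMost Suc_eq_plus1)
    then show ?thesis using False card by (simp add: occ_def)
  qed
qed


section \<open>The word RAM\<close>

text \<open>
  A program is a fixed finite list of instructions that does not depend on the word size \<open>w\<close>.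
  Registers and memory cells hold \<open>w\<close>-bit words, represented as natural numbers below \<open>2 ^ w\<close>;
  every instruction takes one time unit.
\<close>

datatype binop = Add | Sub | Mul | Div | Mod | And | Or | Xor | Shl | Shr | Less

fun apply_op :: "nat \<Rightarrow> binop \<Rightarrow> nat \<Rightarrow> nat \<Rightarrow> nat" where
  "apply_op w Add a b = (a + b) mod 2 ^ w"
| "apply_op w Sub a b = (a + (2 ^ w - b)) mod 2 ^ w"
| "apply_op w Mul a b = (a * b) mod 2 ^ w"
| "apply_op w Div a b = a div b"
| "apply_op w Mod a b = a mod b"
| "apply_op w And a b = a AND b"
| "apply_op w Or a b = a OR b"
| "apply_op w Xor a b = a XOR b"
| "apply_op w Shl a b = (a * 2 ^ b) mod 2 ^ w"
| "apply_op w Shr a b = a div 2 ^ b"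
| "apply_op w Less a b = of_bool (a < b)"

text \<open>
  Memory addresses have the form \<open>k * x + c\<close> with \<open>x\<close> the content of a register and literals
  \<open>k\<close>, \<open>c\<close> (scaled-index addressing). If \<open>w\<close> is just large enough for the positions of
  the text, this makes constant multiples of \<open>2 ^ w\<close> cells accessible, so that a data structure of
  \<open>O(n)\<close> words can be addressed.
\<close>

datatype instr =
    Const nat nat
  | Op binop nat nat nat
  | Load nat nat nat nat
  | Store nat nat nat nat
  | Input nat nat
  | JumpZero nat nat

record config =
  pc :: nat
  reg :: "nat \<Rightarrow> nat"
  mem :: "nat \<Rightarrow> nat"

fun exec :: "nat \<Rightarrow> nat list \<Rightarrow> instr \<Rightarrow> config \<Rightarrow> config" where
  "exec w P (Const d v) s = s\<lparr>pc := pc s + 1, reg := (reg s)(d := v mod 2 ^ w)\<rparr>"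
| "exec w P (Op f d a b) s =
     s\<lparr>pc := pc s + 1, reg := (reg s)(d := apply_op w f (reg s a) (reg s b))\<rparr>"
| "exec w P (Load d k a c) s =
     s\<lparr>pc := pc s + 1, reg := (reg s)(d := mem s (k * reg s a + c))\<rparr>"
| "exec w P (Store b k a c) s =
     s\<lparr>pc := pc s + 1, mem := (mem s)(k * reg s a + c := reg s b)\<rparr>"
| "exec w P (Input d a) s =
     s\<lparr>pc := pc s + 1,
       reg := (reg s)(d := if reg s a < length P then P ! reg s a else 0)\<rparr>"
| "exec w P (JumpZero a l) s = s\<lparr>pc := if reg s a = 0 then l else pc s + 1\<rparr>"

definition halted :: "instr list \<Rightarrow> config \<Rightarrow> bool" where
  "halted prog s \<longleftrightarrow> length prog \<le> pc s"

definition step :: "nat \<Rightarrow> nat list \<Rightarrow> instr list \<Rightarrow> config \<Rightarrow> config" where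
  "step w P prog s = (if halted prog s then s else exec w P (prog ! pc s) s)"

text \<open>
  The data structure is a bit string \<open>D\<close>, packed into consecutive words from cell 0 on, with
  zeros in all remaining cells. The pattern \<open>P\<close> is a read-only input array with one symbol per
  word. Initially register 0 holds \<open>w\<close> and register 1 the length of \<open>P\<close>.
\<close>

definition init_config :: "nat \<Rightarrow> bool list \<Rightarrow> nat list \<Rightarrow> config" where
  "init_config w D P =
     \<lparr>pc = 0,
      reg = (\<lambda>_. 0)(0 := w, 1 := length P),
      mem = (\<lambda>i. horner_sum of_bool 2 (take w (drop (i * w) D)))\<rparr>"

definition outputs_within ::
    "nat \<Rightarrow> instr list \<Rightarrow> bool list \<Rightarrow> nat list \<Rightarrow> nat \<Rightarrow> real \<Rightarrow> bool" where
  "outputs_within w prog D P y t \<longleftrightarrow>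
     (\<exists>k. real k \<le> t \<and>
       (let s = (step w P prog ^^ k) (init_config w D P) in halted prog s \<and> reg s 0 = y))"

text \<open>
  Logarithms in asymptotic bounds are understood to be at least 1.
\<close>

definition lg :: "real \<Rightarrow> real" where
  "lg x = max 1 (log 2 x)"

end

theory Submission
  imports Defs
begin

text \<open>
  Backward search extends a pattern to the left: if the suffixes prefixed by \<open>P\<close> occupy the ranks
  \<open>[l, h)\<close>, those prefixed by \<open>c P\<close> occupy \<open>[F c l, F c h)\<close>, where \<open>F c x\<close> counts the ranks \<open>k\<close>
  whose pair (first symbol, \<open>\<Psi>\<close> value) is lexicographically below \<open>(c, x)\<close>. These pairs increase with \<open>k\<close>, and
  along a run the \<open>\<Psi>\<close> values are consecutive, so \<open>F c x\<close> can be read off the last run whose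
  head is below \<open>(c, x)\<close>: counting reduces to predecessor search among the \<open>r\<close> run heads.

  The predecessor structure first splits the universe \<open>\<sigma> n\<close> into about \<open>r\<close> blocks, so that
  local keys have \<open>e = O(log (\<sigma> n / r))\<close> bits. Inside a block, every \<open>64 L f\<close>-th key is a sample, where \<open>f\<close> is the
  number of fields per word and \<open>L = O(e / log w)\<close> the number of digits of a local key in a
  base \<open>2 ^ \<beta>\<close> of about \<open>sqrt w\<close>. The longest digit prefix of the query that occurs in the trie of the
  samples is found by binary search over the \<open>L\<close> levels with perfect hash tables; a
  rank table that fits in one word finishes the trie search. Binary search among the
  keys between two samples stops when they fit into one word, where they are compared in parallel. All this takes
  \<open>O(log L)\<close> time, and the sampling rate makes the tries fit into \<open>O(r / f)\<close> words.
\<close>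

section \<open>A structured language for the word RAM\<close>

datatype exp = Cn nat | V nat | Bin binop exp exp | Ld nat exp nat | In exp

datatype cmd = Asg nat exp | Sq cmd cmd (infixr ";;" 60) | Ite exp cmd cmd | Wh exp cmd

fun ev :: "nat \<Rightarrow> nat list \<Rightarrow> (nat \<Rightarrow> nat) \<Rightarrow> (nat \<Rightarrow> nat) \<Rightarrow> exp \<Rightarrow> nat" where
  "ev w P M s (Cn v) = v mod 2 ^ w"
| "ev w P M s (V x) = s x"
| "ev w P M s (Bin f a b) = apply_op w f (ev w P M s a) (ev w P M s b)"
| "ev w P M s (Ld k e c) = M (k * ev w P M s e + c)"
| "ev w P M s (In e) = (if ev w P M s e < length P then P ! ev w P M s e else 0)"

inductive bs :: "nat \<Rightarrow> nat list \<Rightarrow> (nat \<Rightarrow> nat) \<Rightarrow> cmd \<Rightarrow> (nat \<Rightarrow> nat) \<Rightarrow> nat \<Rightarrow> (nat \<Rightarrow> nat) \<Rightarrow> bool"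
  for w P M where
  bs_Asg: "bs w P M (Asg x e) s 0 (s(x := ev w P M s e))"
| bs_Sq: "bs w P M a s t s' \<Longrightarrow> bs w P M b s' t' s'' \<Longrightarrow> bs w P M (a ;; b) s (t + t') s''"
| bs_IteT: "ev w P M s e \<noteq> 0 \<Longrightarrow> bs w P M a s t s' \<Longrightarrow> bs w P M (Ite e a b) s t s'"
| bs_IteF: "ev w P M s e = 0 \<Longrightarrow> bs w P M b s t s' \<Longrightarrow> bs w P M (Ite e a b) s t s'"
| bs_WhT: "ev w P M s e \<noteq> 0 \<Longrightarrow> bs w P M a s t s' \<Longrightarrow> bs w P M (Wh e a) s' t' s''
    \<Longrightarrow> bs w P M (Wh e a) s (Suc (t + t')) s''"
| bs_WhF: "ev w P M s e = 0 \<Longrightarrow> bs w P M (Wh e a) s 0 s"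

fun exp_below :: "nat \<Rightarrow> exp \<Rightarrow> bool" where
  "exp_below N (Cn v) = True"
| "exp_below N (V x) = (x < N)"
| "exp_below N (Bin f a b) = (exp_below N a \<and> exp_below N b)"
| "exp_below N (Ld k e c) = exp_below N e"
| "exp_below N (In e) = exp_below N e"

fun cmd_below :: "nat \<Rightarrow> cmd \<Rightarrow> bool" where
  "cmd_below N (Asg x e) = (x < N \<and> exp_below N e)"
| "cmd_below N (a ;; b) = (cmd_below N a \<and> cmd_below N b)"
| "cmd_below N (Ite e a b) = (exp_below N e \<and> cmd_below N a \<and> cmd_below N b)"
| "cmd_below N (Wh e a) = (exp_below N e \<and> cmd_below N a)"

fun comp_exp :: "exp \<Rightarrow> nat \<Rightarrow> instr list" where
  "comp_exp (Cn v) d = [Const d v]"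
| "comp_exp (V x) d = [Op Or d x x]"
| "comp_exp (Bin f a b) d = comp_exp a d @ comp_exp b (d + 1) @ [Op f d d (d + 1)]"
| "comp_exp (Ld k e c) d = comp_exp e d @ [Load d k d c]"
| "comp_exp (In e) d = comp_exp e d @ [Input d d]"

fun exp_size :: "exp \<Rightarrow> nat" where
  "exp_size (Cn v) = 1"
| "exp_size (V x) = 1"
| "exp_size (Bin f a b) = exp_size a + exp_size b + 1"
| "exp_size (Ld k e c) = exp_size e + 1"
| "exp_size (In e) = exp_size e + 1"

lemma length_comp_exp [simp]: "length (comp_exp e d) = exp_size e"
  by (induction e arbitrary: d) auto

fun cmd_size :: "cmd \<Rightarrow> nat" where
  "cmd_size (Asg x e) = exp_size e + 1"
| "cmd_size (a ;; b) = cmd_size a + cmd_size b"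
| "cmd_size (Ite e a b) = exp_size e + cmd_size a + cmd_size b + 3"
| "cmd_size (Wh e a) = exp_size e + cmd_size a + 3"

text \<open>Jump targets are absolute, so the code depends on its position \<open>p\<close>; registers from \<open>N\<close> on
  are scratch space for expression evaluation.\<close>

fun comp_cmd :: "nat \<Rightarrow> cmd \<Rightarrow> nat \<Rightarrow> instr list" where
  "comp_cmd N (Asg x e) p = comp_exp e N @ [Op Or x N N]"
| "comp_cmd N (a ;; b) p = comp_cmd N a p @ comp_cmd N b (p + cmd_size a)"
| "comp_cmd N (Ite e a b) p =
     comp_exp e N @ [JumpZero N (p + exp_size e + cmd_size a + 3)] @
     comp_cmd N a (p + exp_size e + 1) @
     [Const N 0, JumpZero N (p + exp_size e + cmd_size a + cmd_size b + 3)] @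
     comp_cmd N b (p + exp_size e + cmd_size a + 3)"
| "comp_cmd N (Wh e a) p =
     comp_exp e N @ [JumpZero N (p + exp_size e + cmd_size a + 3)] @
     comp_cmd N a (p + exp_size e + 1) @ [Const N 0, JumpZero N p]"

lemma length_comp_cmd [simp]: "length (comp_cmd N c p) = cmd_size c"
  by (induction c arbitrary: p) auto

definition code_at :: "instr list \<Rightarrow> nat \<Rightarrow> instr list \<Rightarrow> bool" where
  "code_at prog p is \<longleftrightarrow> (\<exists>pre post. prog = pre @ is @ post \<and> length pre = p)"

lemma code_at_Cons: "code_at prog p (x # xs) \<longleftrightarrow> p < length prog \<and> prog ! p = x \<and> code_at prog (Suc p) xs"
proof
  assume "code_at prog p (x # xs)"
  then obtain pre post where "prog = pre @ (x # xs) @ post" "length pre = p"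
    unfolding code_at_def by blast
  moreover from this have "prog = (pre @ [x]) @ xs @ post" "length (pre @ [x]) = Suc p" by auto
  ultimately show "p < length prog \<and> prog ! p = x \<and> code_at prog (Suc p) xs"
    unfolding code_at_def by (metis append_Cons length_append_singleton less_add_Suc1 length_append nth_append_length
        list.size(4) add_Suc_right)
next
  assume a: "p < length prog \<and> prog ! p = x \<and> code_at prog (Suc p) xs"
  then obtain pre post where pp: "prog = pre @ xs @ post" "length pre = Suc p"
    unfolding code_at_def by blast
  from pp(2) obtain pre' y where "pre = pre' @ [y]" "length pre' = p"
    by (metis length_Suc_conv_rev)
  with pp a show "code_at prog p (x # xs)" unfolding code_at_def
    by (intro exI[of _ pre'] exI[of _ post]) (auto simp: nth_append)
qed

lemma code_at_Nil [simp]: "code_at prog p [] \<longleftrightarrow> p \<le> length prog"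
  unfolding code_at_def
  by (auto intro: exI[of _ "take p prog"] exI[of _ "drop p prog"] simp: min_def)
    (metis append_take_drop_id length_take min.absorb2)

lemma code_at_append:
  "code_at prog p (xs @ ys) \<longleftrightarrow> code_at prog p xs \<and> code_at prog (p + length xs) ys"
proof (induction xs arbitrary: p)
  case Nil
  then show ?case by (auto simp: code_at_def)
next
  case (Cons x xs)
  then show ?case by (auto simp: code_at_Cons)
qed

definition reaches :: "nat \<Rightarrow> nat list \<Rightarrow> instr list \<Rightarrow> config \<Rightarrow> nat \<Rightarrow> config \<Rightarrow> bool" where
  "reaches w P prog c k c' \<longleftrightarrow> (step w P prog ^^ k) c = c'"

lemma reaches_trans: "reaches w P prog a k b \<Longrightarrow> reaches w P prog b l c \<Longrightarrow> reaches w P prog a (k + l) c"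
  unfolding reaches_def by (metis add.commute comp_apply funpow_add)

lemma reaches_step:
  "pc c < length prog \<Longrightarrow> exec w P (prog ! pc c) c = c' \<Longrightarrow> reaches w P prog c (Suc 0) c'"
  by (simp add: reaches_def step_def halted_def)

lemma exp_below_mono: "exp_below N e \<Longrightarrow> N \<le> N' \<Longrightarrow> exp_below N' e"
  by (induction e) auto

lemma ev_cong: "exp_below N e \<Longrightarrow> (\<And>x. x < N \<Longrightarrow> s x = s' x) \<Longrightarrow> ev w P M s e = ev w P M s' e"
  by (induction e) auto

lemma comp_exp_correct:
  assumes "code_at prog (pc c) (comp_exp e d)" "exp_below d e"
  shows "\<exists>c'. reaches w P prog c (exp_size e) c' \<and> pc c' = pc c + exp_size e \<and> mem c' = mem c \<and>
    reg c' d = ev w P (mem c) (reg c) e \<and> (\<forall>x<d. reg c' x = reg c x)"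
  using assms
proof (induction e arbitrary: d c)
  case (Cn v)
  then show ?case
    by (intro exI[of _ "exec w P (Const d v) c"]) (auto simp: code_at_Cons intro!: reaches_step)
next
  case (V x)
  then show ?case
    by (intro exI[of _ "exec w P (Op Or d x x) c"]) (auto simp: code_at_Cons intro!: reaches_step)
next
  case (Bin f a b)
  from Bin.prems(1) have code: "code_at prog (pc c) (comp_exp a d)"
    "code_at prog (pc c + exp_size a) (comp_exp b (d + 1))"
    "code_at prog (pc c + exp_size a + exp_size b) [Op f d d (d + 1)]"
    by (simp_all add: code_at_append code_at_Cons Suc_leI)
  from Bin.IH(1)[OF code(1)] Bin.prems(2) obtain c1 where c1:
    "reaches w P prog c (exp_size a) c1" "pc c1 = pc c + exp_size a" "mem c1 = mem c"
    "reg c1 d = ev w P (mem c) (reg c) a" "\<And>x. x < d \<Longrightarrow> reg c1 x = reg c x" by auto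
  from Bin.IH(2)[of c1 "d + 1"] code(2) Bin.prems(2) c1(2) obtain c2 where c2:
    "reaches w P prog c1 (exp_size b) c2" "pc c2 = pc c1 + exp_size b" "mem c2 = mem c1"
    "reg c2 (d + 1) = ev w P (mem c1) (reg c1) b" "\<And>x. x < d + 1 \<Longrightarrow> reg c2 x = reg c1 x"
    using exp_below_mono[of d b "d + 1"] by auto
  have b: "ev w P (mem c1) (reg c1) b = ev w P (mem c) (reg c) b"
    unfolding c1(3) by (rule ev_cong[of d]) (use Bin.prems(2) c1(5) in auto)
  let ?c3 = "exec w P (Op f d d (d + 1)) c2"
  have "reaches w P prog c2 (Suc 0) ?c3"
    using code(3) c1(2) c2(2) by (intro reaches_step) (auto simp: code_at_Cons)
  from reaches_trans[OF reaches_trans[OF c1(1) c2(1)] this]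
  show ?case using c1 c2 b
    by (intro exI[of _ ?c3]) (auto simp: add_ac)
next
  case (Ld k e cc)
  from Ld.prems(1) have code: "code_at prog (pc c) (comp_exp e d)"
    "code_at prog (pc c + exp_size e) [Load d k d cc]"
    by (simp_all add: code_at_append code_at_Cons Suc_leI)
  from Ld.IH[OF code(1)] Ld.prems(2) obtain c1 where c1:
    "reaches w P prog c (exp_size e) c1" "pc c1 = pc c + exp_size e" "mem c1 = mem c"
    "reg c1 d = ev w P (mem c) (reg c) e" "\<And>x. x < d \<Longrightarrow> reg c1 x = reg c x" by auto
  let ?c3 = "exec w P (Load d k d cc) c1"
  have "reaches w P prog c1 (Suc 0) ?c3"
    using code(2) c1(2) by (intro reaches_step) (auto simp: code_at_Cons)
  from reaches_trans[OF c1(1) this]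
  show ?case using c1 by (intro exI[of _ ?c3]) auto
next
  case (In e)
  from In.prems(1) have code: "code_at prog (pc c) (comp_exp e d)"
    "code_at prog (pc c + exp_size e) [Input d d]"
    by (simp_all add: code_at_append code_at_Cons Suc_leI)
  from In.IH[OF code(1)] In.prems(2) obtain c1 where c1:
    "reaches w P prog c (exp_size e) c1" "pc c1 = pc c + exp_size e" "mem c1 = mem c"
    "reg c1 d = ev w P (mem c) (reg c) e" "\<And>x. x < d \<Longrightarrow> reg c1 x = reg c x" by auto
  let ?c3 = "exec w P (Input d d) c1"
  have "reaches w P prog c1 (Suc 0) ?c3"
    using code(2) c1(2) by (intro reaches_step) (auto simp: code_at_Cons)
  from reaches_trans[OF c1(1) this]
  show ?case using c1 by (intro exI[of _ ?c3]) auto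
qed

lemma comp_guard_correct:
  assumes "code_at prog (pc c) (comp_exp e N @ [JumpZero N l])" "exp_below N e"
    "\<And>x. x < N \<Longrightarrow> reg c x = s x" "mem c = M"
  shows "\<exists>c'. reaches w P prog c (exp_size e + 1) c' \<and>
    pc c' = (if ev w P M s e = 0 then l else pc c + exp_size e + 1) \<and> mem c' = M \<and>
    (\<forall>x<N. reg c' x = s x)"
proof -
  from assms(1) have code: "code_at prog (pc c) (comp_exp e N)"
    "code_at prog (pc c + exp_size e) [JumpZero N l]"
    by (simp_all add: code_at_append code_at_Cons Suc_leI)
  from comp_exp_correct[OF code(1) assms(2), of w P] obtain c1 where c1:
    "reaches w P prog c (exp_size e) c1" "pc c1 = pc c + exp_size e" "mem c1 = mem c"
    "reg c1 N = ev w P (mem c) (reg c) e" "\<And>x. x < N \<Longrightarrow> reg c1 x = reg c x" by auto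
  have e: "ev w P (mem c) (reg c) e = ev w P M s e"
    unfolding assms(4) by (rule ev_cong[OF assms(2,3)])
  let ?c3 = "exec w P (JumpZero N l) c1"
  have "reaches w P prog c1 (Suc 0) ?c3"
    using code(2) c1(2) by (intro reaches_step) (auto simp: code_at_Cons)
  from reaches_trans[OF c1(1) this]
  show ?thesis using c1 assms e by (intro exI[of _ ?c3]) auto
qed

lemma goto_correct:
  assumes "code_at prog (pc c) [Const N 0, JumpZero N l]"
  shows "\<exists>c'. reaches w P prog c 2 c' \<and> pc c' = l \<and> mem c' = mem c \<and> (\<forall>x<N. reg c' x = reg c x)"
proof -
  let ?c1 = "exec w P (Const N 0) c"
  let ?c2 = "exec w P (JumpZero N l) ?c1"
  have "reaches w P prog c (Suc 0) ?c1" "reaches w P prog ?c1 (Suc 0) ?c2"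
    using assms by (auto simp: code_at_Cons intro!: reaches_step)
  from reaches_trans[OF this] show ?thesis
    by (intro exI[of _ ?c2]) (auto simp: numeral_2_eq_2)
qed

lemma comp_cmd_correct:
  assumes "bs w P M cm s t s'" "cmd_below N cm" "code_at prog (pc c) (comp_cmd N cm (pc c))"
    "\<And>x. x < N \<Longrightarrow> reg c x = s x" "mem c = M"
  shows "\<exists>k c'. k \<le> cmd_size cm * (t + 1) \<and> reaches w P prog c k c' \<and> pc c' = pc c + cmd_size cm \<and>
    mem c' = M \<and> (\<forall>x<N. reg c' x = s' x)"
  using assms
proof (induction arbitrary: c rule: bs.induct)
  case (bs_Asg x e s)
  from bs_Asg.prems have code: "code_at prog (pc c) (comp_exp e N)"
    "code_at prog (pc c + exp_size e) [Op Or x N N]" and e: "exp_below N e"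
    by (simp_all add: code_at_append code_at_Cons Suc_leI)
  from comp_exp_correct[OF code(1) e, of w P] obtain c1 where c1:
    "reaches w P prog c (exp_size e) c1" "pc c1 = pc c + exp_size e" "mem c1 = mem c"
    "reg c1 N = ev w P (mem c) (reg c) e" "\<And>x. x < N \<Longrightarrow> reg c1 x = reg c x" by auto
  have e: "ev w P (mem c) (reg c) e = ev w P M s e"
    unfolding bs_Asg.prems(4) by (rule ev_cong[OF e bs_Asg.prems(3)])
  let ?c3 = "exec w P (Op Or x N N) c1"
  have "reaches w P prog c1 (Suc 0) ?c3"
    using code(2) c1(2) by (intro reaches_step) (auto simp: code_at_Cons)
  from reaches_trans[OF c1(1) this]
  show ?case using c1 bs_Asg.prems e
    by (intro exI[of _ "exp_size e + 1"] exI[of _ ?c3]) auto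
next
  case (bs_Sq a s t s' b t' s'')
  from bs_Sq.prems have code: "code_at prog (pc c) (comp_cmd N a (pc c))"
    "code_at prog (pc c + cmd_size a) (comp_cmd N b (pc c + cmd_size a))"
    by (simp_all add: code_at_append code_at_Cons Suc_leI)
  from bs_Sq.IH(1)[OF _ code(1)] bs_Sq.prems obtain k1 c1 where c1:
    "k1 \<le> cmd_size a * (t + 1)" "reaches w P prog c k1 c1" "pc c1 = pc c + cmd_size a" "mem c1 = M"
    "\<And>x. x < N \<Longrightarrow> reg c1 x = s' x" by auto
  from bs_Sq.IH(2)[of c1] code(2) bs_Sq.prems c1 obtain k2 c2 where c2:
    "k2 \<le> cmd_size b * (t' + 1)" "reaches w P prog c1 k2 c2" "pc c2 = pc c1 + cmd_size b" "mem c2 = M"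
    "\<And>x. x < N \<Longrightarrow> reg c2 x = s'' x" by auto
  have "k1 + k2 \<le> cmd_size (a ;; b) * (t + t' + 1)"
    using c1(1) c2(1) by (auto simp: algebra_simps)
  with reaches_trans[OF c1(2) c2(2)] c1 c2 show ?case
    by (intro exI[of _ "k1 + k2"] exI[of _ c2]) auto
next
  case (bs_IteT s e a t s' b)
  let ?l = "pc c + exp_size e + cmd_size a + 3"
  let ?p = "pc c + exp_size e + 1"
  have "code_at prog (pc c) ((comp_exp e N @ [JumpZero N ?l]) @ comp_cmd N a ?p @
      [Const N 0, JumpZero N (?l + cmd_size b)] @ comp_cmd N b ?l)"
    using bs_IteT.prems(2) by (simp add: add_ac)
  then have code: "code_at prog (pc c) (comp_exp e N @ [JumpZero N ?l])"
    "code_at prog ?p (comp_cmd N a ?p)"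
    "code_at prog (?p + cmd_size a) [Const N 0, JumpZero N (?l + cmd_size b)]"
    by (simp_all add: code_at_append code_at_Cons Suc_leI)
  from comp_guard_correct[OF code(1) _ bs_IteT.prems(3,4), of w P] bs_IteT.prems(1) bs_IteT.hyps(1)
  obtain c1 where c1: "reaches w P prog c (exp_size e + 1) c1" "pc c1 = ?p" "mem c1 = M"
    "\<And>x. x < N \<Longrightarrow> reg c1 x = s x" by auto
  from bs_IteT.IH[of c1] code(2) bs_IteT.prems c1 obtain k2 c2 where c2:
    "k2 \<le> cmd_size a * (t + 1)" "reaches w P prog c1 k2 c2" "pc c2 = pc c1 + cmd_size a" "mem c2 = M"
    "\<And>x. x < N \<Longrightarrow> reg c2 x = s' x" by auto
  have "code_at prog (pc c2) [Const N 0, JumpZero N (?l + cmd_size b)]"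
    using code(3) c1(2) c2(3) by (simp add: add_ac)
  from goto_correct[OF this, of w P] obtain c3 where c3:
    "reaches w P prog c2 2 c3" "pc c3 = ?l + cmd_size b" "mem c3 = mem c2"
    "\<And>x. x < N \<Longrightarrow> reg c3 x = reg c2 x" by auto
  from reaches_trans[OF reaches_trans[OF c1(1) c2(2)] c3(1)]
  have "reaches w P prog c (exp_size e + 1 + k2 + 2) c3" .
  moreover have "exp_size e + 1 + k2 + 2 \<le> cmd_size (Ite e a b) * (t + 1)"
    using c2(1) by (auto simp: algebra_simps)
  ultimately show ?case using c2 c3
    by (intro exI[of _ "exp_size e + 1 + k2 + 2"] exI[of _ c3]) auto
next
  case (bs_IteF s e b t s' a)
  let ?l = "pc c + exp_size e + cmd_size a + 3"
  let ?p = "pc c + exp_size e + 1"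
  have "code_at prog (pc c) ((comp_exp e N @ [JumpZero N ?l]) @ comp_cmd N a ?p @
      [Const N 0, JumpZero N (?l + cmd_size b)] @ comp_cmd N b ?l)"
    using bs_IteF.prems(2) by (simp add: add_ac)
  then have code: "code_at prog (pc c) (comp_exp e N @ [JumpZero N ?l])"
    "code_at prog ?l (comp_cmd N b ?l)"
    by (simp_all add: code_at_append code_at_Cons numeral_eq_Suc Suc_leI)
  from comp_guard_correct[OF code(1) _ bs_IteF.prems(3,4), of w P] bs_IteF.prems(1) bs_IteF.hyps(1)
  obtain c1 where c1: "reaches w P prog c (exp_size e + 1) c1" "pc c1 = ?l" "mem c1 = M"
    "\<And>x. x < N \<Longrightarrow> reg c1 x = s x" by auto
  from bs_IteF.IH[of c1] code(2) bs_IteF.prems c1 obtain k2 c2 where c2: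
    "k2 \<le> cmd_size b * (t + 1)" "reaches w P prog c1 k2 c2" "pc c2 = pc c1 + cmd_size b" "mem c2 = M"
    "\<And>x. x < N \<Longrightarrow> reg c2 x = s' x" by auto
  from reaches_trans[OF c1(1) c2(2)]
  have "reaches w P prog c (exp_size e + 1 + k2) c2" .
  moreover have "exp_size e + 1 + k2 \<le> cmd_size (Ite e a b) * (t + 1)"
    using c2(1) by (auto simp: algebra_simps)
  ultimately show ?case using c1 c2
    by (intro exI[of _ "exp_size e + 1 + k2"] exI[of _ c2]) auto
next
  case (bs_WhT s e a t s' t' s'')
  let ?l = "pc c + exp_size e + cmd_size a + 3"
  let ?p = "pc c + exp_size e + 1"
  have "code_at prog (pc c) ((comp_exp e N @ [JumpZero N ?l]) @ comp_cmd N a ?p @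
      [Const N 0, JumpZero N (pc c)])"
    using bs_WhT.prems(2) by (simp add: add_ac)
  then have code: "code_at prog (pc c) (comp_exp e N @ [JumpZero N ?l])"
    "code_at prog ?p (comp_cmd N a ?p)"
    "code_at prog (?p + cmd_size a) [Const N 0, JumpZero N (pc c)]"
    by (simp_all add: code_at_append code_at_Cons Suc_leI)
  from comp_guard_correct[OF code(1) _ bs_WhT.prems(3,4), of w P] bs_WhT.prems(1) bs_WhT.hyps(1)
  obtain c1 where c1: "reaches w P prog c (exp_size e + 1) c1" "pc c1 = ?p" "mem c1 = M"
    "\<And>x. x < N \<Longrightarrow> reg c1 x = s x" by auto
  from bs_WhT.IH(1)[of c1] code(2) bs_WhT.prems c1 obtain k2 c2 where c2:
    "k2 \<le> cmd_size a * (t + 1)" "reaches w P prog c1 k2 c2" "pc c2 = pc c1 + cmd_size a" "mem c2 = M"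
    "\<And>x. x < N \<Longrightarrow> reg c2 x = s' x" by auto
  have "code_at prog (pc c2) [Const N 0, JumpZero N (pc c)]"
    using code(3) c1(2) c2(3) by (simp add: add_ac)
  from goto_correct[OF this, of w P] obtain c3 where c3:
    "reaches w P prog c2 2 c3" "pc c3 = pc c" "mem c3 = mem c2"
    "\<And>x. x < N \<Longrightarrow> reg c3 x = reg c2 x" by auto
  from bs_WhT.IH(2)[of c3] bs_WhT.prems c2 c3 obtain k4 c4 where c4:
    "k4 \<le> cmd_size (Wh e a) * (t' + 1)" "reaches w P prog c3 k4 c4"
    "pc c4 = pc c + cmd_size (Wh e a)" "mem c4 = M"
    "\<And>x. x < N \<Longrightarrow> reg c4 x = s'' x" by auto
  from reaches_trans[OF reaches_trans[OF reaches_trans[OF c1(1) c2(2)] c3(1)] c4(2)]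
  have "reaches w P prog c (exp_size e + 1 + k2 + 2 + k4) c4" .
  moreover have "exp_size e + 1 + k2 + 2 + k4 \<le> cmd_size (Wh e a) * (Suc (t + t') + 1)"
    using c2(1) c4(1) by (auto simp: algebra_simps)
  ultimately show ?case using c4
    by (intro exI[of _ "exp_size e + 1 + k2 + 2 + k4"] exI[of _ c4]) auto
next
  case (bs_WhF s e a)
  let ?l = "pc c + exp_size e + cmd_size a + 3"
  have "code_at prog (pc c) ((comp_exp e N @ [JumpZero N ?l]) @ comp_cmd N a (pc c + exp_size e + 1) @
      [Const N 0, JumpZero N (pc c)])"
    using bs_WhF.prems(2) by (simp add: add_ac)
  then have code: "code_at prog (pc c) (comp_exp e N @ [JumpZero N ?l])"
    by (simp_all add: code_at_append code_at_Cons Suc_leI)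
  from comp_guard_correct[OF code(1) _ bs_WhF.prems(3,4), of w P] bs_WhF.prems(1) bs_WhF.hyps(1)
  obtain c1 where c1: "reaches w P prog c (exp_size e + 1) c1" "pc c1 = ?l" "mem c1 = M"
    "\<And>x. x < N \<Longrightarrow> reg c1 x = s x" by auto
  then show ?case by (intro exI[of _ "exp_size e + 1"] exI[of _ c1]) auto
qed

lemma outputs_withinI:
  assumes "bs w P (mem (init_config w D P)) cm ((\<lambda>_. 0)(0 := w, 1 := length P)) t s'"
    "cmd_below N cm" "0 < N" "s' 0 = y" "real (cmd_size cm) * (real t + 1) \<le> B"
  shows "outputs_within w (comp_cmd N cm 0) D P y B"
proof -
  let ?c = "init_config w D P"
  have "code_at (comp_cmd N cm 0) (pc ?c) (comp_cmd N cm (pc ?c))"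
    by (auto simp: init_config_def code_at_def)
  from comp_cmd_correct[OF assms(1,2) this] obtain k c' where
    k: "k \<le> cmd_size cm * (t + 1)" "reaches w P (comp_cmd N cm 0) ?c k c'" "pc c' = cmd_size cm"
      "\<forall>x<N. reg c' x = s' x"
    by (auto simp: init_config_def)
  have "real k \<le> real (cmd_size cm * (t + 1))" using k(1) by (simp only: of_nat_le_iff)
  then have "real k \<le> B" using assms(5) by (simp add: algebra_simps)
  with k assms show ?thesis
    unfolding outputs_within_def reaches_def Let_def halted_def by (intro exI[of _ k]) auto
qed

definition wp :: "nat \<Rightarrow> nat list \<Rightarrow> (nat \<Rightarrow> nat) \<Rightarrow> cmd \<Rightarrow> (nat \<Rightarrow> nat) \<Rightarrow> (nat \<Rightarrow> (nat \<Rightarrow> nat) \<Rightarrow> bool) \<Rightarrow> bool" where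
  "wp w P M c s Q \<longleftrightarrow> (\<exists>t s'. bs w P M c s t s' \<and> Q t s')"

lemma wp_Asg: "Q 0 (s(x := ev w P M s e)) \<Longrightarrow> wp w P M (Asg x e) s Q"
  unfolding wp_def by (blast intro: bs.intros)

lemma wp_Sq: "wp w P M a s (\<lambda>t s'. wp w P M b s' (\<lambda>t'. Q (t + t'))) \<Longrightarrow> wp w P M (a ;; b) s Q"
  unfolding wp_def by (blast intro: bs.intros)

lemma wp_Ite: "(ev w P M s e \<noteq> 0 \<Longrightarrow> wp w P M a s Q) \<Longrightarrow> (ev w P M s e = 0 \<Longrightarrow> wp w P M b s Q) \<Longrightarrow>
    wp w P M (Ite e a b) s Q"
  unfolding wp_def by (cases "ev w P M s e = 0") (blast intro: bs.intros)+

lemma wp_mono: "wp w P M c s Q \<Longrightarrow> (\<And>t s'. Q t s' \<Longrightarrow> Q' t s') \<Longrightarrow> wp w P M c s Q'"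
  unfolding wp_def by blast

text \<open>\<open>I k\<close> is the loop invariant when \<open>k\<close> further iterations suffice, \<open>B\<close> a bound on the ticks of
  the loop body.\<close>

lemma wp_Wh:
  assumes "I k s"
    and step: "\<And>k s. I k s \<Longrightarrow> ev w P M s e \<noteq> 0 \<Longrightarrow>
      k > 0 \<and> wp w P M a s (\<lambda>t s'. t \<le> B \<and> I (k - 1) s')"
    and final: "\<And>t k s'. I k s' \<Longrightarrow> ev w P M s' e = 0 \<Longrightarrow> t \<le> k0 * (B + 1) \<Longrightarrow> Q t s'" and "k \<le> k0"
  shows "wp w P M (Wh e a) s Q"
proof -
  have "\<exists>t k' s'. bs w P M (Wh e a) s t s' \<and> t \<le> k * (B + 1) \<and> I k' s' \<and> ev w P M s' e = 0"
    using \<open>I k s\<close>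
  proof (induction k arbitrary: s)
    case 0
    then have "ev w P M s e = 0" using step by blast
    then show ?case using 0 by (auto intro: bs_WhF)
  next
    case (Suc k)
    show ?case
    proof (cases "ev w P M s e = 0")
      case True
      then show ?thesis using Suc.prems bs_WhF[OF True] by (intro exI[of _ 0] exI[of _ "Suc k"]) auto
    next
      case False
      from step[OF Suc.prems False] obtain t s1 where 1: "bs w P M a s t s1" "t \<le> B" "I k s1"
        unfolding wp_def by auto
      from Suc.IH[OF 1(3)] obtain t' k' s' where
        2: "bs w P M (Wh e a) s1 t' s'" "t' \<le> k * (B + 1)" "I k' s'" "ev w P M s' e = 0" by blast
      from bs_WhT[OF False 1(1) 2(1)] 1(2) 2 show ?thesis
        by (intro exI[of _ "Suc (t + t')"] exI[of _ k'] exI[of _ s']) auto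
    qed
  qed
  then obtain t k' s' where r: "bs w P M (Wh e a) s t s'" "t \<le> k * (B + 1)" "I k' s'"
    "ev w P M s' e = 0" by blast
  have "k * (B + 1) \<le> k0 * (B + 1)" using \<open>k \<le> k0\<close> by (rule mult_le_mono1)
  with r have "Q t s'" by (intro final) auto
  with r(1) show ?thesis unfolding wp_def by blast
qed

section \<open>Static hashing by multiplication and shifting\<close>

definition mshift :: "nat \<Rightarrow> nat \<Rightarrow> nat \<Rightarrow> nat \<Rightarrow> nat" where
  "mshift w a s x = (a * x mod 2 ^ w) div 2 ^ (w - s)"

lemma mshift_less: "s \<le> w \<Longrightarrow> mshift w a s x < 2 ^ s"
  unfolding mshift_def
  by (simp add: less_mult_imp_div_less flip: power_add)

lemma card_odd_below: "card {c::nat. c < 2 ^ Suc m \<and> odd c} = 2 ^ m"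
proof -
  have "{c::nat. c < 2 ^ Suc m \<and> odd c} = (\<lambda>i. 2 * i + 1) ` {..<2 ^ m}"
    by (auto simp: image_iff elim!: oddE)
  then show ?thesis by (simp add: card_image inj_on_def)
qed

lemma int_mod_pow2: "int (a mod 2 ^ k) = int a mod 2 ^ k"
  by (simp add: zmod_int)

lemma int_less_pow2: "a < 2 ^ k \<Longrightarrow> int a < 2 ^ k"
  by (metis of_nat_less_iff of_nat_numeral of_nat_power)

lemma int_div_mod_pow2: "int a = 2 ^ k * int (a div 2 ^ k) + int (a mod 2 ^ k)"
  by (simp add: zdiv_int zmod_int)

lemma mshift_collisions_less:
  assumes "y < x" "x < 2 ^ w" "s \<le> w"
  shows "card {a. a < 2 ^ w \<and> odd a \<and> mshift w a s x = mshift w a s y} \<le> 2 ^ (w - s)"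
proof -
  define D where "D = x - y"
  have D: "0 < D" "D < 2 ^ w" using assms by (auto simp: D_def)
  obtain j c where "D = 2 ^ j * c" "odd c"
    using D(1)
  proof (induction D arbitrary: thesis rule: less_induct)
    case (less D)
    show ?case
    proof (cases "odd D")
      case True then show ?thesis using less.prems(1)[of 0 D] by simp
    next
      case False
      then obtain E where E: "D = 2 * E" by blast
      show ?thesis
      proof (rule less.IH[of E])
        fix j c assume "E = 2 ^ j * c" "odd c"
        then show thesis using less.prems(1)[of "Suc j" c] E by simp
      qed (use E less.prems in auto)
    qed
  qed
  note jc = this
  have c0: "c > 0" using jc(2) by (cases c) auto
  have jw: "j < w"
  proof (rule ccontr)
    assume "\<not> j < w"
    then have "(2::nat) ^ w \<le> 2 ^ j" by simp
    also have "\<dots> \<le> D" using jc c0 by simp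
    finally show False using D by simp
  qed
  define k where "k = w - s"
  have kw: "k \<le> w" by (simp add: k_def)
  let ?Bad = "{a. a < 2 ^ w \<and> odd a \<and> mshift w a s x = mshift w a s y}"
  let ?C = "{c'::nat. c' < 2 ^ (w - j) \<and> odd c' \<and> (2 ^ j * c' < 2 ^ k \<or> 2 ^ w - 2 ^ k < 2 ^ j * c')}"
  let ?f = "\<lambda>a. (a div 2 ^ (w - j), a * c mod 2 ^ (w - j))"
  have ww: "(2::nat) ^ w = 2 ^ j * 2 ^ (w - j)" using jw by (simp flip: power_add)
  have inj: "inj_on ?f ?Bad"
  proof (rule inj_onI)
    fix a b assume ab: "?f a = ?f b"
    have "int (a * c mod 2 ^ (w - j)) = int (b * c mod 2 ^ (w - j))" using ab by simp
    then have "int (a * c) mod 2 ^ (w - j) = int (b * c) mod 2 ^ (w - j)" by (simp only: int_mod_pow2)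
    then have "2 ^ (w - j) dvd (int a - int b) * int c"
      by (simp add: mod_eq_dvd_iff algebra_simps)
    moreover have "coprime (2 ^ (w - j)) (int c)" using jc(2) by simp
    ultimately have "2 ^ (w - j) dvd int a - int b"
      using coprime_dvd_mult_left_iff by blast
    then have "int a mod 2 ^ (w - j) = int b mod 2 ^ (w - j)"
      by (simp add: mod_eq_dvd_iff)
    then have "a mod 2 ^ (w - j) = b mod 2 ^ (w - j)"
      by (simp only: int_mod_pow2[symmetric] of_nat_eq_iff)
    moreover have "a div 2 ^ (w - j) = b div 2 ^ (w - j)" using ab by simp
    ultimately show "a = b" by (metis div_mult_mod_eq)
  qed
  have sub: "?f ` ?Bad \<subseteq> {..<2 ^ j} \<times> ?C"
  proof safe
    fix a :: nat assume a: "a < 2 ^ w" "odd a" "mshift w a s x = mshift w a s y"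
    show "a div 2 ^ (w - j) < 2 ^ j" using a(1) ww
      by (simp add: less_mult_imp_div_less mult.commute)
    let ?c = "a * c mod 2 ^ (w - j)"
    show "?c < 2 ^ (w - j)" by simp
    show oc: "even ?c \<Longrightarrow> False" using a(2) jc(2) jw by (simp add: dvd_mod_iff)
    then have c1: "?c > 0" by (rule_tac ccontr) simp
    assume nu: "\<not> 2 ^ w - 2 ^ k < 2 ^ j * ?c"
    define u where "u = a * x mod 2 ^ w"
    define v where "v = a * y mod 2 ^ w"
    have uv: "u div 2 ^ k = v div 2 ^ k" using a(3) by (simp add: mshift_def u_def v_def k_def)
    have uvw: "u < 2 ^ w" "v < 2 ^ w" by (simp_all add: u_def v_def)
    have near: "\<bar>int u - int v\<bar> < 2 ^ k"
    proof -
      have "int u = 2 ^ k * int (v div 2 ^ k) + int (u mod 2 ^ k)"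
        unfolding uv[symmetric] by (rule int_div_mod_pow2)
      moreover have "int v = 2 ^ k * int (v div 2 ^ k) + int (v mod 2 ^ k)"
        by (rule int_div_mod_pow2)
      moreover have "int (u mod 2 ^ k) < 2 ^ k" "int (v mod 2 ^ k) < 2 ^ k"
        by (rule int_less_pow2, simp)+
      ultimately show ?thesis by linarith
    qed
    have "2 ^ j * ?c = 2 ^ j * (a * c) mod 2 ^ w"
      by (subst ww) (rule mult_mod_right)
    also have "2 ^ j * (a * c) = a * D" by (simp only: jc(1) mult.left_commute)
    finally have "int (2 ^ j * ?c) = int (a * D) mod 2 ^ w" by (simp add: zmod_int)
    also have "int (a * D) = int (a * x) - int (a * y)"
      using assms(1) by (simp add: D_def of_nat_diff algebra_simps)
    also have "\<dots> mod 2 ^ w = (int u - int v) mod 2 ^ w"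
      by (simp add: u_def v_def zmod_int mod_diff_eq)
    finally have e: "int (2 ^ j * ?c) = (int u - int v) mod 2 ^ w" .
    show "2 ^ j * ?c < 2 ^ k"
    proof (cases "v \<le> u")
      case True
      moreover have "int u < 2 ^ w" using uvw by (simp add: int_less_pow2)
      ultimately have "(int u - int v) mod 2 ^ w = int u - int v"
        by (intro mod_pos_pos_trivial) linarith+
      then have "int (2 ^ j * ?c) < int (2 ^ k)" using e near by simp
      then show ?thesis by (simp only: of_nat_less_iff)
    next
      case False
      have "int v < 2 ^ w" using uvw by (simp add: int_less_pow2)
      then have "(int u - int v + 2 ^ w) mod 2 ^ w = int u - int v + 2 ^ w"
        using False by (intro mod_pos_pos_trivial) linarith+
      then have "int (2 ^ j * ?c) = int u - int v + 2 ^ w" using e by simp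
      then have "int (2 ^ j * ?c) > int (2 ^ w) - int (2 ^ k)" using near by simp
      moreover have "int (2 ^ w) - int (2 ^ k) = int (2 ^ w - 2 ^ k)"
        using kw by (simp add: of_nat_diff)
      ultimately have "2 ^ w - 2 ^ k < 2 ^ j * ?c" by (simp only: of_nat_less_iff)
      then show ?thesis using nu by simp
    qed
  qed
  have C: "card ?C * 2 ^ j \<le> 2 ^ k"
  proof (cases "j < k")
    case True
    let ?O = "{c::nat. c < 2 ^ Suc (k - j - 1) \<and> odd c}"
    have kj: "(2::nat) ^ k = 2 ^ j * 2 ^ (k - j)" using True by (simp flip: power_add)
    have S: "Suc (k - j - 1) = k - j" using True by simp
    have "?C \<subseteq> ?O \<union> (\<lambda>c. 2 ^ (w - j) - c) ` ?O"
    proof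
      fix c' assume c': "c' \<in> ?C"
      show "c' \<in> ?O \<union> (\<lambda>c. 2 ^ (w - j) - c) ` ?O"
      proof (cases "2 ^ j * c' < 2 ^ k")
        case True
        then have "c' < 2 ^ (k - j)" unfolding kj by simp
        then show ?thesis using c' S by simp
      next
        case False
        then have *: "2 ^ j * 2 ^ (w - j) - 2 ^ j * 2 ^ (k - j) < 2 ^ j * c'" using c' ww kj by simp
        then have "2 ^ j * (2 ^ (w - j) - 2 ^ (k - j)) < 2 ^ j * c'"
          by (simp only: diff_mult_distrib2)
        then have "2 ^ (w - j) - 2 ^ (k - j) < c'" by simp
        moreover have "c' < 2 ^ (w - j)" using c' by simp
        ultimately have "2 ^ (w - j) - c' < 2 ^ (k - j)" by linarith
        moreover have "odd (2 ^ (w - j) - c')" using c' jw by simp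
        moreover have "c' = 2 ^ (w - j) - (2 ^ (w - j) - c')" using c' by simp
        ultimately show ?thesis using S by (intro UnI2 image_eqI) auto
      qed
    qed
    moreover have f: "finite ?O" by simp
    ultimately have "card ?C \<le> card (?O \<union> (\<lambda>c. 2 ^ (w - j) - c) ` ?O)" by (intro card_mono) auto
    also have "\<dots> \<le> card ?O + card ?O"
      using card_image_le[OF f, of "\<lambda>c. 2 ^ (w - j) - c"]
        card_Un_le[of ?O "(\<lambda>c. 2 ^ (w - j) - c) ` ?O"] by linarith
    also have "\<dots> = 2 ^ (k - j)" unfolding card_odd_below using S by (metis mult_2 power_Suc)
    finally show ?thesis unfolding kj by (simp add: mult.commute)
  next
    case False
    then have kj: "(2::nat) ^ k \<le> 2 ^ j" by simp
    have "?C = {}"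
    proof (rule ccontr)
      assume "?C \<noteq> {}"
      then obtain c' :: nat where c': "c' < 2 ^ (w - j)" "odd c'" "2 ^ j * c' < 2 ^ k \<or> 2 ^ w - 2 ^ k < 2 ^ j * c'"
        by auto
      have "c' > 0" using c'(2) by (cases c') auto
      then have "2 ^ j \<le> 2 ^ j * c'" by simp
      then have "\<not> 2 ^ j * c' < 2 ^ k" using kj by linarith
      moreover have "2 ^ j * (c' + 1) \<le> 2 ^ w" unfolding ww using c'(1) by (intro mult_le_mono2) simp
      then have "2 ^ j * c' \<le> 2 ^ w - 2 ^ j" by simp
      then have "\<not> 2 ^ w - 2 ^ k < 2 ^ j * c'" using kj by linarith
      ultimately show False using c'(3) by blast
    qed
    then show ?thesis by (simp only: card.empty mult_0 le0)
  qed
  have "finite ?C" by simp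
  have "card ?Bad = card (?f ` ?Bad)" using inj by (simp add: card_image)
  also have "\<dots> \<le> card ({..<(2::nat) ^ j} \<times> ?C)"
    using sub by (intro card_mono finite_cartesian_product) auto
  also have "\<dots> \<le> 2 ^ k" using C by (simp add: card_cartesian_product mult.commute)
  finally show ?thesis by (simp add: k_def)
qed

lemma mshift_universal:
  assumes "x \<noteq> y" "x < 2 ^ w" "y < 2 ^ w" "s \<le> w"
  shows "card {a. a < 2 ^ w \<and> odd a \<and> mshift w a s x = mshift w a s y} \<le> 2 ^ (w - s)"
proof (cases "y < x")
  case True then show ?thesis using assms by (intro mshift_collisions_less)
next
  case False
  then show ?thesis using mshift_collisions_less[of x y w s] assms by (simp add: eq_commute)
qed

definition collisions :: "nat \<Rightarrow> nat \<Rightarrow> nat \<Rightarrow> nat set \<Rightarrow> (nat \<times> nat) set" where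
  "collisions w a s S = {(x, y) \<in> S \<times> S. x \<noteq> y \<and> mshift w a s x = mshift w a s y}"

lemma finite_collisions: "finite S \<Longrightarrow> finite (collisions w a s S)"
  by (rule finite_subset[of _ "S \<times> S"]) (auto simp: collisions_def)

lemma few_collisions:
  assumes "finite S" "S \<subseteq> {..<2 ^ w}" "s \<le> w" "1 \<le> w"
  shows "\<exists>a<2 ^ w. card (collisions w a s S) * 2 ^ s \<le> 2 * (card S * (card S - 1))"
proof (rule ccontr)
  assume "\<not> ?thesis"
  then have big: "card (collisions w a s S) * 2 ^ s > 2 * (card S * (card S - 1))" if "a < 2 ^ w" for a
    using that by force
  let ?A = "{a::nat. a < 2 ^ w \<and> odd a}"
  let ?Q = "{(x, y) \<in> S \<times> S. x \<noteq> y}"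
  have A: "card ?A = 2 ^ (w - 1)" using card_odd_below[of "w - 1"] assms(4) by simp
  have fQ: "finite ?Q" using assms(1) by (rule_tac finite_subset[of _ "S \<times> S"]) auto
  have Q: "card ?Q = card S * (card S - 1)"
  proof -
    have "?Q = (SIGMA x:S. S - {x})" by auto
    then show ?thesis using assms(1) by (simp add: card_SigmaI)
  qed
  have "(\<Sum>a\<in>?A. card (collisions w a s S)) = (\<Sum>a\<in>?A. \<Sum>p\<in>?Q. of_bool (p \<in> collisions w a s S))"
  proof (rule sum.cong[OF refl])
    fix a
    have "(\<Sum>p\<in>?Q. of_bool (p \<in> collisions w a s S)) = card (?Q \<inter> {p. p \<in> collisions w a s S})"
      using fQ by (simp add: sum_of_bool_eq)
    also have "?Q \<inter> {p. p \<in> collisions w a s S} = collisions w a s S" by (auto simp: collisions_def)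
    finally show "card (collisions w a s S) = (\<Sum>p\<in>?Q. of_bool (p \<in> collisions w a s S))" by simp
  qed
  also have "\<dots> = (\<Sum>p\<in>?Q. \<Sum>a\<in>?A. of_bool (p \<in> collisions w a s S))" by (rule sum.swap)
  also have "\<dots> \<le> (\<Sum>p\<in>?Q. 2 ^ (w - s))"
  proof (rule sum_mono)
    fix p assume "p \<in> ?Q"
    then obtain x y where p: "p = (x, y)" "x \<in> S" "y \<in> S" "x \<noteq> y" by auto
    have "(\<Sum>a\<in>?A. of_bool (p \<in> collisions w a s S)) = card (?A \<inter> {a. p \<in> collisions w a s S})"
      by (simp add: sum_of_bool_eq)
    also have "?A \<inter> {a. p \<in> collisions w a s S} = {a. a < 2 ^ w \<and> odd a \<and> mshift w a s x = mshift w a s y}"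
      using p by (auto simp: collisions_def)
    also have "card \<dots> \<le> 2 ^ (w - s)" using p assms by (intro mshift_universal) auto
    finally show "(\<Sum>a\<in>?A. of_bool (p \<in> collisions w a s S)) \<le> (2::nat) ^ (w - s)" by simp
  qed
  finally have 1: "(\<Sum>a\<in>?A. card (collisions w a s S)) \<le> card S * (card S - 1) * 2 ^ (w - s)"
    using Q by simp
  have ne: "?A \<noteq> {}" using A by (metis card.empty power_eq_0_iff zero_neq_numeral)
  have "2 ^ (w - 1) * (2 * (card S * (card S - 1))) = (\<Sum>a\<in>?A. 2 * (card S * (card S - 1)))"
    using A by simp
  also have "\<dots> < (\<Sum>a\<in>?A. card (collisions w a s S) * 2 ^ s)"
    using ne by (intro sum_strict_mono big) auto
  also have "\<dots> = (\<Sum>a\<in>?A. card (collisions w a s S)) * 2 ^ s" by (simp add: sum_distrib_right)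
  also have "\<dots> \<le> card S * (card S - 1) * 2 ^ (w - s) * 2 ^ s" using 1 by (rule mult_le_mono1)
  also have "\<dots> = card S * (card S - 1) * (2 ^ (w - s) * 2 ^ s)" by simp
  also have "(2::nat) ^ (w - s) * 2 ^ s = 2 * 2 ^ (w - 1)"
    using assms by (metis le_add_diff_inverse2 power_add power_minus_mult Suc_le_eq mult.commute One_nat_def)
  finally show False by simp
qed

lemma pow2_between: "1 \<le> m \<Longrightarrow> \<exists>s. m \<le> 2 ^ s \<and> 2 ^ s \<le> 2 * (m::nat)"
proof (induction m rule: dec_induct)
  case base then show ?case by (intro exI[of _ 0]) auto
next
  case (step m)
  then obtain s where s: "m \<le> 2 ^ s" "2 ^ s \<le> 2 * m" by blast
  show ?case
  proof (cases "m = 2 ^ s")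
    case True then show ?thesis by (intro exI[of _ "Suc s"]) auto
  next
    case False then show ?thesis using s by (intro exI[of _ s]) auto
  qed
qed

lemma perfect_mshift:
  assumes "finite S" "S \<subseteq> {..<2 ^ w}" "4 * (card S)\<^sup>2 \<le> 2 ^ w" "1 \<le> w"
  shows "\<exists>a s. a < 2 ^ w \<and> s \<le> w \<and> 2 ^ s \<le> 4 * (card S)\<^sup>2 + 1 \<and> inj_on (mshift w a s) S"
proof (cases "S = {}")
  case True then show ?thesis by (intro exI[of _ 0]) auto
next
  case False
  then have N: "card S \<ge> 1" using assms(1) by (simp add: Suc_leI card_gt_0_iff)
  then obtain s where s: "2 * (card S)\<^sup>2 \<le> 2 ^ s" "2 ^ s \<le> 2 * (2 * (card S)\<^sup>2)"
    using pow2_between[of "2 * (card S)\<^sup>2"] by auto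
  have "(2::nat) ^ s \<le> 2 ^ w" using s assms(3) by linarith
  then have sw: "s \<le> w" by simp
  from few_collisions[OF assms(1,2) sw assms(4)] obtain a where
    a: "a < 2 ^ w" "card (collisions w a s S) * 2 ^ s \<le> 2 * (card S * (card S - 1))" by blast
  note a(2)
  also have "2 * (card S * (card S - 1)) < 2 * (card S)\<^sup>2" using N by (simp add: power2_eq_square)
  also have "\<dots> \<le> 2 ^ s" by (rule s(1))
  finally have "card (collisions w a s S) = 0" by (cases "card (collisions w a s S)") auto
  moreover note finite_collisions[OF assms(1)]
  ultimately have "collisions w a s S = {}" by simp
  then have "inj_on (mshift w a s) S" by (fastforce simp: collisions_def inj_on_def)
  then show ?thesis using a(1) sw s by (intro exI[of _ a] exI[of _ s]) auto
qed

text \<open>The two-level scheme of Fredman, Komlos and Szemeredi.\<close>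

lemma two_level_hashing:
  assumes "finite S" "S \<subseteq> {..<2 ^ w}" "S \<noteq> {}" "12 * card S \<le> 2 ^ w" "1 \<le> w"
  shows "\<exists>a s as ss. a < 2 ^ w \<and> s \<le> w \<and> 2 ^ s \<le> 2 * card S \<and>
    (\<forall>i<2 ^ s. as i < 2 ^ w \<and> ss i \<le> w) \<and> (\<Sum>i<2 ^ s. 2 ^ ss i) \<le> 14 * card S \<and>
    (\<forall>x\<in>S. \<forall>y\<in>S. mshift w a s x = mshift w a s y \<longrightarrow>
      mshift w (as (mshift w a s x)) (ss (mshift w a s x)) x =
      mshift w (as (mshift w a s x)) (ss (mshift w a s x)) y \<longrightarrow> x = y)"
proof -
  let ?N = "card S"
  have N: "?N \<ge> 1" using assms by (simp add: Suc_leI card_gt_0_iff)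
  then obtain s where s: "?N \<le> 2 ^ s" "2 ^ s \<le> 2 * ?N" using pow2_between by blast
  have "(2::nat) ^ s \<le> 2 ^ w" using s assms(4) by linarith
  then have sw: "s \<le> w" by simp
  from few_collisions[OF assms(1,2) sw assms(5)] obtain a where
    a: "a < 2 ^ w" "card (collisions w a s S) * 2 ^ s \<le> 2 * (?N * (?N - 1))" by blast
  let ?h = "mshift w a s"
  define B where "B i = {x \<in> S. ?h x = i}" for i
  have fB: "finite (B i)" for i using assms(1) by (simp add: B_def)
  have "card (collisions w a s S) * 2 ^ s \<le> 2 * ?N * 2 ^ s"
  proof -
    have "2 * (?N * (?N - 1)) \<le> 2 * ?N * ?N" by simp
    also have "\<dots> \<le> 2 * ?N * 2 ^ s" using s(1) by (rule mult_le_mono2)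
    finally show ?thesis using a(2) by linarith
  qed
  then have coll: "card (collisions w a s S) \<le> 2 * ?N" by simp
  have "(\<Sum>i<2 ^ s. (card (B i))\<^sup>2) = card (\<Union>i<2 ^ s. B i \<times> B i)"
    using fB by (subst card_UN_disjoint) (auto simp: B_def card_cartesian_product power2_eq_square)
  also have "(\<Union>i<2 ^ s. B i \<times> B i) \<subseteq> collisions w a s S \<union> (\<lambda>x. (x, x)) ` S"
    by (auto simp: B_def collisions_def)
  then have "card (\<Union>i<2 ^ s. B i \<times> B i) \<le> card (collisions w a s S \<union> (\<lambda>x. (x, x)) ` S)"
    using assms(1) by (intro card_mono) (auto intro: finite_collisions)
  also have "\<dots> \<le> card (collisions w a s S) + card ((\<lambda>x. (x, x)) ` S)" by (rule card_Un_le)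
  also have "\<dots> \<le> 3 * ?N" using coll card_image_le[OF assms(1), of "\<lambda>x. (x, x)"] by simp
  finally have sq: "(\<Sum>i<2 ^ s. (card (B i))\<^sup>2) \<le> 3 * ?N" .
  have "\<exists>a' s'. a' < 2 ^ w \<and> s' \<le> w \<and> 2 ^ s' \<le> 4 * (card (B i))\<^sup>2 + 1 \<and> inj_on (mshift w a' s') (B i)"
    if i: "i < 2 ^ s" for i
  proof (rule perfect_mshift)
    have "(card (B i))\<^sup>2 \<le> (\<Sum>i<2 ^ s. (card (B i))\<^sup>2)" using i by (intro member_le_sum) auto
    then show "4 * (card (B i))\<^sup>2 \<le> 2 ^ w" using sq assms(4) by linarith
  qed (use fB assms in \<open>auto simp: B_def\<close>)
  then obtain as ss where as: "\<And>i. i < 2 ^ s \<Longrightarrow> as i < 2 ^ w \<and> ss i \<le> w \<and>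
      2 ^ ss i \<le> 4 * (card (B i))\<^sup>2 + 1 \<and> inj_on (mshift w (as i) (ss i)) (B i)" by metis
  have "(\<Sum>i<2 ^ s. 2 ^ ss i) \<le> (\<Sum>i<2 ^ s. 4 * (card (B i))\<^sup>2 + 1)" using as by (intro sum_mono) auto
  also have "\<dots> = 4 * (\<Sum>i<2 ^ s. (card (B i))\<^sup>2) + 2 ^ s" unfolding sum.distrib by (simp add: sum_distrib_left)
  also have "\<dots> \<le> 14 * ?N" using sq s(2) by linarith
  finally have tot: "(\<Sum>i<2 ^ s. 2 ^ ss i) \<le> 14 * ?N" .
  have "x = y" if "x \<in> S" "y \<in> S" "?h x = ?h y"
      "mshift w (as (?h x)) (ss (?h x)) x = mshift w (as (?h x)) (ss (?h x)) y" for x y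
  proof -
    have "inj_on (mshift w (as (?h x)) (ss (?h x))) (B (?h x))" using as mshift_less[OF sw] by blast
    moreover have "x \<in> B (?h x)" "y \<in> B (?h x)" using that by (auto simp: B_def)
    ultimately show ?thesis using that(4) by (auto dest: inj_onD)
  qed
  then show ?thesis using a(1) sw s(2) as tot
    by (intro exI[of _ a] exI[of _ s] exI[of _ as] exI[of _ ss]) blast
qed

lemma allocate:
  assumes "finite X"
  shows "\<exists>off. (\<forall>x\<in>X. off x + sz x \<le> (\<Sum>x\<in>X. sz x)) \<and>
    (\<forall>x\<in>X. \<forall>y\<in>X. \<forall>i<sz x. \<forall>j<sz y. off x + i = off y + j \<longrightarrow> x = y \<and> i = (j::nat))"
  using assms
proof (induction X)
  case empty then show ?case by auto
next
  case (insert z X)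
  then obtain off where off: "\<forall>x\<in>X. off x + sz x \<le> sum sz X"
    "\<And>x y i j. x \<in> X \<Longrightarrow> y \<in> X \<Longrightarrow> i < sz x \<Longrightarrow> j < sz y \<Longrightarrow> off x + i = off y + j \<Longrightarrow> x = y \<and> i = j"
    by blast
  let ?off = "off(z := sum sz X)"
  have "\<forall>x\<in>insert z X. ?off x + sz x \<le> sum sz (insert z X)"
    using insert off by auto
  moreover have "x = y \<and> i = j" if xy: "x \<in> insert z X" "y \<in> insert z X" "i < sz x" "j < sz y"
    "?off x + i = ?off y + j" for x y i j
  proof (cases "x = z \<or> y = z")
    case True
    consider "x = z" "y = z" | "x = z" "y \<noteq> z" | "x \<noteq> z" "y = z" using True by blast
    then show ?thesis
    proof cases
      case 1 then show ?thesis using xy by simp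
    next
      case 2
      then have "off y + sz y \<le> sum sz X" using xy off by blast
      then show ?thesis using 2 xy by simp
    next
      case 3
      then have "off x + sz x \<le> sum sz X" using xy off by blast
      then show ?thesis using 3 xy by simp
    qed
  next
    case False
    then show ?thesis using xy off(2)[of x y i j] by auto
  qed
  ultimately show ?case by (intro exI[of _ ?off]) blast
qed

definition spread :: "'a set \<Rightarrow> ('a \<Rightarrow> nat) \<Rightarrow> ('a \<Rightarrow> nat) \<Rightarrow> ('a \<Rightarrow> nat \<Rightarrow> nat) \<Rightarrow> nat \<Rightarrow> nat" where
  "spread X off sz val i = (if \<exists>x\<in>X. \<exists>t<sz x. i = off x + t
     then (let (x, t) = (SOME (x, t). x \<in> X \<and> t < sz x \<and> i = off x + t) in val x t) else 0)"

lemma spread_eq: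
  assumes "x \<in> X" "t < sz x"
    and "\<forall>x\<in>X. \<forall>y\<in>X. \<forall>i<sz x. \<forall>j<sz y. off x + i = off y + j \<longrightarrow> x = y \<and> i = j"
  shows "spread X off sz val (off x + t) = val x t"
proof -
  have "(SOME (x', t'). x' \<in> X \<and> t' < sz x' \<and> off x + t = off x' + t') = (x, t)"
  proof (rule some_equality)
    fix p assume "case p of (x', t') \<Rightarrow> x' \<in> X \<and> t' < sz x' \<and> off x + t = off x' + t'"
    then obtain x' t' where p: "p = (x', t')" "x' \<in> X" "t' < sz x'" "off x + t = off x' + t'" by (cases p) auto
    then have "x = x' \<and> t = t'" using assms by blast
    then show "p = (x, t)" using p by simp
  qed (use assms in auto)
  then show ?thesis using assms(1,2) by (auto simp: spread_def)
qed

lemma spread_cases: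
  assumes "spread X off sz val i \<noteq> 0"
  obtains x t where "x \<in> X" "t < sz x" "i = off x + t" "spread X off sz val i = val x t"
proof -
  have ex: "\<exists>x\<in>X. \<exists>t<sz x. i = off x + t" using assms by (auto simp: spread_def split: if_splits)
  then obtain p where p: "case p of (x, t) \<Rightarrow> x \<in> X \<and> t < sz x \<and> i = off x + t" by auto
  obtain x t where xt: "(SOME (x, t). x \<in> X \<and> t < sz x \<and> i = off x + t) = (x, t)" by fastforce
  have "x \<in> X \<and> t < sz x \<and> i = off x + t"
    using someI[of "\<lambda>(x, t). x \<in> X \<and> t < sz x \<and> i = off x + t", OF p] xt by simp
  then show ?thesis using that[of x t] ex xt by (auto simp: spread_def)
qed

section \<open>Packed memory and parallel comparison\<close>

lemma digits_less:
  assumes "\<And>j. j < N \<Longrightarrow> g j < b" shows "(\<Sum>j<N. g j * b ^ j) < (b::nat) ^ N"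
  using assms
proof (induction N)
  case (Suc N)
  then have "(\<Sum>j<N. g j * b ^ j) < b ^ N" "g N + 1 \<le> b" by (auto simp: Suc_leI)
  then have "(\<Sum>j<N. g j * b ^ j) + g N * b ^ N < (g N + 1) * b ^ N" by (simp add: algebra_simps)
  also have "\<dots> \<le> b * b ^ N" using \<open>g N + 1 \<le> b\<close> by (rule mult_le_mono1)
  finally show ?case by simp
qed simp

lemma digits_div:
  assumes "\<And>j. j < N \<Longrightarrow> g j < b" "k \<le> N"
  shows "(\<Sum>j<N. g j * b ^ j) div (b::nat) ^ k = (\<Sum>j<N - k. g (j + k) * b ^ j)"
proof (cases "k = N")
  case True
  then show ?thesis using digits_less[OF assms(1), of N] by simp
next
  case False
  then have "b > 0" using assms by (metis gr_zeroI le_neq_implies_less not_less0)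
  have "(\<Sum>j<N. g j * b ^ j) = (\<Sum>j<k. g j * b ^ j) + (\<Sum>j=k..<N. g j * b ^ j)"
    using assms(2) by (simp add: lessThan_atLeast0 sum.atLeastLessThan_concat)
  also have "(\<Sum>j=k..<N. g j * b ^ j) = (\<Sum>j<N - k. g (j + k) * b ^ (j + k))"
    using sum.shift_bounds_nat_ivl[of "\<lambda>j. g j * b ^ j" 0 k "N - k"] assms(2)
    by (simp add: lessThan_atLeast0)
  also have "\<dots> = (\<Sum>j<N - k. g (j + k) * b ^ j) * b ^ k"
    by (simp add: sum_distrib_right power_add mult.assoc)
  finally show ?thesis using digits_less[of k g b] assms \<open>b > 0\<close> by simp
qed

lemma digits_nth:
  assumes "\<And>j. j < N \<Longrightarrow> g j < b" "k < N"
  shows "(\<Sum>j<N. g j * b ^ j) div (b::nat) ^ k mod b = g k"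
proof -
  obtain m where m: "N - k = Suc m" using assms(2) by (metis Suc_diff_Suc)
  have "(\<Sum>j<N. g j * b ^ j) div b ^ k = (\<Sum>j<Suc m. g (j + k) * b ^ j)"
    using digits_div[of N g b k] assms m by simp
  also have "\<dots> = g k + b * (\<Sum>j<m. g (Suc j + k) * b ^ j)"
    by (simp only: sum.lessThan_Suc_shift) (simp add: sum_distrib_left algebra_simps)
  finally show ?thesis using assms by simp
qed

lemma and_split:
  fixes X m Y :: nat
  assumes "m < 2 ^ S"
  shows "X AND (m + 2 ^ S * Y) = (X AND m) + 2 ^ S * ((X div 2 ^ S) AND Y)"
proof -
  let ?Z = "X AND (m + 2 ^ S * Y)"
  have "take_bit S ?Z = take_bit S X AND take_bit S (m + 2 ^ S * Y)" by (rule take_bit_and)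
  also have "take_bit S (m + 2 ^ S * Y) = take_bit S m" by (simp add: take_bit_eq_mod)
  also have "take_bit S X AND take_bit S m = take_bit S (X AND m)" by simp
  also have "\<dots> = X AND m"
  proof -
    have "m AND mask S = m" using assms by (metis take_bit_eq_mask take_bit_nat_eq_self)
    then show ?thesis by (metis take_bit_eq_mask and.assoc)
  qed
  finally have t: "?Z mod 2 ^ S = X AND m" by (simp add: take_bit_eq_mod)
  have "drop_bit S ?Z = drop_bit S X AND drop_bit S (m + 2 ^ S * Y)" by (rule drop_bit_and)
  then have d: "?Z div 2 ^ S = (X div 2 ^ S) AND Y" using assms by (simp add: drop_bit_eq_div)
  show ?thesis using t d by (metis add.commute mult_div_mod_eq)
qed

lemma and_low_mask: "X AND (2 ^ p - 1) = X mod 2 ^ p" for X :: nat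
  by (metis mask_eq_exp_minus_1 take_bit_eq_mask take_bit_eq_mod)

lemma and_field_mask:
  fixes X :: nat
  assumes "p \<le> S"
  shows "X AND (\<Sum>i<m. (2 ^ p - 1) * (2 ^ S) ^ i) = (\<Sum>i<m. (X div (2 ^ S) ^ i mod 2 ^ p) * (2 ^ S) ^ i)"
proof (induction m arbitrary: X)
  case (Suc m)
  have pS: "(2::nat) ^ p - 1 < 2 ^ S"
  proof -
    have "(2::nat) ^ p \<le> 2 ^ S" using assms by simp
    moreover have "(0::nat) < 2 ^ p" by simp
    ultimately show ?thesis by linarith
  qed
  have "(\<Sum>i<Suc m. (2 ^ p - 1) * (2 ^ S) ^ i) = (2 ^ p - 1) + 2 ^ S * (\<Sum>i<m. (2 ^ p - 1) * ((2::nat) ^ S) ^ i)"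
    by (simp only: sum.lessThan_Suc_shift) (simp add: sum_distrib_left mult.left_commute)
  then have "X AND (\<Sum>i<Suc m. (2 ^ p - 1) * (2 ^ S) ^ i) =
     X mod 2 ^ p + 2 ^ S * (\<Sum>i<m. (X div 2 ^ S div (2 ^ S) ^ i mod 2 ^ p) * (2 ^ S) ^ i)"
    using and_split[OF pS] Suc.IH[of "X div 2 ^ S"] and_low_mask[of X p] by (simp only:)
  also have "\<dots> = (\<Sum>i<Suc m. (X div (2 ^ S) ^ i mod 2 ^ p) * (2 ^ S) ^ i)"
    by (simp only: sum.lessThan_Suc_shift) (simp add: sum_distrib_left mult.left_commute div_mult2_eq)
  finally show ?case .
qed simp

lemma digit_sum_mod:
  assumes "(\<Sum>i<m. g i) < b - (1::nat)"
  shows "(\<Sum>i<m. g i * b ^ i) mod (b - 1) = (\<Sum>i<m. g i)"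
proof -
  have b: "1 \<le> b" using assms by simp
  have pw: "b ^ i mod (b - 1) = 1 mod (b - 1)" for i
  proof -
    have "b = 1 + (b - 1)" using b by simp
    then have "b mod (b - 1) = 1 mod (b - 1)" by (metis mod_add_self2)
    then show ?thesis by (metis power_mod power_one)
  qed
  have gb: "g i * b ^ i mod (b - 1) = g i mod (b - 1)" for i
  proof -
    have "g i * b ^ i mod (b - 1) = g i * (b ^ i mod (b - 1)) mod (b - 1)" by (simp only: mod_mult_right_eq)
    also have "\<dots> = g i mod (b - 1)" by (simp only: pw mod_mult_right_eq mult_1_right)
    finally show ?thesis .
  qed
  have "(\<Sum>i<m. g i * b ^ i) mod (b - 1) = (\<Sum>i<m. g i * b ^ i mod (b - 1)) mod (b - 1)"
    by (simp add: mod_sum_eq)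
  also have "\<dots> = (\<Sum>i<m. g i mod (b - 1)) mod (b - 1)"
    by (simp only: gb)
  also have "\<dots> = (\<Sum>i<m. g i) mod (b - 1)" by (simp add: mod_sum_eq)
  finally show ?thesis using assms by simp
qed

text \<open>Fields are compared in parallel: after adding \<open>2 ^ q\<close> to each and subtracting \<open>x\<close> from each,
  bit \<open>q\<close> of a field tells whether its old content was at least \<open>x\<close>.\<close>

lemma parallel_compare:
  fixes v :: "nat \<Rightarrow> nat"
  assumes "\<And>i. i < m \<Longrightarrow> v i < 2 ^ q" "x < 2 ^ q" "q < S" "m < 2 ^ S - 1"
  defines "U \<equiv> (\<Sum>i<m. (2 ^ S) ^ i)"
  shows "(((U * 2 ^ q + (\<Sum>i<m. v i * (2 ^ S) ^ i) - U * x) div 2 ^ q) AND U) mod (2 ^ S - 1)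
    = card {i. i < m \<and> x \<le> v i}"
    and "U * 2 ^ q + (\<Sum>i<m. v i * (2 ^ S) ^ i) < (2 ^ S) ^ m"
    and "U * x \<le> U * 2 ^ q + (\<Sum>i<m. v i * (2 ^ S) ^ i)"
proof -
  let ?b = "(2::nat) ^ S"
  have qS: "(2::nat) ^ q + 2 ^ q \<le> 2 ^ S"
  proof -
    have "(2::nat) ^ Suc q \<le> 2 ^ S" using assms(3) by (intro power_increasing) auto
    then show ?thesis by simp
  qed
  have e1: "U * 2 ^ q + (\<Sum>i<m. v i * ?b ^ i) = (\<Sum>i<m. (2 ^ q + v i) * ?b ^ i)"
    unfolding U_def sum_distrib_right add_mult_distrib sum.distrib by (simp add: mult.commute)
  have "2 ^ q + v i < ?b" if "i < m" for i using assms(1)[OF that] qS by linarith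
  then show "U * 2 ^ q + (\<Sum>i<m. v i * ?b ^ i) < ?b ^ m" unfolding e1 by (rule digits_less)
  have "(2 ^ q + v i) * ?b ^ i = (2 ^ q + v i - x) * ?b ^ i + x * ?b ^ i" for i
    using assms(2) by (simp flip: add_mult_distrib)
  then have e2: "(\<Sum>i<m. (2 ^ q + v i) * ?b ^ i) = (\<Sum>i<m. (2 ^ q + v i - x) * ?b ^ i) + U * x"
    unfolding U_def sum_distrib_right by (simp add: sum.distrib mult.commute)
  then show "U * x \<le> U * 2 ^ q + (\<Sum>i<m. v i * ?b ^ i)" using e1 by simp
  let ?Y = "\<Sum>i<m. (2 ^ q + v i - x) * ?b ^ i"
  have Y: "U * 2 ^ q + (\<Sum>i<m. v i * ?b ^ i) - U * x = ?Y" using e1 e2 by simp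
  have Yd: "2 ^ q + v i - x < ?b" if "i < m" for i using assms(1)[OF that] qS by linarith
  have U1: "U = (\<Sum>i<m. (2 ^ 1 - 1) * ?b ^ i)" by (simp add: U_def)
  have "(?Y div 2 ^ q) AND U = (\<Sum>i<m. (?Y div 2 ^ q div ?b ^ i mod 2 ^ 1) * ?b ^ i)"
    unfolding U1 using assms(3) by (intro and_field_mask) simp
  also have "\<dots> = (\<Sum>i<m. of_bool (x \<le> v i) * ?b ^ i)"
  proof (rule sum.cong[OF refl])
    fix i assume "i \<in> {..<m}"
    then have i: "i < m" by simp
    let ?y = "2 ^ q + v i - x"
    have "?Y div 2 ^ q div ?b ^ i = ?Y div ?b ^ i div 2 ^ q"
      by (simp only: div_mult2_eq[symmetric] mult.commute)
    moreover have "?Y div ?b ^ i div 2 ^ q mod 2 = (?Y div ?b ^ i mod ?b) div 2 ^ q mod 2"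
    proof -
      define Z where "Z = ?Y div ?b ^ i"
      have "q + Suc (S - q - 1) = S" using assms(3) by simp
      then have bb: "?b = 2 ^ q * (2 * 2 ^ (S - q - 1))" by (metis power_add power_Suc)
      have "Z mod ?b div 2 ^ q = (Z div 2 ^ q) mod (2 * 2 ^ (S - q - 1))"
        unfolding bb by (simp add: mod_mult2_eq)
      then have "Z mod ?b div 2 ^ q mod 2 = Z div 2 ^ q mod 2" by (simp add: mod_mod_cancel)
      then show ?thesis unfolding Z_def by simp
    qed
    moreover have "?Y div ?b ^ i mod ?b = ?y" by (rule digits_nth[OF Yd i])
    ultimately have "?Y div 2 ^ q div ?b ^ i mod 2 = ?y div 2 ^ q mod 2" by simp
    also have "\<dots> = of_bool (x \<le> v i)"
    proof (cases "x \<le> v i")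
      case True
      then have "?y = 2 ^ q + (v i - x)" "v i - x < 2 ^ q" using assms(1)[OF i] by auto
      then have "?y div 2 ^ q = Suc ((v i - x) div 2 ^ q)" by (simp only: div_add_self1)
      also have "(v i - x) div 2 ^ q = 0" using \<open>v i - x < 2 ^ q\<close> by (rule div_less)
      finally have "?y div 2 ^ q = 1" by (simp only: One_nat_def)
      then show ?thesis using True by simp
    next
      case False
      then have "?y < 2 ^ q" using assms(2) by linarith
      then show ?thesis using False by simp
    qed
    finally show "(?Y div 2 ^ q div ?b ^ i mod 2 ^ 1) * ?b ^ i = of_bool (x \<le> v i) * ?b ^ i" by simp
  qed
  finally have "((?Y div 2 ^ q) AND U) mod (?b - 1) = (\<Sum>i<m. of_bool (x \<le> v i) * ?b ^ i) mod (?b - 1)"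
    by simp
  also have "\<dots> = (\<Sum>i<m. of_bool (x \<le> v i))"
  proof (rule digit_sum_mod)
    have "(\<Sum>i<m. of_bool (x \<le> v i)) \<le> (\<Sum>i<m. 1::nat)" by (intro sum_mono) auto
    then show "(\<Sum>i<m. of_bool (x \<le> v i)) < ?b - 1" using assms(4) by simp
  qed
  also have "\<dots> = card {i. i < m \<and> x \<le> v i}"
    by (simp add: sum_of_bool_eq Collect_conj_eq lessThan_def)
  finally show "(((U * 2 ^ q + (\<Sum>i<m. v i * ?b ^ i) - U * x) div 2 ^ q) AND U) mod (?b - 1)
    = card {i. i < m \<and> x \<le> v i}" unfolding Y .
qed

lemma repunit_div:
  assumes "2 \<le> (b::nat)" shows "(b ^ m - 1) div (b - 1) = (\<Sum>i<m. b ^ i)"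
proof -
  have "(\<Sum>i<m. b ^ i) * (b - 1) + 1 = b ^ m"
  proof (induction m)
    case (Suc m)
    have "b ^ Suc m = b ^ m * (b - 1) + b ^ m" using assms by (simp add: algebra_simps flip: mult_Suc_right)
    then show ?case using Suc by (simp add: algebra_simps)
  qed simp
  then have "b ^ m - 1 = (\<Sum>i<m. b ^ i) * (b - 1)" by simp
  then show ?thesis using assms by simp
qed

lemma allones_shr: "k \<le> w \<Longrightarrow> ((2::nat) ^ w - 1) div 2 ^ (w - k) = 2 ^ k - 1"
proof -
  assume k: "k \<le> w"
  have "(2::nat) ^ w - 1 = (2 ^ k - 1) * 2 ^ (w - k) + (2 ^ (w - k) - 1)"
  proof -
    have "(2::nat) ^ w = 2 ^ k * 2 ^ (w - k)" using k by (simp flip: power_add)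
    moreover have "(1::nat) \<le> 2 ^ (w - k)" "2 ^ (w - k) \<le> (2::nat) ^ k * 2 ^ (w - k)" by auto
    ultimately show ?thesis by (simp add: algebra_simps)
  qed
  moreover have "((2 ^ k - 1) * 2 ^ (w - k) + (2 ^ (w - k) - 1)) div 2 ^ (w - k) = (2::nat) ^ k - 1"
    by (subst div_mult_self3) auto
  ultimately show ?thesis by simp
qed

lemma apply_Add: "a + b < 2 ^ w \<Longrightarrow> apply_op w Add a b = a + b" by simp
lemma apply_Mul: "a * b < 2 ^ w \<Longrightarrow> apply_op w Mul a b = a * b" by simp
lemma apply_Sub: "b \<le> a \<Longrightarrow> a < 2 ^ w \<Longrightarrow> apply_op w Sub a b = a - b"
proof -
  assume "b \<le> a" "a < 2 ^ w"
  then have "a + (2 ^ w - b) = (a - b) + 2 ^ w" "a - b < 2 ^ w" by auto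
  then show ?thesis by simp
qed

text \<open>
  Register 0 holds \<open>w\<close>, register 1 the pattern length, registers 3 and 4 the flags for packed and unpacked memory,
  register 2 the field width (0 in unpacked memory), register 5 the field mask and register 6 the number \<open>f\<close> of records per word.
\<close>

definition rd :: "nat \<Rightarrow> exp \<Rightarrow> exp" where
  "rd c e = Bin And
     (Bin Shr (Bin Add (Bin Mul (V 3) (Ld 39 (Bin Div e (V 6)) 0))
                       (Bin Mul (V 4) (Ld 39 (Bin Div e (V 6)) c)))
       (Bin Mul (Bin Add (Bin Mul (Bin Mod e (V 6)) (Cn 17)) (Cn c)) (V 2)))
     (V 5)"

definition all_ones :: exp where "all_ones = Bin Sub (Cn 0) (Cn 1)"
definition stride :: exp where "stride = Bin Mul (Cn 17) (V 2)"
definition base_pred :: exp where "base_pred = Bin Shr all_ones (Bin Sub (V 0) stride)"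
definition repunit :: "exp \<Rightarrow> exp" where
  "repunit m = Bin Div (Bin Shr all_ones (Bin Sub (V 0) (Bin Mul m stride))) base_pred"
definition fields :: "nat \<Rightarrow> exp \<Rightarrow> exp \<Rightarrow> exp" where
  "fields c a m = Bin And
     (Bin Shr (Ld 39 (Bin Div a (V 6)) 0)
       (Bin Mul (Bin Add (Bin Mul (Bin Mod a (V 6)) (Cn 17)) (Cn c)) (V 2)))
     (Bin Mul (repunit m) (V 5))"
definition pcount :: "nat \<Rightarrow> exp \<Rightarrow> exp \<Rightarrow> exp \<Rightarrow> exp" where
  "pcount c a m x = Bin Sub m (Bin Mod (Bin And
     (Bin Shr (Bin Sub (Bin Add (Bin Mul (repunit m) (Bin Shl (Cn 1) (V 2))) (fields c a m))
                (Bin Mul (repunit m) x)) (V 2)) (repunit m)) base_pred)"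

text \<open>
  The data consist of 17 arrays \<open>A c\<close> of \<open>q\<close>-bit fields, which must not waste space if \<open>w\<close> exceeds
  \<open>log n\<close> by far, and of 22 arrays \<open>Wt c\<close> of words, of length at most \<open>r / f\<close>. In
  packed memory one word holds \<open>f\<close> records of 17 fields; otherwise \<open>w = O(log n)\<close>, and each field takes a word.
\<close>

locale layout =
  fixes w :: nat and P :: "nat list" and M :: "nat \<Rightarrow> nat" and pk :: bool and q f :: nat
    and A Wt :: "nat \<Rightarrow> nat \<Rightarrow> nat"
  assumes w1: "1 \<le> w" and q1: "1 \<le> q" and f1: "1 \<le> f"
    and M_less: "M a < 2 ^ w"
    and A_less: "c < 17 \<Longrightarrow> A c i < 2 ^ q"
    and unpacked: "\<not> pk \<Longrightarrow> f = 1 \<and> q = w"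
    and unpacked_A: "\<not> pk \<Longrightarrow> c < 17 \<Longrightarrow> M (39 * i + c) = A c i"
    and packed: "pk \<Longrightarrow> 17 * q * f \<le> w" and f_less: "pk \<Longrightarrow> f < 2 ^ q"
    and packed_A: "pk \<Longrightarrow> M (39 * t) = (\<Sum>j<17 * f. A (j mod 17) (t * f + j div 17) * (2 ^ q) ^ j)"
    and Wt: "c < 22 \<Longrightarrow> M (39 * i + (17 + c)) = Wt c i"
begin

abbreviation "eval \<equiv> ev w P M"

definition hdr :: "(nat \<Rightarrow> nat) \<Rightarrow> bool" where
  "hdr s \<longleftrightarrow> s 0 = w \<and> s 2 = (if pk then q else 0) \<and> s 3 = of_bool pk \<and> s 4 = of_bool (\<not> pk) \<and>
     s 5 = 2 ^ q - 1 \<and> s 6 = f"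

lemma hdr_pk: "hdr s \<Longrightarrow> pk \<Longrightarrow> s 0 = w \<and> s 2 = q \<and> s 5 = 2 ^ q - 1 \<and> s 6 = f"
  unfolding hdr_def by simp

lemma w_less: "w < 2 ^ w" by (rule less_exp)

lemma packed_field:
  assumes pk "c < 17"
  shows "M (39 * (i div f)) div 2 ^ (((i mod f) * 17 + c) * q) mod 2 ^ q = A c i"
    and "((i mod f) * 17 + c) * q < 2 ^ w" "(i mod f) * 17 + c < 2 ^ w" "17 < (2::nat) ^ w"
proof -
  let ?j = "(i mod f) * 17 + c"
  have "i mod f < f" using f1 by simp
  then have "i mod f + 1 \<le> f" by simp
  moreover have "k + 1 \<le> f \<Longrightarrow> k * 17 + c < 17 * f" for k using assms(2) by linarith
  ultimately have j: "?j < 17 * f" by blast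
  have "?j * q \<le> 17 * f * q" using j by (intro mult_le_mono1) simp
  also have "\<dots> \<le> w" using packed[OF assms(1)] by (simp add: mult_ac)
  finally show jq: "?j * q < 2 ^ w" using w_less by linarith
  have "?j \<le> ?j * q" using q1 by simp
  then show "?j < 2 ^ w" using jq by linarith
  have "17 * 1 * 1 \<le> 17 * q * f" using q1 f1 by (intro mult_le_mono) auto
  then show "17 < (2::nat) ^ w" using packed[OF assms(1)] w_less by linarith
  have "M (39 * (i div f)) div (2 ^ q) ^ ?j mod 2 ^ q = A (?j mod 17) ((i div f) * f + ?j div 17)"
    unfolding packed_A[OF assms(1)]
    by (rule digits_nth[OF _ j]) (rule A_less, simp)
  moreover have "?j mod 17 = c" "?j div 17 = i mod f" using assms(2) by auto
  ultimately show "M (39 * (i div f)) div 2 ^ (?j * q) mod 2 ^ q = A c i"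
    by (simp add: power_mult[symmetric] mult.commute)
qed

lemma eval_rd:
  assumes "s 2 = (if pk then q else 0)" "s 3 = of_bool pk" "s 4 = of_bool (\<not> pk)" "s 5 = 2 ^ q - 1"
    "s 6 = f \<or> eval s e = 0" "c < 17"
  shows "eval s (rd c e) = A c (eval s e)"
proof (cases pk)
  case True
  let ?i = "eval s e"
  have d: "?i div s 6 = ?i div f" "?i mod s 6 = ?i mod f" using assms(5) by auto
  note p = packed_field(1-3)[OF True assms(6), of ?i] packed_field(4)[OF True assms(6)]
  have "c < 2 ^ w" using p(3) by simp
  then have sh: "eval s (Bin Mul (Bin Add (Bin Mul (Bin Mod e (V 6)) (Cn 17)) (Cn c)) (V 2)) =
      ((?i mod f) * 17 + c) * q"
    using p(2-4) assms(1) True by (simp add: d)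
  have "eval s (Bin Add (Bin Mul (V 3) (Ld 39 (Bin Div e (V 6)) 0))
                       (Bin Mul (V 4) (Ld 39 (Bin Div e (V 6)) c))) = M (39 * (?i div f))"
    using assms(2,3) True M_less by (simp add: d)
  with sh show ?thesis using assms(4) p(1)
    unfolding rd_def ev.simps(3)[of _ _ _ _ And] ev.simps(3)[of _ _ _ _ Shr] by (simp add: and_low_mask[unfolded One_nat_def])
next
  case False
  let ?i = "eval s e"
  have d: "?i div s 6 = ?i" using assms(5) unpacked[OF False] by auto
  show ?thesis using assms False unpacked[OF False] A_less[OF assms(6), of ?i] unpacked_A[OF False assms(6), of ?i]
    unfolding rd_def by (simp add: d and_low_mask[unfolded One_nat_def])
qed

lemma eval_rd_hdr: "hdr s \<Longrightarrow> c < 17 \<Longrightarrow> eval s (rd c e) = A c (eval s e)"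
  by (rule eval_rd) (auto simp: hdr_def)

lemma eval_all_ones: "eval s all_ones = 2 ^ w - 1"
proof -
  have "1 mod 2 ^ w = (1::nat)" using w1 by (simp add: one_mod_2_pow_eq)
  then show ?thesis by (simp add: all_ones_def)
qed

lemma eval_stride: "hdr s \<Longrightarrow> pk \<Longrightarrow> eval s stride = 17 * q" "pk \<Longrightarrow> 17 * q \<le> w"
proof -
  assume pk: pk
  have "17 * q * 1 \<le> 17 * q * f" using f1 by (intro mult_le_mono2)
  then show q: "17 * q \<le> w" using packed[OF pk] by linarith
  moreover have "17 \<le> 17 * q" using q1 by simp
  ultimately have "17 < (2::nat) ^ w" "17 * q < 2 ^ w" using w_less by linarith+
  then show "hdr s \<Longrightarrow> eval s stride = 17 * q" using hdr_pk[of s] pk by (simp add: stride_def)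
qed

lemma eval_base_pred: "hdr s \<Longrightarrow> pk \<Longrightarrow> eval s base_pred = 2 ^ (17 * q) - 1"
proof -
  assume h: "hdr s" pk
  have "apply_op w Sub w (17 * q) = w - 17 * q" using eval_stride(2)[OF h(2)] w_less by (rule apply_Sub)
  then show ?thesis unfolding base_pred_def
    using hdr_pk[OF h] eval_stride(1)[OF h] eval_stride(2)[OF h(2)] eval_all_ones allones_shr[of "17 * q" w]
    by (simp del: apply_op.simps(2))
qed

lemma eval_repunit:
  assumes "hdr s" pk "eval s m \<le> f"
  shows "eval s (repunit m) = (\<Sum>i<eval s m. (2 ^ (17 * q)) ^ i)"
proof -
  let ?m = "eval s m"
  have "?m * (17 * q) \<le> f * (17 * q)" using assms(3) by (rule mult_le_mono1)
  also have "f * (17 * q) \<le> w" using packed[OF assms(2)] by (simp add: mult_ac)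
  finally have mw: "?m * (17 * q) \<le> w" .
  have 1: "apply_op w Mul ?m (17 * q) = ?m * (17 * q)" using mw w_less by (intro apply_Mul) linarith
  have 2: "apply_op w Sub w (?m * (17 * q)) = w - ?m * (17 * q)" using mw w_less by (rule apply_Sub)
  have "eval s (repunit m) = (2 ^ (?m * (17 * q)) - 1) div (2 ^ (17 * q) - 1)"
    unfolding repunit_def using hdr_pk[OF assms(1,2)] eval_stride(1)[OF assms(1,2)] eval_base_pred[OF assms(1,2)]
      eval_all_ones allones_shr[OF mw]
    by (simp add: 1 2 del: apply_op.simps(2,3))
  also have "(2::nat) ^ (?m * (17 * q)) = (2 ^ (17 * q)) ^ ?m" by (simp flip: power_mult add: mult.commute)
  also have "((2 ^ (17 * q)) ^ ?m - 1) div (2 ^ (17 * q) - 1) = (\<Sum>i<?m. ((2::nat) ^ (17 * q)) ^ i)"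
  proof (rule repunit_div)
    have "(2::nat) ^ 1 \<le> 2 ^ (17 * q)" using q1 by (intro power_increasing) auto
    then show "(2::nat) \<le> 2 ^ (17 * q)" by simp
  qed
  finally show ?thesis .
qed

lemma eval_fields:
  assumes h: "hdr s" pk "eval s a mod f + eval s m \<le> f" "c < 17"
  shows "eval s (fields c a m) = (\<Sum>i<eval s m. A c (eval s a + i) * (2 ^ (17 * q)) ^ i)"
proof -
  let ?m = "eval s m" and ?a = "eval s a" and ?S = "17 * q"
  have mf: "?m \<le> f" using h by simp
  note p = packed_field[OF h(2,4)]
  let ?j = "(?a mod f) * 17 + c"
  have "c < 2 ^ w" using p(3)[of ?a] by simp
  then have e1: "eval s (Bin Mul (Bin Add (Bin Mul (Bin Mod a (V 6)) (Cn 17)) (Cn c)) (V 2)) = ?j * q"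
    using p(2,3)[of ?a] p(4) hdr_pk[OF h(1,2)] by simp
  have mS: "?m * ?S \<le> w"
  proof -
    have "?m * ?S \<le> f * ?S" using mf by (rule mult_le_mono1)
    also have "f * ?S \<le> w" using packed[OF h(2)] by (simp add: mult_ac)
    finally show ?thesis .
  qed
  let ?U = "\<Sum>i<?m. (2 ^ ?S) ^ i :: nat"
  have e2: "?U * (2 ^ q - 1) = (\<Sum>i<?m. (2 ^ q - 1) * (2 ^ ?S) ^ i)"
    unfolding sum_distrib_right by (simp add: mult.commute)
  have "(2::nat) ^ q \<le> 2 ^ ?S" by simp
  moreover have "(0::nat) < 2 ^ q" by simp
  ultimately have qS: "(2::nat) ^ q - 1 < 2 ^ ?S" by linarith
  have "?U * (2 ^ q - 1) < (2 ^ ?S) ^ ?m"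
    unfolding e2 by (rule digits_less) (rule qS)
  also have "((2::nat) ^ ?S) ^ ?m = 2 ^ (?m * ?S)" by (simp flip: power_mult add: mult.commute)
  also have "\<dots> \<le> 2 ^ w" using mS by simp
  finally have e3: "eval s (Bin Mul (repunit m) (V 5)) = ?U * (2 ^ q - 1)"
    using eval_repunit[OF h(1,2) mf] hdr_pk[OF h(1,2)] by simp
  have "eval s (fields c a m) = (M (39 * (?a div f)) div 2 ^ (?j * q)) AND (?U * (2 ^ q - 1))"
    using hdr_pk[OF h(1,2)] e1 e3 unfolding fields_def ev.simps(3)[of _ _ _ _ And] ev.simps(3)[of _ _ _ _ Shr] by simp
  also have "\<dots> = (\<Sum>i<?m. (M (39 * (?a div f)) div 2 ^ (?j * q) div (2 ^ ?S) ^ i mod 2 ^ q) * (2 ^ ?S) ^ i)"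
    unfolding e2 by (rule and_field_mask) simp
  also have "\<dots> = (\<Sum>i<?m. A c (?a + i) * (2 ^ ?S) ^ i)"
  proof (rule sum.cong[OF refl])
    fix i assume "i \<in> {..<?m}"
    then have i: "?a mod f + i < f" using h(3) by simp
    have "(?a + i) mod f = ?a mod f + i" using i by (metis mod_add_left_eq mod_less)
    moreover have "(?a + i) div f = ?a div f"
    proof -
      have "?a + i = f * (?a div f) + (?a mod f + i)" by simp
      then show ?thesis using i f1 by (metis add_cancel_right_right div_less div_mult_self4 not_one_le_zero)
    qed
    ultimately have "M (39 * (?a div f)) div 2 ^ ((?j + 17 * i) * q) mod 2 ^ q = A c (?a + i)"
      using p(1)[of "?a + i"] by (simp add: algebra_simps)
    moreover have "M (39 * (?a div f)) div 2 ^ (?j * q) div (2 ^ ?S) ^ i = M (39 * (?a div f)) div 2 ^ ((?j + 17 * i) * q)"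
      by (simp add: div_mult2_eq[symmetric] power_mult[symmetric] power_add[symmetric] algebra_simps)
    ultimately show "(M (39 * (?a div f)) div 2 ^ (?j * q) div (2 ^ ?S) ^ i mod 2 ^ q) * (2 ^ ?S) ^ i = A c (?a + i) * (2 ^ ?S) ^ i"
      by simp
  qed
  finally show ?thesis .
qed

lemma eval_pcount:
  assumes h: "hdr s" pk "eval s a mod f + eval s m \<le> f" "c < 17" "eval s x < 2 ^ q"
  shows "eval s (pcount c a m x) = card {i. eval s a \<le> i \<and> i < eval s a + eval s m \<and> A c i < eval s x}"
proof -
  let ?m = "eval s m" and ?a = "eval s a" and ?S = "17 * q" and ?x = "eval s x"
  have mf: "?m \<le> f" using h by simp
  let ?U = "\<Sum>i<?m. (2 ^ ?S) ^ i :: nat"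
  let ?V = "\<Sum>i<?m. A c (?a + i) * (2 ^ ?S) ^ i"
  have mS: "?m * ?S \<le> w"
  proof -
    have "?m * ?S \<le> f * ?S" using mf by (rule mult_le_mono1)
    also have "f * ?S \<le> w" using packed[OF h(2)] by (simp add: mult_ac)
    finally show ?thesis .
  qed
  have "(2::nat) ^ q * 2 \<le> 2 ^ ?S"
  proof -
    have "(2::nat) ^ Suc q \<le> 2 ^ ?S" using q1 by (intro power_increasing) auto
    then show ?thesis by simp
  qed
  moreover have "?m < 2 ^ q" using mf f_less[OF h(2)] by linarith
  moreover have "(2::nat) ^ 1 \<le> 2 ^ q" using q1 by (intro power_increasing) auto
  ultimately have mb: "?m < 2 ^ ?S - 1" by simp
  have qS: "q < ?S" using q1 by simp
  have v: "A c (?a + i) < 2 ^ q" for i using h(4) by (rule A_less)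
  note pc = parallel_compare[of ?m "\<lambda>i. A c (?a + i)" q ?x ?S, OF v h(5) qS mb]
  have "((2::nat) ^ ?S) ^ ?m = 2 ^ (?m * ?S)" by (simp flip: power_mult add: mult.commute)
  also have "\<dots> \<le> 2 ^ w" using mS by simp
  finally have lw: "?U * 2 ^ q + ?V < 2 ^ w" using pc(2) by linarith
  have "q < w" using qS eval_stride(2)[OF h(2)] by linarith
  then have e1: "eval s (Bin Shl (Cn 1) (V 2)) = 2 ^ q"
    using hdr_pk[OF h(1,2)] w1 by (simp add: one_mod_2_pow_eq)
  have e2: "apply_op w Mul ?U (2 ^ q) = ?U * 2 ^ q" using lw by (intro apply_Mul) linarith
  have e3: "apply_op w Add (?U * 2 ^ q) ?V = ?U * 2 ^ q + ?V" using lw by (rule apply_Add)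
  have e4: "apply_op w Mul ?U ?x = ?U * ?x" using lw pc(3) by (intro apply_Mul) linarith
  have e5: "apply_op w Sub (?U * 2 ^ q + ?V) (?U * ?x) = ?U * 2 ^ q + ?V - ?U * ?x"
    using pc(3) lw by (rule apply_Sub)
  let ?G = "{i. i < ?m \<and> ?x \<le> A c (?a + i)}"
  have G: "card ?G \<le> ?m" using card_mono[of "{..<?m}" ?G] by auto
  have "?m * 1 \<le> ?m * ?S" using q1 by (intro mult_le_mono2) simp
  then have mw: "?m < 2 ^ w" using w_less mS by linarith
  have e6: "apply_op w Sub ?m (card ?G) = ?m - card ?G" using G mw by (rule apply_Sub)
  have "eval s (pcount c a m x) = ?m - card ?G"
    unfolding pcount_def ev.simps(3)[of _ _ _ _ _ m] ev.simps(3) eval_repunit[OF h(1,2) mf] eval_fields[OF h(1-4)]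
      eval_base_pred[OF h(1,2)] e1[unfolded ev.simps(3)] e2 e3 e4 e5
    using hdr_pk[OF h(1,2)] pc(1) e6 by (simp del: apply_op.simps(2))
  also have "\<dots> = card ({..<?m} - ?G)" by (subst card_Diff_subset) auto
  also have "{..<?m} - ?G = {i. i < ?m \<and> A c (?a + i) < ?x}" by auto
  also have "card \<dots> = card ((\<lambda>i. ?a + i) ` {i. i < ?m \<and> A c (?a + i) < ?x})"
    by (simp add: card_image inj_on_def)
  also have "(\<lambda>i. ?a + i) ` {i. i < ?m \<and> A c (?a + i) < ?x} = {i. ?a \<le> i \<and> i < ?a + ?m \<and> A c i < ?x}"
  proof (intro equalityI subsetI)
    fix i assume "i \<in> {i. ?a \<le> i \<and> i < ?a + ?m \<and> A c i < ?x}"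
    then show "i \<in> (\<lambda>i. ?a + i) ` {i. i < ?m \<and> A c (?a + i) < ?x}"
      by (intro image_eqI[of _ _ "i - ?a"]) auto
  qed auto
  finally show ?thesis .
qed

end

definition pack_bits :: "nat \<Rightarrow> (nat \<Rightarrow> nat) \<Rightarrow> nat \<Rightarrow> bool list" where
  "pack_bits w Wd len = map (\<lambda>j. bit (Wd (j div w)) (j mod w)) [0..<len]"

lemma mem_pack_bits:
  assumes "1 \<le> w" "\<And>i. Wd i < 2 ^ min w (len - i * w)"
  shows "mem (init_config w (pack_bits w Wd len) P) = Wd"
proof
  fix i
  let ?k = "min w (len - i * w)"
  have "take w (drop (i * w) (pack_bits w Wd len)) = map (bit (Wd i)) [0..<?k]"
  proof (rule nth_equalityI)
    fix j assume "j < length (take w (drop (i * w) (pack_bits w Wd len)))"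
    then have j: "j < w" "i * w + j < len" by (auto simp: pack_bits_def)
    have "(i * w + j) div w = i" "(i * w + j) mod w = j" using j(1) by auto
    then show "take w (drop (i * w) (pack_bits w Wd len)) ! j = map (bit (Wd i)) [0..<?k] ! j"
      using j by (simp add: pack_bits_def)
  qed (auto simp: pack_bits_def)
  then have "mem (init_config w (pack_bits w Wd len) P) i = take_bit ?k (Wd i)"
    by (simp add: init_config_def horner_sum_bit_eq_take_bit)
  also have "\<dots> = Wd i" using assms(2) by (rule take_bit_nat_eq_self)
  finally show "mem (init_config w (pack_bits w Wd len) P) i = Wd i" .
qed

lemma layout_unpacked:
  assumes "1 \<le> w" "\<And>c i. c < 17 \<Longrightarrow> A c i < 2 ^ w" "\<And>c i. c < 22 \<Longrightarrow> Wt c i < 2 ^ w"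
    "\<And>c i. c < 17 \<Longrightarrow> R < i \<Longrightarrow> A c i = 0" "\<And>c i. c < 22 \<Longrightarrow> R < i \<Longrightarrow> Wt c i = 0"
  shows "\<exists>D. length D = 39 * (R + 1) * w \<and>
    (\<forall>P. layout w (mem (init_config w D P)) False w 1 A Wt)"
proof -
  define Wd where "Wd a = (if a mod 39 < 17 then A (a mod 39) (a div 39)
      else Wt (a mod 39 - 17) (a div 39))" for a
  let ?len = "39 * (R + 1) * w"
  have lw: "Wd a < 2 ^ w" for a using assms(2,3) by (auto simp: Wd_def)
  have bd: "Wd i < 2 ^ min w (?len - i * w)" for i
  proof (cases "i < 39 * (R + 1)")
    case True
    then have "(i + 1) * w \<le> ?len" by (intro mult_le_mono1) simp
    then have "min w (?len - i * w) = w" by simp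
    then show ?thesis using lw by simp
  next
    case False
    then have "39 * (R + 1) div 39 \<le> i div 39" by (intro div_le_mono) simp
    then have "R < i div 39" by simp
    then show ?thesis using assms(4,5) by (simp add: Wd_def)
  qed
  have "layout w (mem (init_config w (pack_bits w Wd ?len) P)) False w 1 A Wt" for P
    unfolding mem_pack_bits[OF assms(1) bd]
    by unfold_locales (use assms lw in \<open>auto simp: Wd_def\<close>)
  moreover have "length (pack_bits w Wd ?len) = ?len" by (simp add: pack_bits_def)
  ultimately show ?thesis by blast
qed

lemma layout_packed:
  assumes "1 \<le> q" "1 \<le> f" "17 * q * f \<le> w" "f < 2 ^ q"
    "\<And>c i. c < 17 \<Longrightarrow> A c i < 2 ^ q" "\<And>c i. c < 22 \<Longrightarrow> Wt c i < 2 ^ w"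
    "\<And>c i. c < 17 \<Longrightarrow> R < i \<Longrightarrow> A c i = 0" "\<And>c i. c < 22 \<Longrightarrow> R div f \<le> i \<Longrightarrow> Wt c i = 0"
  shows "\<exists>D. length D = (if R < f then 17 * q * (R + 1) else 39 * (R div f + 1) * w) \<and>
    (\<forall>P. layout w (mem (init_config w D P)) True q f A Wt)"
proof -
  define Pk where "Pk t = (\<Sum>j<17 * f. A (j mod 17) (t * f + j div 17) * (2 ^ q) ^ j)" for t
  define Wd where "Wd a = (if a mod 39 = 0 then Pk (a div 39)
      else if a mod 39 < 17 then 0 else Wt (a mod 39 - 17) (a div 39))" for a
  let ?len = "if R < f then 17 * q * (R + 1) else 39 * (R div f + 1) * w"
  have "17 * 1 * 1 \<le> 17 * q * f" using assms by (intro mult_le_mono) auto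
  then have w1: "1 \<le> w" using assms(3) by linarith
  have Pk_less: "Pk t < 2 ^ w" for t
  proof -
    have "Pk t < (2 ^ q) ^ (17 * f)" unfolding Pk_def by (rule digits_less) (rule assms(5), simp)
    also have "\<dots> = 2 ^ (17 * q * f)" by (simp flip: power_mult add: mult_ac)
    also have "\<dots> \<le> 2 ^ w" using assms(3) by simp
    finally show ?thesis .
  qed
  have lw: "Wd a < 2 ^ w" for a using assms(6) Pk_less by (auto simp: Wd_def)
  have Pk0: "Pk t = 0" if "R < t * f" for t
    using that assms(7) by (auto simp: Pk_def intro!: sum.neutral)
  have bd: "Wd i < 2 ^ min w (?len - i * w)" for i
  proof (cases "R < f")
    case True
    then have Rf: "R div f = 0" by simp
    show ?thesis
    proof (cases "i = 0")
      case True
      have "R + 1 \<le> f" using \<open>R < f\<close> by simp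
      then have "17 * q * (R + 1) \<le> 17 * q * f" by (rule mult_le_mono2)
      then have m: "min w (?len - i * w) = 17 * q * (R + 1)" using True \<open>R < f\<close> assms(3) by simp
      have "Pk 0 = (\<Sum>j<17 * (R + 1). A (j mod 17) (j div 17) * (2 ^ q) ^ j)"
        unfolding Pk_def
      proof (rule sum.mono_neutral_cong_right)
        show "{..<17 * (R + 1)} \<subseteq> {..<17 * f}" using \<open>R + 1 \<le> f\<close> by auto
        show "\<forall>j\<in>{..<17 * f} - {..<17 * (R + 1)}. A (j mod 17) (0 * f + j div 17) * (2 ^ q) ^ j = 0"
        proof
          fix j assume "j \<in> {..<17 * f} - {..<17 * (R + 1)}"
          then have "17 * (R + 1) div 17 \<le> j div 17" by (intro div_le_mono) simp
          then have "R < j div 17" by simp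
          then show "A (j mod 17) (0 * f + j div 17) * (2 ^ q) ^ j = 0" using assms(7) by simp
        qed
      qed auto
      also have "\<dots> < (2 ^ q) ^ (17 * (R + 1))" by (rule digits_less) (rule assms(5), simp)
      also have "\<dots> = 2 ^ (17 * q * (R + 1))" by (simp flip: power_mult add: mult_ac)
      finally show ?thesis unfolding m using True by (simp add: Wd_def)
    next
      case False
      have "Wd i = 0"
      proof (cases "i mod 39 = 0")
        case True
        then have "i div 39 \<ge> 1" using False by (metis One_nat_def Suc_leI div_eq_0_iff gr0I mod_less zero_neq_numeral)
        then have "1 * f \<le> i div 39 * f" by (rule mult_le_mono1)
        then have "R < i div 39 * f" using \<open>R < f\<close> by linarith
        then show ?thesis using True by (simp add: Wd_def Pk0)
      next
        case False
        moreover have "i mod 39 < 39" by simp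
        ultimately show ?thesis using assms(8) Rf by (auto simp: Wd_def)
      qed
      then show ?thesis by simp
    qed
  next
    case False
    show ?thesis
    proof (cases "i < 39 * (R div f + 1)")
      case True
      then have "(i + 1) * w \<le> 39 * (R div f + 1) * w" by (intro mult_le_mono1) simp
      then have "min w (?len - i * w) = w" using False by simp
      then show ?thesis using lw by simp
    next
      case F2: False
      then have "39 * (R div f + 1) div 39 \<le> i div 39" by (intro div_le_mono) simp
      then have i: "R div f < i div 39" by simp
      then have "R < i div 39 * f" using assms(2) by (metis div_less_iff_less_mult less_le_trans zero_less_one)
      moreover have "i mod 39 < 39" by simp
      ultimately have "Wd i = 0" using i assms(8)[of "i mod 39 - 17" "i div 39"] by (auto simp: Wd_def Pk0)
      then show ?thesis by simp
    qed
  qed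
  have "layout w (mem (init_config w (pack_bits w Wd ?len) P)) True q f A Wt" for P
    unfolding mem_pack_bits[OF w1 bd]
    by unfold_locales (use assms lw w1 in \<open>auto simp: Wd_def Pk_def\<close>)
  moreover have "length (pack_bits w Wd ?len) = ?len" by (simp add: pack_bits_def)
  ultimately show ?thesis by blast
qed

section \<open>The predecessor query\<close>

lemma pow2_pred: "0 < k \<Longrightarrow> (2::nat) ^ k = 2 * 2 ^ (k - 1)"
  by (cases k) auto

definition skip :: cmd where "skip = Asg 19 (Cn 0)"
definition eqE :: "exp \<Rightarrow> exp \<Rightarrow> exp" where
  "eqE a b = Bin Less (Bin Or (Bin Less a b) (Bin Less b a)) (Cn 1)"

definition hash_step :: "nat \<Rightarrow> exp \<Rightarrow> exp \<Rightarrow> exp" where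
  "hash_step wb d p = Bin Add (Ld 39 d (17 + (wb + 2)))
     (Bin Shr (Bin Mul (Ld 39 d (17 + wb)) p) (Ld 39 d (17 + (wb + 1))))"

definition slotE :: "nat \<Rightarrow> exp \<Rightarrow> exp \<Rightarrow> exp" where
  "slotE wb d p = hash_step (wb + 3) (hash_step wb d p) p"

definition level_search :: "nat \<Rightarrow> cmd" where
  "level_search wb = Wh (Bin Less (Cn 1) (Bin Sub (V 20) (V 19)))
     (Asg 21 (Bin Shr (Bin Add (V 19) (V 20)) (Cn 1)) ;;
      Asg 24 (Bin Shr (V 15) (Bin Mul (V 23) (Bin Sub (V 22) (V 21)))) ;;
      Ite (eqE (Ld 39 (slotE wb (Bin Add (V 18) (V 21)) (V 24)) (17 + (wb + 6))) (V 24))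
        (Asg 19 (V 21)) (Asg 20 (V 21)))"

definition trie_search :: "nat \<Rightarrow> nat \<Rightarrow> cmd" where
  "trie_search pb wb =
     Asg 18 (Bin Sub (V 18) (Cn 1)) ;;
     Asg 22 (rd (pb + 3) (Cn 0)) ;;
     Asg 23 (rd (pb + 4) (Cn 0)) ;;
     Asg 19 (Cn 0) ;;
     Asg 20 (V 22) ;;
     level_search wb ;;
     Asg 24 (Bin Shr (V 15) (Bin Mul (V 23) (Bin Sub (V 22) (V 19)))) ;;
     Asg 24 (slotE wb (Bin Add (V 18) (V 19)) (V 24)) ;;
     Asg 25 (Bin Mod (Bin Shr (V 15) (Bin Mul (V 23) (Bin Sub (Bin Sub (V 22) (V 19)) (Cn 1)))) (Bin Shl (Cn 1) (V 23))) ;;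
     Asg 24 (Bin Add (Ld 39 (V 24) (17 + (wb + 8)))
       (Bin Mod (Bin Shr (Ld 39 (V 24) (17 + (wb + 7))) (Bin Mul (V 25) (Bin Add (V 23) (Cn 1))))
         (Bin Shl (Cn 1) (Bin Add (V 23) (Cn 1))))) ;;
     Asg 16 (Ld 39 (V 24) (17 + (wb + 9))) ;;
     Asg 17 (Ld 39 (V 24) (17 + (wb + 10)))"

definition bsearch :: "nat \<Rightarrow> cmd" where
  "bsearch pb = Wh (Bin Less (Bin Mul (V 3) (V 6)) (Bin Sub (V 17) (V 16)))
     (Asg 21 (Bin Add (V 16) (Bin Shr (Bin Sub (V 17) (V 16)) (Cn 1))) ;;
      Ite (Bin Less (rd pb (V 21)) (V 15)) (Asg 16 (Bin Add (V 21) (Cn 1))) (Asg 17 (V 21)))"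

definition word_search :: "nat \<Rightarrow> cmd" where
  "word_search pb = Ite (V 3)
     (Asg 20 (Bin Sub (V 6) (Bin Mod (V 16) (V 6))) ;;
      Asg 21 (Bin Sub (V 17) (V 16)) ;;
      Ite (Bin Less (V 20) (V 21)) (Asg 19 (V 20)) (Asg 19 (V 21)) ;;
      Asg 20 (pcount pb (V 16) (V 19) (V 15)) ;;
      Asg 22 (Bin Add (V 16) (V 19)) ;;
      Asg 23 (Bin Sub (V 21) (V 19)) ;;
      Asg 21 (pcount pb (V 22) (V 23) (V 15)) ;;
      Asg 16 (Bin Add (V 16) (Bin Add (V 20) (V 21))))
     skip"

text \<open>
  The query takes a bucket in register 14 and a key in register 15 and leaves in register 16 the first
  index of the bucket whose key is not below the given one; higher registers are scratch. Relative to the base \<open>pb\<close>, the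
  field arrays are: keys, bucket starts, trie pointers (plus 1, 0 for no trie), \<open>L\<close>, \<open>\<beta>\<close>, \<open>e\<close>.
\<close>

definition pred_search :: "nat \<Rightarrow> nat \<Rightarrow> cmd" where
  "pred_search pb wb =
     Asg 16 (rd (pb + 1) (V 14)) ;;
     Asg 17 (rd (pb + 1) (Bin Add (V 14) (Cn 1))) ;;
     Asg 18 (rd (pb + 2) (V 14)) ;;
     Ite (V 18) (trie_search pb wb) skip ;;
     bsearch pb ;;
     word_search pb"

definition hstep :: "nat \<Rightarrow> (nat \<Rightarrow> nat \<Rightarrow> nat) \<Rightarrow> nat \<Rightarrow> nat \<Rightarrow> nat \<Rightarrow> nat" where
  "hstep w W c d p = (W (c + 2) d + (W c d * p mod 2 ^ w) div 2 ^ W (c + 1) d) mod 2 ^ w"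

definition slot :: "nat \<Rightarrow> (nat \<Rightarrow> nat \<Rightarrow> nat) \<Rightarrow> nat \<Rightarrow> nat \<Rightarrow> nat" where
  "slot w W d p = hstep w W 3 (hstep w W 0 d p) p"

definition trie_prefixes :: "nat \<Rightarrow> nat \<Rightarrow> nat set \<Rightarrow> nat \<Rightarrow> nat set" where
  "trie_prefixes L \<beta> Smp l = (\<lambda>y. y div 2 ^ (\<beta> * (L - l))) ` Smp"

definition below :: "nat \<Rightarrow> nat \<Rightarrow> nat set \<Rightarrow> nat \<Rightarrow> nat \<Rightarrow> nat" where
  "below L \<beta> Smp l p = card {y \<in> Smp. y div 2 ^ (\<beta> * (L - l)) < p}"

text \<open>The table of the trie with first-level hash descriptors at \<open>d0, \<dots>, d0 + L - 1\<close>; \<open>lo c\<close> and \<open>hi c\<close>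
  delimit the keys that lie between the \<open>c\<close>-th sample and the next one.\<close>

definition trie_ok :: "nat \<Rightarrow> (nat \<Rightarrow> nat \<Rightarrow> nat) \<Rightarrow> nat \<Rightarrow> nat \<Rightarrow> nat \<Rightarrow> nat set \<Rightarrow> (nat \<Rightarrow> nat) \<Rightarrow> (nat \<Rightarrow> nat) \<Rightarrow> bool" where
  "trie_ok w W L \<beta> d0 Smp lo hi \<longleftrightarrow>
     (\<forall>l<L. \<forall>p<2 ^ w - 1. W 6 (slot w W (d0 + l) p) = p \<longleftrightarrow> p \<in> trie_prefixes L \<beta> Smp l) \<and>
     (\<forall>l<L. \<forall>p\<in>trie_prefixes L \<beta> Smp l. \<forall>\<delta><2 ^ \<beta>.
        let e = slot w W (d0 + l) p;
            u = (W 8 e + W 7 e div 2 ^ (\<delta> * (\<beta> + 1)) mod 2 ^ (\<beta> + 1)) mod 2 ^ w;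
            c = below L \<beta> Smp (l + 1) (p * 2 ^ \<beta> + \<delta>)
        in W 9 u = lo c \<and> W 10 u = hi c)"

definition frame :: "nat \<Rightarrow> (nat \<Rightarrow> nat) \<Rightarrow> (nat \<Rightarrow> nat) \<Rightarrow> bool" where
  "frame N s s' \<longleftrightarrow> (\<forall>v<N. s' v = s v)"

context layout
begin

abbreviation "wpl \<equiv> wp w P M"

lemma hdr_upd [simp]: "6 < x \<Longrightarrow> hdr (s(x := v)) = hdr s"
  by (auto simp: hdr_def)

lemma hdr_frame: "frame N s s' \<Longrightarrow> 6 < N \<Longrightarrow> hdr s \<Longrightarrow> hdr s'"
  by (simp add: hdr_def frame_def)

lemma w_ne_0 [simp]: "w \<noteq> 0" "0 < w"
  using w1 by auto

lemma one_mod [simp]: "1 mod 2 ^ w = (1::nat)" "Suc 0 mod 2 ^ w = Suc 0"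
  using w1 by (auto simp: one_mod_2_pow_eq)

lemma eval_eqE: "eval s (eqE a b) \<noteq> 0 \<longleftrightarrow> eval s a = eval s b"
  using w1 by (auto simp: eqE_def)

lemma wp_skip: "Q 0 (s(19 := 0)) \<Longrightarrow> wpl skip s Q"
  unfolding skip_def by (rule wp_Asg) simp

lemma hdr_thr: "hdr s \<Longrightarrow> s 3 * s 6 = (if pk then f else 0)" "(if pk then f else 0) < 2 ^ w"
proof -
  show "hdr s \<Longrightarrow> s 3 * s 6 = (if pk then f else 0)" by (simp add: hdr_def)
  have "pk \<Longrightarrow> 1 * f \<le> 17 * q * f" using q1 by (intro mult_le_mono1) simp
  then have "pk \<Longrightarrow> f \<le> w" using packed by linarith
  then show "(if pk then f else 0) < 2 ^ w" using w_less by (auto intro: le_less_trans)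
qed

lemma wp_bsearch:
  assumes "hdr s" "s 16 \<le> ans" "ans \<le> s 17"
    "\<And>i. s 16 \<le> i \<Longrightarrow> i < s 17 \<Longrightarrow> A pb i < s 15 \<longleftrightarrow> i < ans" "s 17 < 2 ^ w" "s 17 - s 16 < 2 ^ T * f" "pb < 17"
  shows "wpl (bsearch pb) s (\<lambda>t s'. t \<le> T \<and> frame 16 s s' \<and> s' 16 \<le> ans \<and> ans \<le> s' 17 \<and> s 16 \<le> s' 16 \<and>
    s' 17 \<le> s 17 \<and> s' 17 - s' 16 \<le> (if pk then f else 0))"
proof -
  define I where "I k s' \<longleftrightarrow> frame 16 s s' \<and> s' 16 \<le> ans \<and> ans \<le> s' 17 \<and> s 16 \<le> s' 16 \<and>
    s' 17 \<le> s 17 \<and> s' 17 - s' 16 < 2 ^ k * f" for k s'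
  have guard: "eval s' (Bin Less (Bin Mul (V 3) (V 6)) (Bin Sub (V 17) (V 16))) =
      of_bool ((if pk then f else 0) < s' 17 - s' 16)" if "I k s'" for s' k
  proof -
    have h: "hdr s'" using that assms(1) hdr_frame[of 16 s s'] by (simp add: I_def)
    have "apply_op w Sub (s' 17) (s' 16) = s' 17 - s' 16"
      using that assms(5) by (intro apply_Sub) (auto simp: I_def)
    moreover have "apply_op w Mul (s' 3) (s' 6) = (if pk then f else 0)"
      using hdr_thr(1)[OF h] hdr_thr(2) by simp
    ultimately show ?thesis by (simp del: apply_op.simps(2,3))
  qed
  show ?thesis unfolding bsearch_def
  proof (rule wp_Wh[where I = I and k = T and B = 0])
    show "I T s" using assms by (simp add: I_def frame_def)
  next
    fix k s' assume I: "I k s'" and g: "eval s' (Bin Less (Bin Mul (V 3) (V 6)) (Bin Sub (V 17) (V 16))) \<noteq> 0"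
    from g have g: "(if pk then f else 0) < s' 17 - s' 16"
      unfolding guard[OF I] by (simp only: of_bool_eq_0_iff not_not)
    have k: "k > 0"
    proof (rule ccontr)
      assume "\<not> k > 0"
      then have "s' 17 - s' 16 < f" using I by (simp add: I_def)
      then show False using g unpacked by (auto split: if_splits)
    qed
    have h: "hdr s'" using I assms(1) hdr_frame[of 16 s s'] by (simp add: I_def)
    let ?d = "s' 17 - s' 16"
    let ?mid = "s' 16 + ?d div 2"
    have lt: "s' 16 < s' 17" using g by simp
    have s17: "s' 17 < 2 ^ w" using I assms(5) by (simp add: I_def)
    have mid: "s' 16 \<le> ?mid" "?mid < s' 17" using lt by auto
    have e: "eval s' (Bin Add (V 16) (Bin Shr (Bin Sub (V 17) (V 16)) (Cn 1))) = ?mid"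
    proof -
      have "apply_op w Sub (s' 17) (s' 16) = ?d" using lt s17 by (intro apply_Sub) auto
      moreover have "apply_op w Add (s' 16) (?d div 2) = ?mid" using mid s17 by (intro apply_Add) linarith
      ultimately show ?thesis by (simp del: apply_op.simps(1,2))
    qed
    have b: "?d < 2 ^ k * f" using I by (simp add: I_def)
    have half: "m \<le> ?d div 2 \<Longrightarrow> m < 2 ^ (k - 1) * f" for m
    proof -
      have "2 ^ k = 2 * (2::nat) ^ (k - 1)" using k by (rule pow2_pred)
      then have "?d < 2 * (2 ^ (k - 1) * f)" using b by (simp add: mult.assoc)
      then show "m \<le> ?d div 2 \<Longrightarrow> m < 2 ^ (k - 1) * f" by linarith
    qed
    have s15: "s' 15 = s 15" and ra: "s 16 \<le> s' 16" "s' 17 \<le> s 17" using I by (auto simp: I_def frame_def)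
    have cmp: "A pb ?mid < s 15 \<longleftrightarrow> ?mid < ans"
      using mid ra by (intro assms(4)) auto
    have "wpl (Asg 21 (Bin Add (V 16) (Bin Shr (Bin Sub (V 17) (V 16)) (Cn 1))) ;;
      Ite (Bin Less (rd pb (V 21)) (V 15)) (Asg 16 (Bin Add (V 21) (Cn 1))) (Asg 17 (V 21))) s'
       (\<lambda>t s'. t \<le> 0 \<and> I (k - 1) s')"
    proof (intro wp_Sq wp_Asg wp_Ite, goal_cases)
      case 1
      then have "A pb ?mid < s 15" using e h assms(7) s15 by (simp add: eval_rd_hdr del: apply_op.simps(1,2))
      then have "?mid < ans" using cmp by simp
      moreover have "s' 17 - (?mid + 1) \<le> ?d div 2" by linarith
      moreover have "?mid + 1 < 2 ^ w" using mid s17 by linarith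
      ultimately show ?case using I half[of "s' 17 - (?mid + 1)"]
        unfolding e by (simp add: I_def frame_def)
    next
      case 2
      then have "\<not> A pb ?mid < s 15" using e h assms(7) s15 by (simp add: eval_rd_hdr del: apply_op.simps(1,2))
      then have "ans \<le> ?mid" using cmp by simp
      then show ?case using I half[of "?mid - s' 16"] mid unfolding e by (simp add: I_def frame_def)
    qed
    then show "k > 0 \<and> wpl (Asg 21 (Bin Add (V 16) (Bin Shr (Bin Sub (V 17) (V 16)) (Cn 1))) ;;
      Ite (Bin Less (rd pb (V 21)) (V 15)) (Asg 16 (Bin Add (V 21) (Cn 1))) (Asg 17 (V 21))) s'
       (\<lambda>t s'. t \<le> 0 \<and> I (k - 1) s')" using k by blast
  next
    fix t k s' assume "I k s'" "eval s' (Bin Less (Bin Mul (V 3) (V 6)) (Bin Sub (V 17) (V 16))) = 0" "t \<le> T * (0 + 1)"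
    then show "t \<le> T \<and> frame 16 s s' \<and> s' 16 \<le> ans \<and> ans \<le> s' 17 \<and> s 16 \<le> s' 16 \<and>
      s' 17 \<le> s 17 \<and> s' 17 - s' 16 \<le> (if pk then f else 0)"
      using guard[of k s'] by (simp add: I_def split: if_splits)
  qed simp
qed

lemma wp_word_search:
  assumes "hdr s" "s 16 \<le> ans" "ans \<le> s 17"
    "\<And>i. s 16 \<le> i \<Longrightarrow> i < s 17 \<Longrightarrow> A pb i < s 15 \<longleftrightarrow> i < ans" "s 17 < 2 ^ w"
    "s 17 - s 16 \<le> (if pk then f else 0)" "pb < 17" "s 15 < 2 ^ q"
  shows "wpl (word_search pb) s (\<lambda>t s'. t = 0 \<and> frame 16 s s' \<and> s' 16 = ans)"
proof (cases pk)
  case False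
  then have "s 3 = 0" "ans = s 16" using assms unfolding hdr_def by auto
  then show ?thesis unfolding word_search_def
    by (intro wp_Ite) (auto intro!: wp_skip simp: frame_def)
next
  case True
  note h = hdr_pk[OF assms(1) True]
  let ?d = "s 17 - s 16"
  let ?r = "f - s 16 mod f"
  let ?m = "min ?d ?r"
  have "s 3 = 1" using assms(1) True unfolding hdr_def by simp
  have fw: "f < 2 ^ w" using hdr_thr(2) True by simp
  have smf: "s 16 mod f < f" using f1 by simp
  have df: "?d \<le> f" using assms(6) True by simp
  have le: "s 16 \<le> s 17" using assms by simp
  have e1: "apply_op w Sub f (s 16 mod f) = ?r" using smf fw by (intro apply_Sub) auto
  have e2: "apply_op w Sub (s 17) (s 16) = ?d" using le assms(5) by (rule apply_Sub)
  have e3: "apply_op w Add (s 16) ?m = s 16 + ?m" using le assms(5) by (intro apply_Add) linarith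
  have e4: "apply_op w Sub ?d ?m = ?d - ?m" using le assms(5) by (intro apply_Sub) auto
  define c1 where "c1 = card {i. s 16 \<le> i \<and> i < s 16 + ?m \<and> A pb i < s 15}"
  define c2 where "c2 = card {i. s 16 + ?m \<le> i \<and> i < s 16 + ?m + (?d - ?m) \<and> A pb i < s 15}"
  have "c1 + c2 = card ({i. s 16 \<le> i \<and> i < s 16 + ?m \<and> A pb i < s 15} \<union>
      {i. s 16 + ?m \<le> i \<and> i < s 16 + ?m + (?d - ?m) \<and> A pb i < s 15})"
    unfolding c1_def c2_def by (rule card_Un_disjoint[symmetric]) auto
  also have "{i. s 16 \<le> i \<and> i < s 16 + ?m \<and> A pb i < s 15} \<union>
      {i. s 16 + ?m \<le> i \<and> i < s 16 + ?m + (?d - ?m) \<and> A pb i < s 15} = {s 16..<ans}"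
  proof (intro equalityI subsetI)
    fix i assume "i \<in> {i. s 16 \<le> i \<and> i < s 16 + ?m \<and> A pb i < s 15} \<union>
      {i. s 16 + ?m \<le> i \<and> i < s 16 + ?m + (?d - ?m) \<and> A pb i < s 15}"
    then have "s 16 \<le> i" "i < s 17" "A pb i < s 15" using le by auto
    then show "i \<in> {s 16..<ans}" using assms(4) by simp
  next
    fix i assume "i \<in> {s 16..<ans}"
    then have "s 16 \<le> i" "i < s 17" "A pb i < s 15" using assms(3) assms(4)[of i] by auto
    then show "i \<in> {i. s 16 \<le> i \<and> i < s 16 + ?m \<and> A pb i < s 15} \<union>
      {i. s 16 + ?m \<le> i \<and> i < s 16 + ?m + (?d - ?m) \<and> A pb i < s 15}" by auto
  qed
  finally have c12: "s 16 + (c1 + c2) = ans" using assms(2) by simp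
  then have e5: "apply_op w Add c1 c2 = c1 + c2" "apply_op w Add (s 16) (c1 + c2) = ans"
    using assms(3,5) by (simp_all add: apply_Add del: apply_op.simps)
  define s1 where "s1 = s(20 := ?r, 21 := ?d, 19 := ?m)"
  have h1: "hdr s1" using assms(1) by (simp add: s1_def)
  have p1: "eval s1 (pcount pb (V 16) (V 19) (V 15)) = c1"
    unfolding c1_def by (subst eval_pcount[OF h1 True]) (use assms(7,8) smf in \<open>auto simp: s1_def\<close>)
  define s2 where "s2 = s1(20 := c1, 22 := s 16 + ?m, 23 := ?d - ?m)"
  have al: "(s 16 + ?m) mod f + (?d - ?m) \<le> f"
  proof (cases "?d \<le> ?r")
    case True
    then show ?thesis using f1 by (simp add: less_imp_le)
  next
    case False
    then have "?m = ?r" by simp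
    moreover have "s 16 = f * (s 16 div f) + s 16 mod f" by simp
    ultimately have "s 16 + ?m = f * (s 16 div f) + f" using smf by linarith
    then have "(s 16 + ?m) mod f = 0" by simp
    then show ?thesis using df by simp
  qed
  have h2: "hdr s2" using h1 by (simp add: s2_def)
  have p2: "eval s2 (pcount pb (V 22) (V 23) (V 15)) = c2"
    unfolding c2_def by (subst eval_pcount[OF h2 True]) (use assms(7,8) al in \<open>auto simp: s2_def s1_def\<close>)
  show ?thesis unfolding word_search_def
  proof (rule wp_Ite)
    show "wpl (Asg 20 (Bin Sub (V 6) (Bin Mod (V 16) (V 6))) ;;
      Asg 21 (Bin Sub (V 17) (V 16)) ;;
      Ite (Bin Less (V 20) (V 21)) (Asg 19 (V 20)) (Asg 19 (V 21)) ;;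
      Asg 20 (pcount pb (V 16) (V 19) (V 15)) ;;
      Asg 22 (Bin Add (V 16) (V 19)) ;;
      Asg 23 (Bin Sub (V 21) (V 19)) ;;
      Asg 21 (pcount pb (V 22) (V 23) (V 15)) ;;
      Asg 16 (Bin Add (V 16) (Bin Add (V 20) (V 21)))) s (\<lambda>t s'. t = 0 \<and> frame 16 s s' \<and> s' 16 = ans)"
    proof (rule wp_Sq, rule wp_Asg, rule wp_Sq, rule wp_Asg, rule wp_Sq)
      let ?s0 = "s(20 := ?r, 21 := ?d)"
      have s0: "s(20 := eval s (Bin Sub (V 6) (Bin Mod (V 16) (V 6))),
         21 := eval (s(20 := eval s (Bin Sub (V 6) (Bin Mod (V 16) (V 6))))) (Bin Sub (V 17) (V 16))) = ?s0"
        using e1 e2 h by (simp del: apply_op.simps(2))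
      have rest: "wpl (Asg 20 (pcount pb (V 16) (V 19) (V 15)) ;;
      Asg 22 (Bin Add (V 16) (V 19)) ;;
      Asg 23 (Bin Sub (V 21) (V 19)) ;;
      Asg 21 (pcount pb (V 22) (V 23) (V 15)) ;;
      Asg 16 (Bin Add (V 16) (Bin Add (V 20) (V 21)))) s1 (\<lambda>t s'. t = 0 \<and> frame 16 s s' \<and> s' 16 = ans)"
      proof -
        have 1: "s1(20 := c1, 22 := eval (s1(20 := c1)) (Bin Add (V 16) (V 19)),
            23 := eval (s1(20 := c1, 22 := eval (s1(20 := c1)) (Bin Add (V 16) (V 19)))) (Bin Sub (V 21) (V 19))) = s2"
          using e3 e4 by (simp add: s1_def s2_def del: apply_op.simps(1,2))
        show ?thesis
          by (intro wp_Sq wp_Asg, simp only: p1 1 p2)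
            (use e5 in \<open>simp add: s2_def s1_def frame_def del: apply_op.simps(1)\<close>)
      qed
      show "wpl (Ite (Bin Less (V 20) (V 21)) (Asg 19 (V 20)) (Asg 19 (V 21)))
     (s(20 := eval s (Bin Sub (V 6) (Bin Mod (V 16) (V 6))),
         21 := eval (s(20 := eval s (Bin Sub (V 6) (Bin Mod (V 16) (V 6))))) (Bin Sub (V 17) (V 16))))
     (\<lambda>t s'. wpl (Asg 20 (pcount pb (V 16) (V 19) (V 15)) ;;
      Asg 22 (Bin Add (V 16) (V 19)) ;;
      Asg 23 (Bin Sub (V 21) (V 19)) ;;
      Asg 21 (pcount pb (V 22) (V 23) (V 15)) ;;
      Asg 16 (Bin Add (V 16) (Bin Add (V 20) (V 21)))) s' (\<lambda>t'. (\<lambda>s'. (0 + (0 + (t + t'))) = 0 \<and> frame 16 s s' \<and> s' 16 = ans)))"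
        unfolding s0
        by (intro wp_Ite wp_Asg) (use rest in \<open>simp_all add: s1_def min_def not_less fun_upd_def split: if_splits\<close>)
    qed
  qed (use \<open>s 3 = 1\<close> in simp)
qed


abbreviation "Wx wb \<equiv> \<lambda>c. Wt (wb + c)"

lemma eval_hash_step:
  assumes "wb + c + 2 < 22"
  shows "eval s (hash_step (wb + c) d p) = hstep w (Wx wb) c (eval s d) (eval s p)"
  using Wt[of "wb + c" "eval s d"] Wt[of "wb + c + 1" "eval s d"] Wt[of "wb + c + 2" "eval s d"] assms
  unfolding hash_step_def hstep_def by (simp add: add_ac)

lemma eval_slotE:
  assumes "wb + 5 < 22"
  shows "eval s (slotE wb d p) = slot w (Wx wb) (eval s d) (eval s p)"
  using eval_hash_step[of wb 3 s "hash_step wb d p" p] eval_hash_step[of wb 0 s d p] assms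
  unfolding slotE_def slot_def by simp

lemma div_pow2_less: "(x::nat) < 2 ^ w \<Longrightarrow> 1 \<le> k \<Longrightarrow> x div 2 ^ k < 2 ^ w - 1"
proof -
  assume x: "x < 2 ^ w" "1 \<le> k"
  have "x div 2 ^ k \<le> x div 2 ^ 1" using x(2) by (intro div_le_mono2 power_increasing) auto
  then have "x div 2 ^ k \<le> x div 2" by simp
  moreover have "(2::nat) ^ w = 2 * 2 ^ (w - 1)" by (rule pow2_pred) simp
  moreover have "(1::nat) \<le> 2 ^ (w - 1)" by simp
  ultimately show ?thesis using x(1) by linarith
qed

lemma wp_level_search:
  assumes ok: "trie_ok w (Wx wb) L \<beta> d0 Smp lo hi" and wb: "wb + 10 < 22"
    and L: "1 \<le> L" "1 \<le> \<beta>" "2 * L * (\<beta> + 1) < 2 ^ w" "d0 + L < 2 ^ w" "L \<le> 2 ^ T"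
    and x: "x < 2 ^ w" "x div 2 ^ (\<beta> * L) \<in> trie_prefixes L \<beta> Smp 0"
    and s: "s 15 = x" "s 18 = d0" "s 22 = L" "s 23 = \<beta>" "s 19 = 0" "s 20 = L"
  shows "wpl (level_search wb) s (\<lambda>t s'. t \<le> T \<and> (\<forall>v. v \<notin> {19, 20, 21, 24} \<longrightarrow> s' v = s v) \<and> s' 19 < L \<and>
    x div 2 ^ (\<beta> * (L - s' 19)) \<in> trie_prefixes L \<beta> Smp (s' 19) \<and>
    (s' 19 + 1 = L \<or> x div 2 ^ (\<beta> * (L - (s' 19 + 1))) \<notin> trie_prefixes L \<beta> Smp (s' 19 + 1)))"
proof -
  define ex where "ex l \<longleftrightarrow> x div 2 ^ (\<beta> * (L - l)) \<in> trie_prefixes L \<beta> Smp l" for l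
  define I where "I k s' \<longleftrightarrow> (\<forall>v. v \<notin> {19, 20, 21, 24} \<longrightarrow> s' v = s v) \<and> s' 19 < s' 20 \<and> s' 20 \<le> L \<and>
    ex (s' 19) \<and> (s' 20 = L \<or> \<not> ex (s' 20)) \<and> s' 20 - s' 19 \<le> 2 ^ k" for k s'
  have Lw: "2 * L < 2 ^ w" "\<beta> * L < 2 ^ w"
  proof -
    have "2 * L * 1 \<le> 2 * L * (\<beta> + 1)" by (intro mult_le_mono2) simp
    then show "2 * L < 2 ^ w" using L(3) by linarith
    have "L * \<beta> \<le> 2 * L * (\<beta> + 1)" by (intro mult_le_mono) auto
    then show "\<beta> * L < 2 ^ w" using L(3) mult.commute[of \<beta> L] by linarith
  qed
  have guard: "eval s' (Bin Less (Cn 1) (Bin Sub (V 20) (V 19))) = of_bool (1 < s' 20 - s' 19)"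
    if "I k s'" for k s'
  proof -
    have "apply_op w Sub (s' 20) (s' 19) = s' 20 - s' 19" using that Lw by (intro apply_Sub) (auto simp: I_def)
    then show ?thesis by (simp del: apply_op.simps(2))
  qed
  show ?thesis unfolding level_search_def
  proof (rule wp_Wh[where I = I and k = T and B = 0])
    show "I T s" using s L x by (simp add: I_def ex_def)
  next
    fix k s' assume I: "I k s'" and g: "eval s' (Bin Less (Cn 1) (Bin Sub (V 20) (V 19))) \<noteq> 0"
    from g have g: "1 < s' 20 - s' 19"
      unfolding guard[OF I] by (simp only: of_bool_eq_0_iff not_not)
    have k: "k > 0" using I g by (cases k) (auto simp: I_def)
    let ?mid = "(s' 19 + s' 20) div 2"
    have mid: "s' 19 < ?mid" "?mid < s' 20" "s' 20 \<le> L" using g I by (auto simp: I_def)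
    have half: "m \<le> 2 ^ (k - 1)" if "2 * m \<le> s' 20 - s' 19 + 1" for m
    proof -
      have "2 ^ k = 2 * (2::nat) ^ (k - 1)" using k by (rule pow2_pred)
      then have "2 * m \<le> 2 * 2 ^ (k - 1) + 1" using that I by (simp add: I_def)
      then show ?thesis by linarith
    qed
    have sv: "s' 15 = x" "s' 18 = d0" "s' 22 = L" "s' 23 = \<beta>" using I s by (auto simp: I_def)
    have e1: "eval s' (Bin Shr (Bin Add (V 19) (V 20)) (Cn 1)) = ?mid"
      using mid Lw by simp
    let ?s1 = "s'(21 := ?mid)"
    let ?p = "x div 2 ^ (\<beta> * (L - ?mid))"
    have e2: "eval ?s1 (Bin Shr (V 15) (Bin Mul (V 23) (Bin Sub (V 22) (V 21)))) = ?p"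
    proof -
      have "apply_op w Sub L ?mid = L - ?mid" using mid Lw by (intro apply_Sub) auto
      moreover have "apply_op w Mul \<beta> (L - ?mid) = \<beta> * (L - ?mid)"
      proof (rule apply_Mul)
        have "\<beta> * (L - ?mid) \<le> \<beta> * L" by (intro mult_le_mono2) simp
        then show "\<beta> * (L - ?mid) < 2 ^ w" using Lw by linarith
      qed
      ultimately show ?thesis using sv by (simp del: apply_op.simps(2,3))
    qed
    let ?s2 = "s'(21 := ?mid, 24 := ?p)"
    have e3: "eval ?s2 (Ld 39 (slotE wb (Bin Add (V 18) (V 21)) (V 24)) (17 + (wb + 6))) =
        Wt (wb + 6) (slot w (Wx wb) (d0 + ?mid) ?p)"
    proof -
      have "eval ?s2 (Bin Add (V 18) (V 21)) = d0 + ?mid" using sv mid L(4) by simp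
      then show ?thesis using wb Wt[of "wb + 6" "slot w (Wx wb) (d0 + ?mid) ?p"]
        by (simp add: eval_slotE del: ev.simps(3))
    qed
    have "1 * 1 \<le> \<beta> * (L - ?mid)" using L(2) mid by (intro mult_le_mono) auto
    then have "?p < 2 ^ w - 1" using x by (intro div_pow2_less) auto
    then have e4: "Wt (wb + 6) (slot w (Wx wb) (d0 + ?mid) ?p) = ?p \<longleftrightarrow> ex ?mid"
      using ok mid unfolding trie_ok_def ex_def by auto
    have c: "eval ?s2 (eqE (Ld 39 (slotE wb (Bin Add (V 18) (V 21)) (V 24)) (17 + (wb + 6))) (V 24)) \<noteq> 0 \<longleftrightarrow> ex ?mid"
      unfolding eval_eqE e3 using e4 by simp
    have "wpl (Asg 21 (Bin Shr (Bin Add (V 19) (V 20)) (Cn 1)) ;;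
      Asg 24 (Bin Shr (V 15) (Bin Mul (V 23) (Bin Sub (V 22) (V 21)))) ;;
      Ite (eqE (Ld 39 (slotE wb (Bin Add (V 18) (V 21)) (V 24)) (17 + (wb + 6))) (V 24))
        (Asg 19 (V 21)) (Asg 20 (V 21))) s' (\<lambda>t s'. t \<le> 0 \<and> I (k - 1) s')"
      apply (rule wp_Sq, rule wp_Asg, unfold e1, rule wp_Sq, rule wp_Asg, unfold e2, rule wp_Ite)
       apply (drule c[THEN iffD1])
       apply (rule wp_Asg)
      subgoal using I mid half[of "s' 20 - ?mid"] by (auto simp: I_def)
      apply (rule wp_Asg)
      using c I mid half[of "?mid - s' 19"] by (auto simp: I_def)
    then show "k > 0 \<and> wpl (Asg 21 (Bin Shr (Bin Add (V 19) (V 20)) (Cn 1)) ;;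
      Asg 24 (Bin Shr (V 15) (Bin Mul (V 23) (Bin Sub (V 22) (V 21)))) ;;
      Ite (eqE (Ld 39 (slotE wb (Bin Add (V 18) (V 21)) (V 24)) (17 + (wb + 6))) (V 24))
        (Asg 19 (V 21)) (Asg 20 (V 21))) s' (\<lambda>t s'. t \<le> 0 \<and> I (k - 1) s')" using k by blast
  next
    fix t k s' assume "I k s'" "eval s' (Bin Less (Cn 1) (Bin Sub (V 20) (V 19))) = 0" "t \<le> T * (0 + 1)"
    moreover from this have "\<not> 1 < s' 20 - s' 19" using guard[of k s'] by (simp only: of_bool_eq_0_iff simp_thms)
    moreover from calculation have "s' 20 = s' 19 + 1" by (auto simp: I_def)
    ultimately show "t \<le> T \<and> (\<forall>v. v \<notin> {19, 20, 21, 24} \<longrightarrow> s' v = s v) \<and> s' 19 < L \<and>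
      x div 2 ^ (\<beta> * (L - s' 19)) \<in> trie_prefixes L \<beta> Smp (s' 19) \<and>
      (s' 19 + 1 = L \<or> x div 2 ^ (\<beta> * (L - (s' 19 + 1))) \<notin> trie_prefixes L \<beta> Smp (s' 19 + 1))"
      by (auto simp: I_def ex_def)
  qed simp
qed

lemma below_eq_rank:
  assumes "l + 1 = L \<or> x div 2 ^ (\<beta> * (L - (l + 1))) \<notin> trie_prefixes L \<beta> Smp (l + 1)"
  shows "below L \<beta> Smp (l + 1) (x div 2 ^ (\<beta> * (L - (l + 1)))) = card {y \<in> Smp. y < x}"
proof -
  let ?b = "2 ^ (\<beta> * (L - (l + 1))) :: nat"
  have "y div ?b < x div ?b \<longleftrightarrow> y < x" if "y \<in> Smp" for y
  proof
    assume "y div ?b < x div ?b" then show "y < x"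
      by (metis div_le_mono leD leI)
  next
    assume "y < x"
    then have le: "y div ?b \<le> x div ?b" by (intro div_le_mono) simp
    show "y div ?b < x div ?b"
    proof (cases "l + 1 = L")
      case True then show ?thesis using \<open>y < x\<close> by simp
    next
      case False
      then have "x div ?b \<notin> trie_prefixes L \<beta> Smp (l + 1)" using assms by simp
      moreover have "y div ?b \<in> trie_prefixes L \<beta> Smp (l + 1)" using that unfolding trie_prefixes_def by blast
      ultimately have "y div ?b \<noteq> x div ?b" by metis
      then show ?thesis using le by simp
    qed
  qed
  then show ?thesis unfolding below_def by (intro arg_cong[of _ _ card]) auto
qed

lemma wp_trie_search:
  assumes ok: "trie_ok w (Wx wb) L \<beta> d0 Smp lo hi" and wb: "wb + 10 < 22" and pb: "pb + 4 < 17"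
    and L: "1 \<le> L" "1 \<le> \<beta>" "2 * L * (\<beta> + 1) < 2 ^ w" "d0 + L < 2 ^ w" "L \<le> 2 ^ T" "2 ^ \<beta> * (\<beta> + 1) \<le> w"
    and x: "x < 2 ^ w" "x div 2 ^ (\<beta> * L) \<in> trie_prefixes L \<beta> Smp 0"
    and s: "hdr s" "s 15 = x" "s 18 = d0 + 1" "A (pb + 3) 0 = L" "A (pb + 4) 0 = \<beta>"
  shows "wpl (trie_search pb wb) s (\<lambda>t s'. t \<le> T \<and> frame 16 s s' \<and>
    s' 16 = lo (card {y \<in> Smp. y < x}) \<and> s' 17 = hi (card {y \<in> Smp. y < x}))"
proof -
  let ?s1 = "s(18 := d0, 22 := L, 23 := \<beta>, 19 := 0, 20 := L)"
  have e18: "eval s (Bin Sub (V 18) (Cn 1)) = d0" using s(3) L(1,4) by simp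
  have e22: "eval (s(18 := d0)) (rd (pb + 3) (Cn 0)) = L" using s pb by (simp add: eval_rd_hdr)
  have e23: "eval (s(18 := d0, 22 := L)) (rd (pb + 4) (Cn 0)) = \<beta>" using s pb by (simp add: eval_rd_hdr)
  have e19: "eval (s(18 := d0, 22 := L, 23 := \<beta>)) (Cn 0) = 0" by simp
  have e20: "eval (s(18 := d0, 22 := L, 23 := \<beta>, 19 := 0)) (V 22) = L" by simp
  have "1 * (\<beta> + 1) \<le> 2 ^ \<beta> * (\<beta> + 1)" by (intro mult_le_mono1) simp
  then have b1: "\<beta> + 1 \<le> 2 ^ \<beta> * (\<beta> + 1)" by simp
  have bw: "\<beta> + 1 < 2 ^ w" "\<beta> < w" using b1 L(6) w_less by linarith+
  have b2: "\<beta> + 1 < w"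
  proof -
    have "2 * (\<beta> + 1) \<le> 2 ^ \<beta> * (\<beta> + 1)" using L(2) by (intro mult_le_mono1) (metis One_nat_def power_one_right power_increasing one_le_numeral)
    then have "2 * (\<beta> + 1) \<le> w" using L(6) by (rule le_trans)
    then show ?thesis by simp
  qed
  have p1: "(2::nat) ^ \<beta> < 2 ^ w" "(2::nat) ^ (\<beta> + 1) < 2 ^ w" using bw b2 by (auto intro!: power_strict_increasing simp del: power_Suc)
  show ?thesis unfolding trie_search_def
    apply (rule wp_Sq, rule wp_Asg, unfold e18)
    apply (rule wp_Sq, rule wp_Asg, unfold e22)
    apply (rule wp_Sq, rule wp_Asg, unfold e23)
    apply (rule wp_Sq, rule wp_Asg, unfold e19)
    apply (rule wp_Sq, rule wp_Asg, unfold e20)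
    apply (rule wp_Sq)
  proof (rule wp_mono[OF wp_level_search[OF ok wb L(1-5) x, of ?s1]], goal_cases)
    case (7 t s')
    let ?a = "s' 19"
    let ?p = "x div 2 ^ (\<beta> * (L - ?a))"
    let ?y = "x div 2 ^ (\<beta> * (L - ?a - 1))"
    let ?d = "?y mod 2 ^ \<beta>"
    let ?e = "slot w (Wx wb) (d0 + ?a) ?p"
    let ?u = "(Wt (wb + 8) ?e + Wt (wb + 7) ?e div 2 ^ (?d * (\<beta> + 1)) mod 2 ^ (\<beta> + 1)) mod 2 ^ w"
    have sv: "s' 15 = x" "s' 18 = d0" "s' 22 = L" "s' 23 = \<beta>" "\<forall>v<16. s' v = s v" and a: "?a < L"
      using 7 s by auto
    have bL: "\<beta> * k < 2 ^ w" if "k \<le> L" for k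
    proof -
      have "k * \<beta> \<le> 2 * L * (\<beta> + 1)" using that by (intro mult_le_mono) auto
      then show ?thesis using L(3) mult.commute[of \<beta> k] by linarith
    qed
    have Lw: "L < 2 ^ w" using L(4) by linarith
    have t1: "eval s' (Bin Shr (V 15) (Bin Mul (V 23) (Bin Sub (V 22) (V 19)))) = ?p"
    proof -
      have "apply_op w Sub L ?a = L - ?a" using a Lw by (intro apply_Sub) auto
      moreover have "apply_op w Mul \<beta> (L - ?a) = \<beta> * (L - ?a)" by (intro apply_Mul bL) simp
      ultimately show ?thesis using sv by (simp del: apply_op.simps(2,3))
    qed
    have t2: "eval (s'(24 := ?p)) (slotE wb (Bin Add (V 18) (V 19)) (V 24)) = ?e"
    proof -
      have "eval (s'(24 := ?p)) (Bin Add (V 18) (V 19)) = d0 + ?a" using sv a L(4) by simp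
      then show ?thesis using wb by (simp add: eval_slotE del: ev.simps(3))
    qed
    have t3: "eval (s'(24 := ?p, 24 := ?e)) (Bin Mod (Bin Shr (V 15) (Bin Mul (V 23) (Bin Sub (Bin Sub (V 22) (V 19)) (Cn 1)))) (Bin Shl (Cn 1) (V 23))) = ?d"
    proof -
      have "apply_op w Sub L ?a = L - ?a" using a Lw by (intro apply_Sub) auto
      moreover have "apply_op w Sub (L - ?a) 1 = L - ?a - 1" using a Lw by (intro apply_Sub) auto
      moreover have "apply_op w Mul \<beta> (L - ?a - 1) = \<beta> * (L - ?a - 1)" by (intro apply_Mul bL) simp
      moreover have "apply_op w Shl 1 \<beta> = 2 ^ \<beta>" using p1 by simp
      ultimately show ?thesis using sv by (simp del: apply_op.simps(2,3,9))
    qed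
    have dw: "?d * (\<beta> + 1) < 2 ^ w"
    proof -
      have "?d * (\<beta> + 1) \<le> 2 ^ \<beta> * (\<beta> + 1)" by (intro mult_le_mono1) (simp add: less_imp_le)
      then show ?thesis using L(6) w_less by linarith
    qed
    have t4: "eval (s'(24 := ?p, 24 := ?e, 25 := ?d)) (Bin Add (Ld 39 (V 24) (17 + (wb + 8)))
       (Bin Mod (Bin Shr (Ld 39 (V 24) (17 + (wb + 7))) (Bin Mul (V 25) (Bin Add (V 23) (Cn 1))))
         (Bin Shl (Cn 1) (Bin Add (V 23) (Cn 1))))) = ?u"
    proof -
      have "apply_op w Add \<beta> 1 = \<beta> + 1" using bw by (intro apply_Add)
      moreover have "apply_op w Mul ?d (\<beta> + 1) = ?d * (\<beta> + 1)" using dw by (rule apply_Mul)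
      moreover have "apply_op w Shl 1 (\<beta> + 1) = 2 ^ (\<beta> + 1)" using p1(2) by (simp del: power_Suc)
      ultimately show ?thesis using sv wb Wt[of "wb + 8" ?e] Wt[of "wb + 7" ?e]
        by (simp del: apply_op.simps(3,9) power_Suc)
    qed
    have y: "?p * 2 ^ \<beta> + ?d = ?y"
    proof -
      have "\<beta> * (L - ?a) = \<beta> * (L - ?a - 1) + \<beta>" using a by (metis Suc_diff_Suc diff_Suc_1 diff_diff_left mult_Suc_right add.commute Suc_eq_plus1)
      then have "?p = ?y div 2 ^ \<beta>" by (simp add: power_add div_mult2_eq)
      then show ?thesis by (simp only: div_mult_mod_eq)
    qed
    have "Wt (wb + 9) ?u = lo (below L \<beta> Smp (?a + 1) (?p * 2 ^ \<beta> + ?d)) \<and>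
          Wt (wb + 10) ?u = hi (below L \<beta> Smp (?a + 1) (?p * 2 ^ \<beta> + ?d))"
    proof -
      have "?p \<in> trie_prefixes L \<beta> Smp ?a" "?d < 2 ^ \<beta>" using 7 by auto
      then show ?thesis using ok[unfolded trie_ok_def Let_def] a by blast
    qed
    moreover have "below L \<beta> Smp (?a + 1) (?p * 2 ^ \<beta> + ?d) = card {y \<in> Smp. y < x}"
      unfolding y using below_eq_rank[of ?a L x \<beta> Smp] 7 by simp
    ultimately have fin: "Wt (wb + 9) ?u = lo (card {y \<in> Smp. y < x})" "Wt (wb + 10) ?u = hi (card {y \<in> Smp. y < x})"
      by simp_all
    define u where "u = ?u"
    have "wb + 9 < 22" "wb + 10 < 22" using wb by simp_all
    then have fw: "M (39 * u + (17 + (wb + 9))) = lo (card {y \<in> Smp. y < x})"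
      "M (39 * u + (17 + (wb + 10))) = hi (card {y \<in> Smp. y < x})"
      using fin[folded u_def] by (simp_all only: Wt)
    have tT: "t \<le> T" using 7 by blast
    show ?case
      apply (rule wp_Sq, rule wp_Asg, unfold t1)
      apply (rule wp_Sq, rule wp_Asg, unfold t2)
      apply (rule wp_Sq, rule wp_Asg, unfold t3)
      apply (rule wp_Sq, rule wp_Asg, unfold t4, fold u_def)
      apply (rule wp_Sq, rule wp_Asg, rule wp_Asg)
      using fw tT sv(5) by (simp only: ev.simps fun_upd_same fun_upd_other) (simp add: frame_def)
  qed (use s in auto)
qed


lemma q_le_w: "q \<le> w"
proof (cases pk)
  case True
  have "q \<le> 17 * q" by simp
  then show ?thesis using eval_stride(2)[OF True] by linarith
qed (use unpacked in simp)

lemma pow_q_le: "x < 2 ^ q \<Longrightarrow> x < (2::nat) ^ w"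
  using q_le_w by (metis less_le_trans one_le_numeral power_increasing)

lemma wp_pred_search:
  assumes h: "hdr s" "pb + 5 < 17" "wb + 10 < 22" "s 14 = j" "s 15 = x" "j + 1 < 2 ^ w" "x < 2 ^ q"
    and ans: "A (pb + 1) j \<le> ans" "ans \<le> A (pb + 1) (j + 1)"
      "\<And>i. A (pb + 1) j \<le> i \<Longrightarrow> i < A (pb + 1) (j + 1) \<Longrightarrow> A pb i < x \<longleftrightarrow> i < ans"
    and T: "g < 2 ^ T * f"
    and notrie: "A (pb + 2) j = 0 \<Longrightarrow> A (pb + 1) (j + 1) - A (pb + 1) j \<le> g"
    and trie: "A (pb + 2) j \<noteq> 0 \<Longrightarrow> \<exists>Smp lo hi L \<beta>. L = A (pb + 3) 0 \<and> \<beta> = A (pb + 4) 0 \<and>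
      trie_ok w (Wx wb) L \<beta> (A (pb + 2) j - 1) Smp lo hi \<and> 1 \<le> L \<and> 1 \<le> \<beta> \<and>
      2 * L * (\<beta> + 1) < 2 ^ w \<and> A (pb + 2) j - 1 + L < 2 ^ w \<and> L \<le> 2 ^ T \<and> 2 ^ \<beta> * (\<beta> + 1) \<le> w \<and>
      x div 2 ^ (\<beta> * L) \<in> trie_prefixes L \<beta> Smp 0 \<and>
      A (pb + 1) j \<le> lo (card {y \<in> Smp. y < x}) \<and> lo (card {y \<in> Smp. y < x}) \<le> ans \<and>
      ans \<le> hi (card {y \<in> Smp. y < x}) \<and> hi (card {y \<in> Smp. y < x}) \<le> A (pb + 1) (j + 1) \<and>
      hi (card {y \<in> Smp. y < x}) - lo (card {y \<in> Smp. y < x}) \<le> g"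
  shows "wpl (pred_search pb wb) s (\<lambda>t s'. t \<le> 2 * T \<and> frame 16 s s' \<and> s' 16 = ans)"
proof -
  let ?st = "A (pb + 1) j" and ?en = "A (pb + 1) (j + 1)" and ?tp = "A (pb + 2) j"
  let ?s1 = "s(16 := ?st, 17 := ?en, 18 := ?tp)"
  have e16: "eval s (rd (pb + 1) (V 14)) = ?st" using h by (simp add: eval_rd_hdr)
  have e17: "eval (s(16 := ?st)) (rd (pb + 1) (Bin Add (V 14) (Cn 1))) = ?en"
    using h by (simp add: eval_rd_hdr)
  have e18: "eval (s(16 := ?st, 17 := ?en)) (rd (pb + 2) (V 14)) = ?tp" using h by (simp add: eval_rd_hdr)
  define Q where "Q s' \<longleftrightarrow> frame 16 s s' \<and> ?st \<le> s' 16 \<and> s' 16 \<le> ans \<and> ans \<le> s' 17 \<and> s' 17 \<le> ?en \<and>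
    s' 17 - s' 16 \<le> g" for s'
  have enw: "?en < 2 ^ w" using h(2) by (intro pow_q_le A_less) simp
  have 1: "wpl (Ite (V 18) (trie_search pb wb) skip) ?s1 (\<lambda>t s'. t \<le> T \<and> Q s')"
  proof (rule wp_Ite)
    assume "eval ?s1 (V 18) \<noteq> 0"
    then have tp: "?tp \<noteq> 0" by simp
    from trie[OF this] obtain Smp lo hi L \<beta> where tr: "L = A (pb + 3) 0" "\<beta> = A (pb + 4) 0"
      "trie_ok w (Wx wb) L \<beta> (A (pb + 2) j - 1) Smp lo hi" "1 \<le> L" "1 \<le> \<beta>"
      "2 * L * (\<beta> + 1) < 2 ^ w" "A (pb + 2) j - 1 + L < 2 ^ w" "L \<le> 2 ^ T" "2 ^ \<beta> * (\<beta> + 1) \<le> w"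
      "x div 2 ^ (\<beta> * L) \<in> trie_prefixes L \<beta> Smp 0"
      "A (pb + 1) j \<le> lo (card {y \<in> Smp. y < x})" "lo (card {y \<in> Smp. y < x}) \<le> ans"
      "ans \<le> hi (card {y \<in> Smp. y < x})" "hi (card {y \<in> Smp. y < x}) \<le> A (pb + 1) (j + 1)"
      "hi (card {y \<in> Smp. y < x}) - lo (card {y \<in> Smp. y < x}) \<le> g" by (elim exE conjE) (rule that; assumption)
    have "wpl (trie_search pb wb) ?s1 (\<lambda>t s'. t \<le> T \<and> frame 16 ?s1 s' \<and>
      s' 16 = lo (card {y \<in> Smp. y < x}) \<and> s' 17 = hi (card {y \<in> Smp. y < x}))"
      using h tr(1,2) tp
      by (intro wp_trie_search[OF tr(3) h(3) _ tr(4-9) pow_q_le[OF h(7)] tr(10)]) auto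
    then show "wpl (trie_search pb wb) ?s1 (\<lambda>t s'. t \<le> T \<and> Q s')"
      by (rule wp_mono) (use tr in \<open>auto simp: Q_def frame_def\<close>)
  next
    assume "eval ?s1 (V 18) = 0"
    then show "wpl skip ?s1 (\<lambda>t s'. t \<le> T \<and> Q s')"
      by (intro wp_skip) (use notrie ans in \<open>auto simp: Q_def frame_def\<close>)
  qed
  have 2: "wpl (bsearch pb) s' (\<lambda>t s''. t \<le> T \<and> Q s'' \<and> s'' 17 - s'' 16 \<le> (if pk then f else 0))"
    if Q: "Q s'" for s'
  proof (rule wp_mono[OF wp_bsearch])
    show "hdr s'" using hdr_frame[of 16 s s'] Q h(1) by (simp add: Q_def)
    show "s' 17 - s' 16 < 2 ^ T * f" using Q T by (simp add: Q_def)
    show "s' 17 < 2 ^ w" using Q enw by (simp add: Q_def)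
  qed (use Q h ans in \<open>auto simp: Q_def frame_def\<close>)
  have 3: "wpl (word_search pb) s' (\<lambda>t s''. t = 0 \<and> frame 16 s s'' \<and> s'' 16 = ans)"
    if Q: "Q s'" "s' 17 - s' 16 \<le> (if pk then f else 0)" for s'
  proof (rule wp_mono[OF wp_word_search])
    show "hdr s'" using hdr_frame[of 16 s s'] Q h(1) by (simp add: Q_def)
    show "s' 17 < 2 ^ w" using Q enw by (simp add: Q_def)
    show "s' 17 - s' 16 \<le> (if pk then f else 0)" by (rule Q(2))
  qed (use Q(1) h ans in \<open>auto simp: Q_def frame_def\<close>)
  show ?thesis unfolding pred_search_def
    apply (rule wp_Sq, rule wp_Asg, unfold e16)
    apply (rule wp_Sq, rule wp_Asg, unfold e17)
    apply (rule wp_Sq, rule wp_Asg, unfold e18)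
    apply (rule wp_Sq)
    apply (rule wp_mono[OF 1])
    apply (elim conjE, rule wp_Sq)
    apply (rule wp_mono[OF 2], assumption)
    apply (elim conjE)
    apply (rule wp_mono[OF 3], assumption, assumption)
    apply auto
    done
qed

end

section \<open>Existence of the tries\<close>

lemma spread_less:
  assumes "\<And>x t. x \<in> X \<Longrightarrow> t < sz x \<Longrightarrow> val x t < B" "0 < B"
  shows "spread X off sz val i < B"
proof (cases "spread X off sz val i = 0")
  case False
  then show ?thesis by (rule spread_cases) (use assms in auto)
qed (use assms in simp)

lemma spread_zero:
  assumes "\<And>x. x \<in> X \<Longrightarrow> off x + sz x \<le> n" "n \<le> i"
  shows "spread X off sz val i = 0"
proof (rule ccontr)
  assume "spread X off sz val i \<noteq> 0"
  then show False by (rule spread_cases) (use assms in fastforce)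
qed

lemma initial_segment_card:
  assumes "\<And>k k'. k' \<le> k \<Longrightarrow> k < n \<Longrightarrow> Q k \<Longrightarrow> Q k'" "k < n"
  shows "Q k \<longleftrightarrow> k < card {k. k < (n::nat) \<and> Q k}"
proof
  assume "Q k"
  then have "{..k} \<subseteq> {k. k < n \<and> Q k}" using assms by auto
  then have "card {..k} \<le> card {k. k < n \<and> Q k}" by (intro card_mono) auto
  then show "k < card {k. k < n \<and> Q k}" by simp
next
  assume k: "k < card {k. k < n \<and> Q k}"
  show "Q k"
  proof (rule ccontr)
    assume "\<not> Q k"
    then have "{k. k < n \<and> Q k} \<subseteq> {..<k}" using assms by (metis (mono_tags, lifting) lessThan_iff mem_Collect_eq not_le subsetI)
    then have "card {k. k < n \<and> Q k} \<le> k" using card_mono[of "{..<k}"] by fastforce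
    then show False using k by simp
  qed
qed

locale keyed =
  fixes N NB e :: nat and bk key :: "nat \<Rightarrow> nat"
  assumes bk_mono: "u \<le> v \<Longrightarrow> v < N \<Longrightarrow> bk u \<le> bk v"
    and key_mono: "u < v \<Longrightarrow> v < N \<Longrightarrow> bk u = bk v \<Longrightarrow> key u < key v"
    and bk_less: "u < N \<Longrightarrow> bk u < NB"
    and key_top: "u < N \<Longrightarrow> v < N \<Longrightarrow> bk u = bk v \<Longrightarrow> key u div 2 ^ e = key v div 2 ^ e"
begin

definition st :: "nat \<Rightarrow> nat" where "st j = card {u. u < N \<and> bk u < j}"

lemma st_mono: "i \<le> j \<Longrightarrow> st i \<le> st j"
  unfolding st_def by (intro card_mono) auto

lemma st_le: "st j \<le> N"
  using card_mono[of "{..<N}" "{u. u < N \<and> bk u < j}"] by (auto simp: st_def)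

lemma st_0 [simp]: "st 0 = 0" by (simp add: st_def)

lemma bk_st: "u < N \<Longrightarrow> bk u < j \<longleftrightarrow> u < st j"
  unfolding st_def by (rule initial_segment_card) (use bk_mono le_less_trans in blast)+

lemma bk_eq_iff: "u < N \<Longrightarrow> bk u = j \<longleftrightarrow> st j \<le> u \<and> u < st (j + 1)"
  using bk_st[of u j] bk_st[of u "j + 1"] by auto

lemma in_bucket: "st j \<le> u \<Longrightarrow> u < st (j + 1) \<Longrightarrow> u < N \<and> bk u = j"
  using bk_eq_iff[of u j] st_le[of "j + 1"] by auto

definition ans :: "nat \<Rightarrow> nat \<Rightarrow> nat" where
  "ans j x = card {u. u < N \<and> (bk u < j \<or> bk u = j \<and> key u < x)}"

lemma ans_iff: "u < N \<Longrightarrow> bk u < j \<or> bk u = j \<and> key u < x \<longleftrightarrow> u < ans j x"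
  unfolding ans_def
proof (rule initial_segment_card)
  fix u v assume uv: "u \<le> v" "v < N" "bk v < j \<or> bk v = j \<and> key v < x"
  show "bk u < j \<or> bk u = j \<and> key u < x"
  proof (cases "u = v")
    case False
    then show ?thesis using bk_mono[OF uv(1,2)] key_mono[of u v] uv by fastforce
  qed (use uv in simp)
qed

lemma st_le_ans: "st j \<le> ans j x" "ans j x \<le> st (j + 1)"
  unfolding st_def ans_def by (intro card_mono; auto)+

lemma key_ans: "st j \<le> i \<Longrightarrow> i < st (j + 1) \<Longrightarrow> key i < x \<longleftrightarrow> i < ans j x"
  using ans_iff[of i j x] in_bucket[of j i] by auto

lemma sum_bucket_sizes: "(\<Sum>j<m. st (j + 1) - st j) = st m"
proof (induction m)
  case (Suc m)
  then show ?case using st_mono[of m "Suc m"] by simp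
qed simp

end

locale trie_data = keyed +
  fixes w f R L \<beta> :: nat
  assumes w1: "1 \<le> w" and f1: "1 \<le> f" and NR: "N \<le> R" and Rw: "R < 2 ^ w"
    and L1: "1 \<le> L" and b1: "1 \<le> \<beta>" and bw: "2 ^ \<beta> * (\<beta> + 1) \<le> w" and eL: "e \<le> \<beta> * L"
    and key_less: "u < N \<Longrightarrow> key u < 2 ^ w"
begin

definition g :: nat where "g = 64 * L * f"
definition nS :: "nat \<Rightarrow> nat" where "nS j = (st (j + 1) - st j) div g"
definition smp :: "nat \<Rightarrow> nat \<Rightarrow> nat" where "smp j i = st j + g * (i + 1) - 1"
definition Smp :: "nat \<Rightarrow> nat set" where "Smp j = (\<lambda>i. key (smp j i)) ` {..<nS j}"
definition lo :: "nat \<Rightarrow> nat \<Rightarrow> nat" where "lo j c = st j + g * c"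
definition hi :: "nat \<Rightarrow> nat \<Rightarrow> nat" where "hi j c = min (st (j + 1)) (st j + g * c + g)"
definition X0 :: "nat set" where "X0 = {j. j < NB \<and> g \<le> st (j + 1) - st j}"
definition S :: "nat \<times> nat \<Rightarrow> nat set" where "S = (\<lambda>(j, l). trie_prefixes L \<beta> (Smp j) l)"
definition X1 :: "(nat \<times> nat) set" where "X1 = X0 \<times> {..<L}"
definition D :: nat where "D = (\<Sum>j\<in>X0. nS j * L)"

lemma g1: "1 \<le> g"
proof -
  have "64 * 1 * 1 \<le> 64 * L * f" using L1 f1 by (intro mult_le_mono) auto
  then show ?thesis by (simp add: g_def)
qed

lemma finite_X0 [simp]: "finite X0" by (simp add: X0_def)
lemma finite_X1 [simp]: "finite X1" by (simp add: X1_def)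
lemma finite_Smp [simp]: "finite (Smp j)" by (simp add: Smp_def)
lemma finite_S [simp]: "finite (S x)" by (cases x) (simp add: S_def trie_prefixes_def)

lemma nS_pos: "j \<in> X0 \<Longrightarrow> 1 \<le> nS j"
  using g1 by (simp add: X0_def nS_def div_greater_zero_iff Suc_le_eq)

lemma nS_g: "nS j * g \<le> st (j + 1) - st j"
  unfolding nS_def by (metis div_times_less_eq_dividend)

lemma smp_range: "i < nS j \<Longrightarrow> st j \<le> smp j i \<and> smp j i < st (j + 1)"
proof -
  assume "i < nS j"
  then have "(i + 1) * g \<le> nS j * g" by (intro mult_le_mono1) simp
  then have "g * (i + 1) \<le> st (j + 1) - st j" using nS_g[of j] by (simp only: mult.commute le_trans)
  moreover have "1 * 1 \<le> g * (i + 1)" using g1 by (intro mult_le_mono) auto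
  ultimately show ?thesis by (auto simp: smp_def)
qed

lemma D_bound: "64 * D \<le> R div f" "64 * D \<le> R"
proof -
  have "D * (64 * f) = (\<Sum>j\<in>X0. nS j * g)"
    unfolding D_def g_def sum_distrib_right by (intro sum.cong) (auto simp: mult_ac)
  also have "\<dots> \<le> (\<Sum>j\<in>X0. st (j + 1) - st j)" by (intro sum_mono nS_g)
  also have "\<dots> \<le> (\<Sum>j<NB. st (j + 1) - st j)" by (intro sum_mono2) (auto simp: X0_def)
  also have "\<dots> \<le> R" unfolding sum_bucket_sizes using st_le NR le_trans by blast
  finally have D: "64 * D * f \<le> R" by (simp add: mult_ac)
  then have "64 * D * f div f \<le> R div f" by (rule div_le_mono)
  then show 1: "64 * D \<le> R div f" using f1 by simp
  then show "64 * D \<le> R" using div_le_dividend le_trans by blast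
qed

lemma card_S_le: "card (S (j, l)) \<le> nS j"
proof -
  have "card (S (j, l)) \<le> card (Smp j)" unfolding S_def trie_prefixes_def by (simp add: card_image_le)
  also have "\<dots> \<le> nS j" unfolding Smp_def using card_image_le[of "{..<nS j}"] by fastforce
  finally show ?thesis .
qed

lemma sum_S: "(\<Sum>x\<in>X1. card (S x)) \<le> D"
proof -
  have "(\<Sum>x\<in>X1. card (S x)) = (\<Sum>j\<in>X0. \<Sum>l<L. card (S (j, l)))"
    unfolding X1_def by (simp add: sum.cartesian_product)
  also have "\<dots> \<le> (\<Sum>j\<in>X0. \<Sum>l<L. nS j)" by (intro sum_mono card_S_le)
  also have "\<dots> = D" by (simp add: D_def mult.commute)
  finally show ?thesis .
qed

lemma Smp_less: "y \<in> Smp j \<Longrightarrow> y < 2 ^ w"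
  using smp_range in_bucket key_less by (fastforce simp: Smp_def)

lemma S_less: "S x \<subseteq> {..<2 ^ w}"
proof (cases x)
  case (Pair j l)
  have "y div b < 2 ^ w" if "y \<in> Smp j" for y b
    using Smp_less[OF that] div_le_dividend[of y b] by linarith
  then show ?thesis unfolding Pair S_def trie_prefixes_def by auto
qed

lemma S_nonempty: "x \<in> X1 \<Longrightarrow> S x \<noteq> {}"
  using nS_pos by (auto simp: X1_def S_def trie_prefixes_def Smp_def lessThan_empty_iff Suc_le_eq)

lemma card_S_D: "x \<in> X1 \<Longrightarrow> card (S x) \<le> D"
  using sum_S member_le_sum[of x X1 "\<lambda>x. card (S x)"] by (simp add: le_trans)

definition ch :: "nat \<times> nat \<Rightarrow> nat \<Rightarrow> nat set" where
  "ch = (\<lambda>(j, l) p. {\<delta>. \<delta> < 2 ^ \<beta> \<and> p * 2 ^ \<beta> + \<delta> \<in> S (j, l + 1)})"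
definition rank :: "nat \<times> nat \<Rightarrow> nat \<Rightarrow> nat \<Rightarrow> nat" where
  "rank x p \<delta> = card {\<delta>' \<in> ch x p. \<delta>' < \<delta>}"
definition Rt :: "nat \<times> nat \<Rightarrow> nat \<Rightarrow> nat" where
  "Rt x p = (\<Sum>\<delta><2 ^ \<beta>. rank x p \<delta> * (2 ^ (\<beta> + 1)) ^ \<delta>)"
definition below_ch :: "nat \<times> nat \<Rightarrow> nat \<Rightarrow> nat \<Rightarrow> nat" where
  "below_ch = (\<lambda>(j, l) p \<delta>. below L \<beta> (Smp j) (l + 1) (p * 2 ^ \<beta> + \<delta>))"

lemma finite_ch [simp]: "finite (ch x p)"
  by (cases x) (simp add: ch_def)

lemma rank_le: "rank x p \<delta> \<le> card (ch x p)"
  unfolding rank_def by (intro card_mono) auto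

lemma card_ch_le: "card (ch x p) \<le> 2 ^ \<beta>"
  using card_mono[of "{..<2 ^ \<beta>}" "ch x p"] by (cases x) (auto simp: ch_def)

lemma rank_less: "rank x p \<delta> < 2 ^ (\<beta> + 1)"
proof -
  have "rank x p \<delta> \<le> 2 ^ \<beta>" using rank_le card_ch_le le_trans by blast
  also have "(2::nat) ^ \<beta> < 2 ^ (\<beta> + 1)" by simp
  finally show ?thesis .
qed

lemma Rt_less: "Rt x p < 2 ^ w"
proof -
  have "Rt x p < (2 ^ (\<beta> + 1)) ^ (2 ^ \<beta>)" unfolding Rt_def by (rule digits_less) (rule rank_less)
  also have "\<dots> = 2 ^ (2 ^ \<beta> * (\<beta> + 1))" by (simp only: power_mult[symmetric] mult.commute)
  also have "\<dots> \<le> 2 ^ w" using bw by (intro power_increasing) auto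
  finally show ?thesis .
qed

lemma Rt_nth: "\<delta> < 2 ^ \<beta> \<Longrightarrow> Rt x p div 2 ^ (\<delta> * (\<beta> + 1)) mod 2 ^ (\<beta> + 1) = rank x p \<delta>"
  using digits_nth[of "2 ^ \<beta>" "rank x p" "2 ^ (\<beta> + 1)" \<delta>] rank_less
  by (simp only: Rt_def power_mult[symmetric] mult.commute[of \<delta>])

lemma S_Suc:
  assumes "l < L" "y \<in> Smp j"
  shows "y div 2 ^ (\<beta> * (L - (l + 1))) \<in> S (j, l + 1)"
  using assms by (auto simp: S_def trie_prefixes_def)

lemma below_ch_eq:
  assumes "l < L" "\<delta> \<le> \<delta>'" "\<delta>' < 2 ^ \<beta>" "rank (j, l) p \<delta> = rank (j, l) p \<delta>'"
  shows "below_ch (j, l) p \<delta> = below_ch (j, l) p \<delta>'"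
proof -
  have sub: "{d \<in> ch (j, l) p. d < \<delta>} \<subseteq> {d \<in> ch (j, l) p. d < \<delta>'}" using assms(2) by auto
  have "{d \<in> ch (j, l) p. d < \<delta>} = {d \<in> ch (j, l) p. d < \<delta>'}"
    using assms(4) sub unfolding rank_def by (intro card_subset_eq) auto
  then have none: "\<not> (\<delta> \<le> d \<and> d < \<delta>')" if "d \<in> ch (j, l) p" for d
    using that by (metis (mono_tags, lifting) mem_Collect_eq not_le)
  let ?b = "2 ^ (\<beta> * (L - (l + 1))) :: nat"
  have "y div ?b < p * 2 ^ \<beta> + \<delta> \<longleftrightarrow> y div ?b < p * 2 ^ \<beta> + \<delta>'" if y: "y \<in> Smp j" for y
  proof (rule iffI)
    assume "y div ?b < p * 2 ^ \<beta> + \<delta>'"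
    show "y div ?b < p * 2 ^ \<beta> + \<delta>"
    proof (rule ccontr)
      assume "\<not> y div ?b < p * 2 ^ \<beta> + \<delta>"
      then have "\<delta> \<le> y div ?b - p * 2 ^ \<beta>" "y div ?b - p * 2 ^ \<beta> < \<delta>'"
        "p * 2 ^ \<beta> + (y div ?b - p * 2 ^ \<beta>) = y div ?b"
        using \<open>y div ?b < p * 2 ^ \<beta> + \<delta>'\<close> by auto
      moreover from this have "y div ?b - p * 2 ^ \<beta> \<in> ch (j, l) p"
        using S_Suc[OF assms(1) y] assms(3) unfolding ch_def by simp
      ultimately show False using none by blast
    qed
  qed (use assms(2) in linarith)
  then show ?thesis unfolding below_ch_def below_def by (auto intro!: arg_cong[of _ _ card])
qed

definition at_rank :: "nat \<times> nat \<Rightarrow> nat \<Rightarrow> nat \<Rightarrow> nat" where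
  "at_rank x p k = below_ch x p (SOME \<delta>. \<delta> < 2 ^ \<beta> \<and> rank x p \<delta> = k)"

lemma at_rank: "l < L \<Longrightarrow> \<delta> < 2 ^ \<beta> \<Longrightarrow> at_rank (j, l) p (rank (j, l) p \<delta>) = below_ch (j, l) p \<delta>"
proof -
  assume d: "l < L" "\<delta> < 2 ^ \<beta>"
  let ?d = "SOME \<delta>'. \<delta>' < 2 ^ \<beta> \<and> rank (j, l) p \<delta>' = rank (j, l) p \<delta>"
  have "?d < 2 ^ \<beta> \<and> rank (j, l) p ?d = rank (j, l) p \<delta>"
    by (rule someI[of _ \<delta>]) (use d in simp)
  then show ?thesis unfolding at_rank_def
    using below_ch_eq[of l \<delta> ?d j p] below_ch_eq[of l ?d \<delta> j p] d by (metis nat_le_linear)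
qed

lemma below_ch_le: "below_ch (j, l) p \<delta> \<le> nS j"
proof -
  have "below_ch (j, l) p \<delta> \<le> card (Smp j)"
    unfolding below_ch_def below_def by (auto intro!: card_mono)
  also have "\<dots> \<le> nS j" unfolding Smp_def using card_image_le[of "{..<nS j}"] by fastforce
  finally show ?thesis .
qed

lemma lo_hi_less: "c \<le> nS j \<Longrightarrow> lo j c < 2 ^ w" "hi j c < 2 ^ w"
proof -
  assume "c \<le> nS j"
  then have "c * g \<le> nS j * g" by (rule mult_le_mono1)
  then have "lo j c \<le> st (j + 1)" using nS_g[of j] st_mono[of j "j + 1"]
    unfolding lo_def mult.commute[of g c] by linarith
  then show "lo j c < 2 ^ w" using st_le[of "j + 1"] NR Rw by linarith
next
  show "hi j c < 2 ^ w" using st_le[of "j + 1"] NR Rw by (simp add: hi_def)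
qed

lemma sum_ch: "x \<in> X1 \<Longrightarrow> (\<Sum>p\<in>S x. card (ch x p) + 1) \<le> nS (fst x) + card (S x)"
proof -
  assume "x \<in> X1"
  obtain j l where x: "x = (j, l)" by (cases x)
  have "(\<Sum>p\<in>S x. card (ch x p)) = card (SIGMA p:S x. ch x p)" by (rule card_SigmaI[symmetric]) auto
  also have "\<dots> = card ((\<lambda>(p, d). p * 2 ^ \<beta> + d) ` (SIGMA p:S x. ch x p))"
  proof (rule card_image[symmetric], rule inj_onI)
    fix a b assume "a \<in> (SIGMA p:S x. ch x p)" "b \<in> (SIGMA p:S x. ch x p)"
      "(case a of (p, d) \<Rightarrow> p * 2 ^ \<beta> + d) = (case b of (p, d) \<Rightarrow> p * 2 ^ \<beta> + d)"
    then obtain p d p' d' where ab: "a = (p, d)" "b = (p', d')" "d < 2 ^ \<beta>" "d' < 2 ^ \<beta>"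
      "p * 2 ^ \<beta> + d = p' * 2 ^ \<beta> + d'" by (auto simp: ch_def x)
    have "p = (p * 2 ^ \<beta> + d) div 2 ^ \<beta>" "p' = (p' * 2 ^ \<beta> + d') div 2 ^ \<beta>" using ab(3,4) by simp_all
    then have "p = p'" using ab(5) by metis
    then show "a = b" using ab by simp
  qed
  also have "\<dots> \<le> card (S (j, l + 1))" by (intro card_mono) (auto simp: ch_def x)
  also have "\<dots> \<le> nS j" by (rule card_S_le)
  finally show ?thesis unfolding sum.distrib x by simp
qed

lemma sum_nS: "(\<Sum>x\<in>X1. nS (fst x)) = D"
proof -
  have "(\<Sum>x\<in>X1. nS (fst x)) = (\<Sum>(j, l)\<in>X0 \<times> {..<L}. nS j)" by (simp add: X1_def case_prod_beta')
  also have "\<dots> = (\<Sum>j\<in>X0. \<Sum>l<L. nS j)" by (rule sum.cartesian_product[symmetric])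
  finally show ?thesis by (simp add: D_def mult.commute)
qed

definition hash_ok :: "nat \<times> nat \<Rightarrow> nat \<Rightarrow> nat \<Rightarrow> (nat \<Rightarrow> nat) \<Rightarrow> (nat \<Rightarrow> nat) \<Rightarrow> bool" where
  "hash_ok x a s as ss \<longleftrightarrow> a < 2 ^ w \<and> s \<le> w \<and> 2 ^ s \<le> 2 * card (S x) \<and>
    (\<forall>i<2 ^ s. as i < 2 ^ w \<and> ss i \<le> w) \<and> (\<Sum>i<2 ^ s. 2 ^ ss i) \<le> 14 * card (S x) \<and>
    (\<forall>p\<in>S x. \<forall>p'\<in>S x. mshift w a s p = mshift w a s p' \<longrightarrow>
      mshift w (as (mshift w a s p)) (ss (mshift w a s p)) p =
      mshift w (as (mshift w a s p)) (ss (mshift w a s p)) p' \<longrightarrow> p = p')"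

lemma hash_ok_exists: "x \<in> X1 \<Longrightarrow> \<exists>a s as ss. hash_ok x a s as ss"
  unfolding hash_ok_def
proof (rule two_level_hashing[OF finite_S S_less S_nonempty _ w1])
  assume "x \<in> X1"
  then show "12 * card (S x) \<le> 2 ^ w" using card_S_D[of x] D_bound(2) Rw by linarith
qed

lemma tables_exist:
  "\<exists>tp W. (\<forall>j. tp j \<le> R) \<and> (\<forall>j. tp j \<noteq> 0 \<longrightarrow> j \<in> X0) \<and> (\<forall>c i. W c i < 2 ^ w) \<and>
     (\<forall>c i. R div f \<le> i \<longrightarrow> W c i = 0) \<and>
     (\<forall>j\<in>X0. tp j \<noteq> 0 \<and> tp j - 1 + L \<le> R \<and> trie_ok w W L \<beta> (tp j - 1) (Smp j) (lo j) (hi j))"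
proof -
  have "\<forall>x. \<exists>a s as ss. x \<in> X1 \<longrightarrow> hash_ok x a s as ss" using hash_ok_exists by blast
  then obtain a s as ss where "\<forall>x. x \<in> X1 \<longrightarrow> hash_ok x (a x) (s x) (as x) (ss x)" by metis
  then have ok: "hash_ok x (a x) (s x) (as x) (ss x)" if "x \<in> X1" for x using that by blast
  define h1 where "h1 x p = mshift w (a x) (s x) p" for x p
  define h2 where "h2 x i p = mshift w (as x i) (ss x i) p" for x i p
  have h1_less: "h1 x p < 2 ^ s x" if "x \<in> X1" for x p
    using ok[OF that] mshift_less by (simp add: h1_def hash_ok_def)
  have h2_less: "h2 x i p < 2 ^ ss x i" if "x \<in> X1" "i < 2 ^ s x" for x i p
    using ok[OF that(1)] that(2) mshift_less by (simp add: h2_def hash_ok_def)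
  have perfect: "p = p'" if "x \<in> X1" "p \<in> S x" "p' \<in> S x" "h1 x p = h1 x p'" "h2 x (h1 x p) p = h2 x (h1 x p) p'"
    for x p p' using ok[OF that(1)] that(2-) unfolding hash_ok_def h1_def h2_def by blast
  define X2 where "X2 = (SIGMA x:X1. {..<(2::nat) ^ s x})"
  define X3 where "X3 = (SIGMA x:X1. S x)"
  define sz0 where "sz0 = (\<lambda>j::nat. L)"
  define sz1 where "sz1 = (\<lambda>x. (2::nat) ^ s x)"
  define sz2 where "sz2 = (\<lambda>(x, i). (2::nat) ^ ss x i)"
  define sz3 where "sz3 = (\<lambda>(x, p). card (ch x p) + 1)"
  have fin: "finite X2" "finite X3" by (auto simp: X2_def X3_def)
  have T0: "sum sz0 X0 \<le> D"
    unfolding sz0_def D_def using nS_pos by (intro sum_mono) simp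
  have "sum sz1 X1 \<le> (\<Sum>x\<in>X1. 2 * card (S x))"
    unfolding sz1_def using ok by (intro sum_mono) (auto simp: hash_ok_def)
  then have T1: "sum sz1 X1 \<le> 2 * D" using sum_S by (simp flip: sum_distrib_left)
  have "sum sz2 X2 = (\<Sum>x\<in>X1. \<Sum>i<2 ^ s x. 2 ^ ss x i)"
    unfolding sz2_def X2_def by (rule sum.Sigma[symmetric]) auto
  also have "\<dots> \<le> (\<Sum>x\<in>X1. 14 * card (S x))" using ok by (intro sum_mono) (auto simp: hash_ok_def)
  finally have T2: "sum sz2 X2 \<le> 14 * D" using sum_S by (simp flip: sum_distrib_left)
  have "sum sz3 X3 = (\<Sum>x\<in>X1. \<Sum>p\<in>S x. card (ch x p) + 1)"
    unfolding sz3_def X3_def by (rule sum.Sigma[symmetric]) auto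
  also have "\<dots> \<le> (\<Sum>x\<in>X1. nS (fst x) + card (S x))" by (intro sum_mono sum_ch)
  finally have T3: "sum sz3 X3 \<le> 2 * D" using sum_S sum_nS by (simp add: sum.distrib)
  obtain off0 where off0: "\<forall>x\<in>X0. off0 x + sz0 x \<le> sum sz0 X0"
    "\<forall>x\<in>X0. \<forall>y\<in>X0. \<forall>i<sz0 x. \<forall>j<sz0 y. off0 x + i = off0 y + j \<longrightarrow> x = y \<and> i = j"
    using allocate[OF finite_X0, of sz0] by blast
  obtain off1 where off1: "\<forall>x\<in>X1. off1 x + sz1 x \<le> sum sz1 X1"
    "\<forall>x\<in>X1. \<forall>y\<in>X1. \<forall>i<sz1 x. \<forall>j<sz1 y. off1 x + i = off1 y + j \<longrightarrow> x = y \<and> i = j"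
    using allocate[OF finite_X1, of sz1] by blast
  obtain off2 where off2: "\<forall>x\<in>X2. off2 x + sz2 x \<le> sum sz2 X2"
    "\<forall>x\<in>X2. \<forall>y\<in>X2. \<forall>i<sz2 x. \<forall>j<sz2 y. off2 x + i = off2 y + j \<longrightarrow> x = y \<and> i = j"
    using allocate[OF fin(1), of sz2] by blast
  obtain off3 where off3: "\<forall>x\<in>X3. off3 x + sz3 x \<le> sum sz3 X3"
    "\<forall>x\<in>X3. \<forall>y\<in>X3. \<forall>i<sz3 x. \<forall>j<sz3 y. off3 x + i = off3 y + j \<longrightarrow> x = y \<and> i = j"
    using allocate[OF fin(2), of sz3] by blast
  have R0: "off0 x + sz0 x \<le> R div f" if "x \<in> X0" for x
    using off0(1) that T0 D_bound(1) by fastforce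
  have R1: "off1 x + sz1 x \<le> R div f" if "x \<in> X1" for x
    using off1(1) that T1 D_bound(1) by fastforce
  have R2: "off2 x + sz2 x \<le> R div f" if "x \<in> X2" for x
    using off2(1) that T2 D_bound(1) by fastforce
  have R3: "off3 x + sz3 x \<le> R div f" if "x \<in> X3" for x
    using off3(1) that T3 D_bound(1) by fastforce
  have Rfw: "R div f < 2 ^ w" using Rw div_le_dividend le_less_trans by blast
  define occupied where "occupied x i t \<longleftrightarrow> (\<exists>p\<in>S x. h1 x p = i \<and> h2 x i p = t)" for x i t
  define pick where "pick x i t = (SOME p. p \<in> S x \<and> h1 x p = i \<and> h2 x i p = t)" for x i t
  have pick: "pick x i t \<in> S x \<and> h1 x (pick x i t) = i \<and> h2 x i (pick x i t) = t" if "occupied x i t" for x i t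
    unfolding pick_def by (rule someI_ex) (use that in \<open>auto simp: occupied_def\<close>)
  have pick_eq: "occupied x (h1 x p) (h2 x (h1 x p) p) \<and> pick x (h1 x p) (h2 x (h1 x p) p) = p"
    if "x \<in> X1" "p \<in> S x" for x p
  proof -
    have o: "occupied x (h1 x p) (h2 x (h1 x p) p)" using that(2) by (auto simp: occupied_def)
    then show ?thesis using pick[OF o] perfect[OF that(1), of "pick x (h1 x p) (h2 x (h1 x p) p)" p] that(2) by simp
  qed
  define Fs where "Fs =
    [spread X0 off0 sz0 (\<lambda>j l. a (j, l)),
     spread X0 off0 sz0 (\<lambda>j l. w - s (j, l)),
     spread X0 off0 sz0 (\<lambda>j l. off1 (j, l)),
     spread X1 off1 sz1 as,
     spread X1 off1 sz1 (\<lambda>x i. w - ss x i),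
     spread X1 off1 sz1 (\<lambda>x i. off2 (x, i)),
     spread X2 off2 sz2 (\<lambda>(x, i) t. if occupied x i t then pick x i t else 2 ^ w - 1),
     spread X2 off2 sz2 (\<lambda>(x, i) t. if occupied x i t then Rt x (pick x i t) else 0),
     spread X2 off2 sz2 (\<lambda>(x, i) t. if occupied x i t then off3 (x, pick x i t) else 0),
     spread X3 off3 sz3 (\<lambda>(x, p) k. min R (lo (fst x) (at_rank x p k))),
     spread X3 off3 sz3 (\<lambda>(x, p) k. hi (fst x) (at_rank x p k))]"
  define W where "W c = (if c < 11 then Fs ! c else (\<lambda>_. 0))" for c
  define tp where "tp j = (if j \<in> X0 then off0 j + 1 else 0)" for j
  have W_less: "W c i < 2 ^ w" for c i
  proof (cases "c < 11")
    case True
    have ww: "w - k < 2 ^ w" for k using less_exp[of w] by (meson diff_le_self le_less_trans)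
    have X1I: "(j, l) \<in> X1" if "j \<in> X0" "l < sz0 j" for j l using that by (simp add: X1_def sz0_def)
    have F: "\<forall>F\<in>set Fs. F i < 2 ^ w"
    proof -
      have "a (j, l) < 2 ^ w" if "j \<in> X0" "l < sz0 j" for j l using ok[OF X1I[OF that]] by (simp add: hash_ok_def)
      moreover have "off1 (j, l) < 2 ^ w" if "j \<in> X0" "l < sz0 j" for j l
        using R1[OF X1I[OF that]] Rfw by linarith
      moreover have "as x t < 2 ^ w" if "x \<in> X1" "t < sz1 x" for x t
        using ok[OF that(1)] that(2) by (simp add: hash_ok_def sz1_def)
      moreover have "off2 (x, t) < 2 ^ w" if "x \<in> X1" "t < sz1 x" for x t
        using R2[of "(x, t)"] that Rfw by (simp add: X2_def sz1_def)
      moreover have pick_less: "pick x i t < 2 ^ w" if "occupied x i t" for x i t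
        using pick[OF that] S_less[of x] by auto
      moreover from pick_less have "(case y of (x, i) \<Rightarrow> \<lambda>t. if occupied x i t then pick x i t else 2 ^ w - 1) t < 2 ^ w"
        for y t using pick_less by (auto split: prod.split)
      moreover have "(case y of (x, i) \<Rightarrow> \<lambda>t. if occupied x i t then Rt x (pick x i t) else 0) t < 2 ^ w"
        for y t using Rt_less by (auto split: prod.split)
      moreover have "(case y of (x, i) \<Rightarrow> \<lambda>t. if occupied x i t then off3 (x, pick x i t) else 0) t < 2 ^ w"
        if "y \<in> X2" for y t
      proof (cases y)
        case (Pair x i)
        have "off3 (x, pick x i t) < 2 ^ w" if "occupied x i t"
          using R3[of "(x, pick x i t)"] pick[OF that] \<open>y \<in> X2\<close> Rfw by (simp add: X3_def X2_def Pair)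
        then show ?thesis by (simp add: Pair)
      qed
      moreover have "(case y of (x, p) \<Rightarrow> \<lambda>k. min R (lo (fst x) (at_rank x p k))) t < 2 ^ w"
        for y t using Rw by (auto split: prod.split)
      moreover have "(case y of (x, p) \<Rightarrow> \<lambda>k. hi (fst x) (at_rank x p k)) t < 2 ^ w"
        for y t using lo_hi_less(2) by (auto split: prod.split)
      ultimately show ?thesis unfolding Fs_def using ww
        by (auto intro!: spread_less)
    qed
    have "length Fs = 11" by (simp add: Fs_def)
    then show ?thesis using F True by (simp add: W_def)
  qed (simp add: W_def)
  have W_zero: "W c i = 0" if "R div f \<le> i" for c i
  proof (cases "c < 11")
    case True
    have "\<forall>F\<in>set Fs. F i = 0"
      unfolding Fs_def using that by (auto intro!: spread_zero[of _ _ _ "R div f"] R0 R1 R2 R3)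
    moreover have "length Fs = 11" by (simp add: Fs_def)
    ultimately show ?thesis using True by (simp add: W_def)
  qed (simp add: W_def)
  have main: "tp j \<noteq> 0 \<and> tp j - 1 + L \<le> R \<and> trie_ok w W L \<beta> (tp j - 1) (Smp j) (lo j) (hi j)"
    if j: "j \<in> X0" for j
  proof -
    have tpR: "off0 j + L \<le> R" using R0[OF j] div_le_dividend[of R f] unfolding sz0_def by linarith
    have slot: "slot w W (off0 j + l) p = off2 (x, h1 x p) + h2 x (h1 x p) p \<and> x \<in> X1"
      if l: "l < L" and x: "x = (j, l)" for l p x
    proof -
      have x1: "x \<in> X1" using j l by (simp add: X1_def x)
      have l0: "l < sz0 j" using l by (simp add: sz0_def)
      have W0: "W 0 (off0 j + l) = a x" "W (Suc 0) (off0 j + l) = w - s x" "W 2 (off0 j + l) = off1 x"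
        unfolding W_def Fs_def x by (simp_all add: spread_eq[where sz = sz0, OF j l0 off0(2)] numeral_2_eq_2)
      let ?i = "h1 x p"
      have i: "?i < sz1 x" using h1_less[OF x1] by (simp add: sz1_def)
      have "off1 x + ?i < 2 ^ w" using R1[OF x1] i Rfw by linarith
      then have s1: "hstep w W 0 (off0 j + l) p = off1 x + ?i"
        unfolding hstep_def using W0 by (simp add: h1_def mshift_def numeral_2_eq_2)
      have W3: "W 3 (off1 x + ?i) = as x ?i" "W 4 (off1 x + ?i) = w - ss x ?i" "W 5 (off1 x + ?i) = off2 (x, ?i)"
        unfolding W_def Fs_def by (simp_all add: spread_eq[where sz = sz1, OF x1 i off1(2)] eval_nat_numeral)
      have x2: "(x, ?i) \<in> X2" using x1 h1_less[OF x1] by (simp add: X2_def)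
      have t: "h2 x ?i p < 2 ^ ss x ?i" using h2_less[OF x1 h1_less[OF x1]] .
      then have "off2 (x, ?i) + h2 x ?i p < 2 ^ w" using R2[OF x2] Rfw by (simp add: sz2_def)
      then have "hstep w W 3 (off1 x + ?i) p = off2 (x, ?i) + h2 x ?i p"
        unfolding hstep_def using W3 by (simp add: h2_def mshift_def)
      then show ?thesis unfolding slot_def s1 using x1 by simp
    qed
    have W6: "W 6 (off2 (x, h1 x p) + h2 x (h1 x p) p) =
          (if occupied x (h1 x p) (h2 x (h1 x p) p) then pick x (h1 x p) (h2 x (h1 x p) p) else 2 ^ w - 1)"
        "W 7 (off2 (x, h1 x p) + h2 x (h1 x p) p) =
          (if occupied x (h1 x p) (h2 x (h1 x p) p) then Rt x (pick x (h1 x p) (h2 x (h1 x p) p)) else 0)"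
        "W 8 (off2 (x, h1 x p) + h2 x (h1 x p) p) =
          (if occupied x (h1 x p) (h2 x (h1 x p) p) then off3 (x, pick x (h1 x p) (h2 x (h1 x p) p)) else 0)"
      if x1: "x \<in> X1" for x p
    proof -
      have x2: "(x, h1 x p) \<in> X2" using x1 h1_less[OF x1] by (simp add: X2_def)
      have t: "h2 x (h1 x p) p < sz2 (x, h1 x p)" using h2_less[OF x1 h1_less[OF x1]] by (simp add: sz2_def)
      note sp = spread_eq[where sz = sz2, OF x2 t off2(2)]
      show "W 6 (off2 (x, h1 x p) + h2 x (h1 x p) p) =
          (if occupied x (h1 x p) (h2 x (h1 x p) p) then pick x (h1 x p) (h2 x (h1 x p) p) else 2 ^ w - 1)"
        "W 7 (off2 (x, h1 x p) + h2 x (h1 x p) p) =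
          (if occupied x (h1 x p) (h2 x (h1 x p) p) then Rt x (pick x (h1 x p) (h2 x (h1 x p) p)) else 0)"
        "W 8 (off2 (x, h1 x p) + h2 x (h1 x p) p) =
          (if occupied x (h1 x p) (h2 x (h1 x p) p) then off3 (x, pick x (h1 x p) (h2 x (h1 x p) p)) else 0)"
        unfolding W_def Fs_def by (simp_all add: sp eval_nat_numeral)
    qed
    have t1: "W 6 (slot w W (off0 j + l) p) = p \<longleftrightarrow> p \<in> trie_prefixes L \<beta> (Smp j) l"
      if l: "l < L" and p: "p < 2 ^ w - 1" for l p
    proof -
      define x where "x = (j, l)"
      note sl = slot[OF l x_def, of p]
      have Sx: "S x = trie_prefixes L \<beta> (Smp j) l" by (simp add: S_def x_def)
      show ?thesis
      proof
        assume "W 6 (slot w W (off0 j + l) p) = p"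
        then show "p \<in> trie_prefixes L \<beta> (Smp j) l"
          using sl W6(1)[of x p] p pick[of x "h1 x p" "h2 x (h1 x p) p"] Sx by (auto split: if_splits)
      next
        assume "p \<in> trie_prefixes L \<beta> (Smp j) l"
        then show "W 6 (slot w W (off0 j + l) p) = p" using sl W6(1)[of x p] pick_eq[of x p] Sx by simp
      qed
    qed
    have t2: "W 9 u = lo j c \<and> W 10 u = hi j c"
      if l: "l < L" and p: "p \<in> trie_prefixes L \<beta> (Smp j) l" and d: "\<delta> < 2 ^ \<beta>" and e: "e = slot w W (off0 j + l) p"
        and u: "u = (W 8 e + W 7 e div 2 ^ (\<delta> * (\<beta> + 1)) mod 2 ^ (\<beta> + 1)) mod 2 ^ w"
        and c: "c = below L \<beta> (Smp j) (l + 1) (p * 2 ^ \<beta> + \<delta>)" for l p \<delta> e u c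
    proof -
      define x where "x = (j, l)"
      note sl = slot[OF l x_def, of p]
      have Sx: "p \<in> S x" using p by (simp add: S_def x_def)
      have x3: "(x, p) \<in> X3" using sl Sx by (simp add: X3_def)
      have W78: "W 8 e = off3 (x, p)" "W 7 e = Rt x p"
        using sl W6(2,3)[of x p] pick_eq[OF conjunct2[OF sl] Sx] e by simp_all
      have rk: "rank x p \<delta> < sz3 (x, p)" using rank_le[of x p \<delta>] by (simp add: sz3_def)
      have "off3 (x, p) + rank x p \<delta> < 2 ^ w" using R3[OF x3] rk Rfw by linarith
      then have u': "u = off3 (x, p) + rank x p \<delta>" unfolding u W78 Rt_nth[OF d] by simp
      have ar: "at_rank x p (rank x p \<delta>) = c"
        unfolding x_def at_rank[OF l d] c below_ch_def by simp
      have "c \<le> nS j" using below_ch_le[of j l p \<delta>] by (simp add: c below_ch_def)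
      then have "c * g \<le> nS j * g" by (rule mult_le_mono1)
      then have "lo j c \<le> st (j + 1)" using nS_g[of j] st_mono[of j "j + 1"]
        unfolding lo_def mult.commute[of g c] by linarith
      then have "min R (lo j c) = lo j c" using st_le[of "j + 1"] NR by simp
      moreover note sp = spread_eq[where sz = sz3, OF x3 rk off3(2)]
      ultimately show ?thesis unfolding W_def Fs_def u'
        by (simp add: sp eval_nat_numeral ar) (simp add: x_def)
    qed
    show ?thesis unfolding trie_ok_def Let_def using t1 t2 tpR j by (auto simp: tp_def)
  qed
  have "tp j \<le> R" for j
  proof (cases "j \<in> X0")
    case True
    then have "tp j = off0 j + 1" by (simp add: tp_def)
    then show ?thesis using R0[OF True] L1 div_le_dividend[of R f] unfolding sz0_def by linarith
  qed (simp add: tp_def)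
  moreover have "tp j \<noteq> 0 \<Longrightarrow> j \<in> X0" for j by (simp add: tp_def split: if_splits)
  ultimately show ?thesis using W_less W_zero main
    by (intro exI[of _ tp] exI[of _ W]) blast
qed


lemma rank_sample:
  assumes "j \<in> X0"
  shows "card {y \<in> Smp j. y < x} = (ans j x - st j) div g"
proof -
  let ?c = "(ans j x - st j) div g"
  have cn: "?c \<le> nS j" unfolding nS_def using st_le_ans(2)[of j x] by (intro div_le_mono) simp
  have iff: "key (smp j i) < x \<longleftrightarrow> i < ?c" if "i < nS j" for i
  proof -
    have "1 * 1 \<le> g * (i + 1)" using g1 by (intro mult_le_mono) auto
    have "key (smp j i) < x \<longleftrightarrow> smp j i < ans j x" using smp_range[OF that] by (intro key_ans) auto
    also have "\<dots> \<longleftrightarrow> (i + 1) * g \<le> ans j x - st j"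
      using \<open>1 * 1 \<le> g * (i + 1)\<close> st_le_ans(1)[of j x] unfolding smp_def mult.commute[of g] by linarith
    also have "\<dots> \<longleftrightarrow> i + 1 \<le> ?c" using g1 by (simp only: less_eq_div_iff_mult_less_eq less_eq_Suc_le One_nat_def)
    finally show ?thesis by (simp add: Suc_le_eq)
  qed
  have "{y \<in> Smp j. y < x} = (\<lambda>i. key (smp j i)) ` {..<?c}"
    using iff cn unfolding Smp_def by (auto simp: image_iff)
  moreover have "inj_on (\<lambda>i. key (smp j i)) {..<?c}"
  proof (rule inj_onI)
    fix i i' assume ii: "i \<in> {..<?c}" "i' \<in> {..<?c}" "key (smp j i) = key (smp j i')"
    have r: "smp j i < N \<and> bk (smp j i) = j" "smp j i' < N \<and> bk (smp j i') = j"
      using ii cn smp_range[of i j] smp_range[of i' j] by (auto intro!: in_bucket)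
    have "smp j i = smp j i'"
      using r ii(3) key_mono[of "smp j i" "smp j i'"] key_mono[of "smp j i'" "smp j i"]
      by (metis linorder_neqE_nat less_irrefl)
    moreover have "1 * 1 \<le> g * (i + 1)" "1 * 1 \<le> g * (i' + 1)" using g1 by (intro mult_le_mono; auto)+
    ultimately have "g * (i + 1) = g * (i' + 1)" unfolding smp_def by linarith
    then show "i = i'" using g1 by simp
  qed
  ultimately show ?thesis by (simp add: card_image)
qed

lemma sample_interval:
  assumes "j \<in> X0"
  defines "c \<equiv> \<lambda>x. card {y \<in> Smp j. y < x}"
  shows "st j \<le> lo j (c x)" "lo j (c x) \<le> ans j x" "ans j x \<le> hi j (c x)" "hi j (c x) \<le> st (j + 1)"
    "hi j (c x) - lo j (c x) \<le> g"
proof -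
  have c: "c x = (ans j x - st j) div g" unfolding c_def by (rule rank_sample[OF assms(1)])
  have "g * c x \<le> ans j x - st j" unfolding c by simp
  then show "lo j (c x) \<le> ans j x" using st_le_ans(1)[of j x] unfolding lo_def by linarith
  have "ans j x - st j < g * c x + g" unfolding c using g1
    by (metis dividend_less_times_div less_le_trans zero_less_one add.commute)
  then have "ans j x \<le> st j + g * c x + g" by linarith
  then show "ans j x \<le> hi j (c x)" using st_le_ans(2)[of j x] unfolding hi_def by simp
qed (auto simp: lo_def hi_def)

lemma prefix_0:
  assumes "j \<in> X0" "\<And>u. u < N \<Longrightarrow> bk u = j \<Longrightarrow> key u div 2 ^ e = x div 2 ^ e"
  shows "x div 2 ^ (\<beta> * L) \<in> trie_prefixes L \<beta> (Smp j) 0"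
proof -
  have 0: "0 < nS j" using nS_pos[OF assms(1)] by simp
  have r: "smp j 0 < N \<and> bk (smp j 0) = j" using smp_range[OF 0] by (intro in_bucket) auto
  have "\<beta> * L = e + (\<beta> * L - e)" using eL by simp
  then have "(2::nat) ^ (\<beta> * L) = 2 ^ e * 2 ^ (\<beta> * L - e)" by (metis power_add)
  then have "y div 2 ^ (\<beta> * L) = y div 2 ^ e div 2 ^ (\<beta> * L - e)" for y :: nat by (simp add: div_mult2_eq)
  then have "x div 2 ^ (\<beta> * L) = key (smp j 0) div 2 ^ (\<beta> * L)" using assms(2) r by simp
  moreover have "key (smp j 0) \<in> Smp j" unfolding Smp_def using 0 by blast
  ultimately show ?thesis unfolding trie_prefixes_def by simp
qed

end

section \<open>Runs of \<open>\<Psi>\<close> and backward search\<close>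

lemma card_initial: "m \<le> n \<Longrightarrow> (\<And>k. k < n \<Longrightarrow> Q k \<longleftrightarrow> k < m) \<Longrightarrow> card {k. k < (n::nat) \<and> Q k} = m"
proof -
  assume "m \<le> n" "\<And>k. k < n \<Longrightarrow> Q k \<longleftrightarrow> k < m"
  then have "{k. k < n \<and> Q k} = {..<m}" by auto
  then show ?thesis by simp
qed

locale csa_text =
  fixes \<sigma> :: nat and T :: "nat list"
  assumes Ttext: "is_text \<sigma> T"
begin

abbreviation "n \<equiv> length T"
definition suf :: "nat \<Rightarrow> nat list" where "suf k = suffix_at T (SA T (k + 1))"
definition sy :: "nat \<Rightarrow> nat" where "sy k = hd (suf k)"
definition ps :: "nat \<Rightarrow> nat" where "ps k = Psi T (k + 1) - 1"

lemma T_nonempty [simp]: "T \<noteq> []" using Ttext by (simp add: is_text_def)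

lemma n1: "1 \<le> n" using Ttext by (cases T) (auto simp: is_text_def)

lemma SA_range: "k < n \<Longrightarrow> SA T (k + 1) \<in> {1..n}"
  using SA_bij[of T] by (auto simp: bij_betw_def)

lemma SA_inj: "k < n \<Longrightarrow> k' < n \<Longrightarrow> SA T (k + 1) = SA T (k' + 1) \<Longrightarrow> k = k'"
  using SA_bij[of T] inj_onD[of "SA T" "{1..n}" "k + 1" "k' + 1"] by (auto simp: bij_betw_def)

lemma SA_inv_range: "i \<in> {1..n} \<Longrightarrow> SA_inv T i \<in> {1..n}" "i \<in> {1..n} \<Longrightarrow> SA T (SA_inv T i) = i"
  unfolding SA_inv_def using SA_bij[of T] inv_into_into[of i "SA T" "{1..n}"] f_inv_into_f[of i "SA T" "{1..n}"]
  by (simp_all add: bij_betw_def)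

lemma suf_nonempty: "k < n \<Longrightarrow> suf k \<noteq> []"
  using SA_range[of k] by (auto simp: suf_def suffix_at_def)

lemma suf_mono: "i \<le> k \<Longrightarrow> k < n \<Longrightarrow> suf i \<le> suf k"
  unfolding suf_def by (rule SA_sorted) auto

lemma suf_strict: "i < k \<Longrightarrow> k < n \<Longrightarrow> suf i < suf k"
proof -
  assume ik: "i < k" "k < n"
  have "suf i \<noteq> suf k"
  proof
    assume "suf i = suf k"
    then have "length (suf i) = length (suf k)" by simp
    then have "SA T (i + 1) = SA T (k + 1)"
      using SA_range[of i] SA_range[of k] ik by (auto simp: suf_def suffix_at_def)
    then show False using SA_inj[of i k] ik by simp
  qed
  then show ?thesis using suf_mono[of i k] ik by auto
qed

lemma suf_less_iff: "i < n \<Longrightarrow> k < n \<Longrightarrow> suf i < suf k \<longleftrightarrow> i < k"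
  using suf_strict[of i k] suf_strict[of k i] by (metis linorder_neqE_nat order_less_asym)

lemma ps_less: "k < n \<Longrightarrow> ps k < n"
  and SA_ps: "k < n \<Longrightarrow> SA T (ps k + 1) = SA T (k + 1) mod n + 1"
proof -
  assume k: "k < n"
  have "SA T (k + 1) mod n < n" using k by (intro mod_less_divisor) linarith
  then have m: "SA T (k + 1) mod n + 1 \<in> {1..n}" by (simp add: Suc_le_eq)
  have P: "Psi T (k + 1) \<in> {1..n}" unfolding Psi_def using SA_inv_range(1)[OF m] by simp
  then show "ps k < n" by (auto simp: ps_def)
  have "ps k + 1 = Psi T (k + 1)" using P by (simp add: ps_def)
  then show "SA T (ps k + 1) = SA T (k + 1) mod n + 1"
    unfolding Psi_def using SA_inv_range(2)[OF m] by simp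
qed

lemma Psi_ps: "k < n \<Longrightarrow> Psi T (k + 1) = ps k + 1"
proof -
  assume k: "k < n"
  have "SA T (k + 1) mod n < n" using k by (intro mod_less_divisor) linarith
  then have m: "SA T (k + 1) mod n + 1 \<in> {1..n}" by (simp add: Suc_le_eq)
  have "Psi T (k + 1) \<in> {1..n}" unfolding Psi_def using SA_inv_range(1)[OF m] by simp
  then show ?thesis by (simp add: ps_def)
qed

lemma suf_Cons: "k < n \<Longrightarrow> SA T (k + 1) < n \<Longrightarrow> suf k = sy k # suf (ps k)"
proof -
  assume k: "k < n" "SA T (k + 1) < n"
  have "SA T (ps k + 1) = SA T (k + 1) + 1" using SA_ps[OF k(1)] k(2) by simp
  moreover have "SA T (k + 1) \<ge> 1" using SA_range[OF k(1)] by simp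
  ultimately have "tl (suf k) = suf (ps k)" unfolding suf_def suffix_at_def by (simp add: tl_drop drop_Suc[symmetric])
  then show ?thesis using suf_nonempty[OF k(1)] unfolding sy_def by (metis list.collapse)
qed

lemma suf_last: "k < n \<Longrightarrow> SA T (k + 1) = n \<Longrightarrow> suf k = [last T]"
proof -
  assume k: "k < n" "SA T (k + 1) = n"
  have "suf k = drop (n - 1) T" using k by (simp add: suf_def suffix_at_def)
  also have "\<dots> = [last T]" using n1 by (metis append_butlast_last_id append_eq_conv_conj length_0_conv length_butlast not_one_le_zero)
  finally show ?thesis .
qed

lemma sy_nth: "k < n \<Longrightarrow> sy k = T ! (SA T (k + 1) - 1)"
  using SA_range[of k] by (auto simp: sy_def suf_def suffix_at_def hd_drop_conv_nth)

lemma sy_in: "k < n \<Longrightarrow> sy k \<in> set T"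
  using sy_nth[of k] SA_range[of k] by auto

lemma sy_last_iff: "k < n \<Longrightarrow> sy k = last T \<longleftrightarrow> SA T (k + 1) = n"
proof
  assume k: "k < n" "sy k = last T"
  show "SA T (k + 1) = n"
  proof (rule ccontr)
    assume "SA T (k + 1) \<noteq> n"
    then have "SA T (k + 1) - 1 < length (butlast T)" using SA_range[OF k(1)] by auto
    then have "T ! (SA T (k + 1) - 1) \<in> set (butlast T)" by (metis nth_butlast nth_mem)
    then have "last T < sy k" using Ttext sy_nth[OF k(1)] by (simp add: is_text_def)
    then show False using k by simp
  qed
next
  assume "k < n" "SA T (k + 1) = n"
  then show "sy k = last T" using suf_last[of k] by (simp add: sy_def)
qed

lemma last_le: "c \<in> set T \<Longrightarrow> last T \<le> c"
proof -
  assume "c \<in> set T"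
  moreover have "T = butlast T @ [last T]" using Ttext by (simp add: is_text_def)
  ultimately have "c \<in> set (butlast T) \<or> c = last T" by (metis in_set_conv_decomp rotate1.simps(2) set_ConsD set_rotate1)
  then show ?thesis using Ttext by (auto simp: is_text_def)
qed

lemma sy_ps_mono: "i < k \<Longrightarrow> k < n \<Longrightarrow> sy i < sy k \<or> sy i = sy k \<and> ps i < ps k"
proof -
  assume ik: "i < k" "k < n"
  then have i: "i < n" by simp
  have lt: "suf i < suf k" using ik by (rule suf_strict)
  have "sy i \<le> sy k" using lt suf_nonempty[OF i] suf_nonempty[OF ik(2)] unfolding sy_def
    by (cases "suf i"; cases "suf k") auto
  moreover have "ps i < ps k" if e: "sy i = sy k"
  proof -
    have "SA T (i + 1) \<noteq> n"
    proof
      assume "SA T (i + 1) = n"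
      then have "SA T (k + 1) = n" using e sy_last_iff[OF i] sy_last_iff[OF ik(2)] by simp
      then show False using \<open>SA T (i + 1) = n\<close> SA_inj[OF i ik(2)] ik by simp
    qed
    moreover from this have "SA T (k + 1) \<noteq> n" using e sy_last_iff[OF i] sy_last_iff[OF ik(2)] by simp
    ultimately have "SA T (i + 1) < n" "SA T (k + 1) < n" using SA_range[OF i] SA_range[OF ik(2)] by auto
    then have "suf (ps i) < suf (ps k)" using lt suf_Cons[OF i] suf_Cons[OF ik(2)] e by simp
    then show ?thesis using suf_less_iff[OF ps_less[OF i] ps_less[OF ik(2)]] by simp
  qed
  ultimately show ?thesis by auto
qed

lemma mem_symbol_range: "k \<in> symbol_range T c \<longleftrightarrow> 1 \<le> k \<and> k \<le> n \<and> sy (k - 1) = c"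
  by (auto simp: symbol_range_def sy_def suf_def)

definition head :: "nat \<Rightarrow> bool" where
  "head k \<longleftrightarrow> k < n \<and> (k = 0 \<or> sy k \<noteq> sy (k - 1) \<or> ps k \<noteq> ps (k - 1) + 1)"

lemma psi_segment_iff:
  "psi_segment T A \<longleftrightarrow> (\<exists>i j. i \<le> j \<and> A = {i..j} \<and> 1 \<le> i \<and> j \<le> n \<and>
     (\<forall>k. i \<le> k \<and> k < j \<longrightarrow> sy k = sy (k - 1) \<and> ps k = ps (k - 1) + 1))"
proof
  assume "psi_segment T A"
  then obtain i j c where A: "i \<le> j" "A = {i..j}" "A \<subseteq> symbol_range T c"
    "\<And>k. i \<le> k \<and> k < j \<Longrightarrow> Psi T (k + 1) = Psi T k + 1" unfolding psi_segment_def by blast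
  have m: "1 \<le> k \<and> k \<le> n \<and> sy (k - 1) = c" if "i \<le> k" "k \<le> j" for k
    using A(2,3) that mem_symbol_range by auto
  have "sy k = sy (k - 1) \<and> ps k = ps (k - 1) + 1" if "i \<le> k" "k < j" for k
  proof -
    have "k < n" "1 \<le> k" using m[of j] m[of k] that A(1) by auto
    then show ?thesis using A(4)[of k] that m[of k] m[of "k + 1"] Psi_ps[of k] Psi_ps[of "k - 1"] by simp
  qed
  then show "\<exists>i j. i \<le> j \<and> A = {i..j} \<and> 1 \<le> i \<and> j \<le> n \<and>
     (\<forall>k. i \<le> k \<and> k < j \<longrightarrow> sy k = sy (k - 1) \<and> ps k = ps (k - 1) + 1)"
    using A(1,2) m[of i] m[of j] by blast
next
  assume "\<exists>i j. i \<le> j \<and> A = {i..j} \<and> 1 \<le> i \<and> j \<le> n \<and>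
     (\<forall>k. i \<le> k \<and> k < j \<longrightarrow> sy k = sy (k - 1) \<and> ps k = ps (k - 1) + 1)"
  then obtain i j where A: "i \<le> j" "A = {i..j}" "1 \<le> i" "j \<le> n"
    "\<And>k. i \<le> k \<Longrightarrow> k < j \<Longrightarrow> sy k = sy (k - 1) \<and> ps k = ps (k - 1) + 1" by blast
  have c: "sy (k - 1) = sy (i - 1)" if "i \<le> k" "k \<le> j" for k
    using that
  proof (induction k rule: dec_induct)
    case (step k) then show ?case using A(5)[of k] by simp
  qed simp
  have "A \<subseteq> symbol_range T (sy (i - 1))"
  proof
    fix k assume "k \<in> A"
    then have "i \<le> k" "k \<le> j" using A(2) by auto
    then show "k \<in> symbol_range T (sy (i - 1))" unfolding mem_symbol_range using c[of k] A(3,4) by linarith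
  qed
  moreover have "Psi T (k + 1) = Psi T k + 1" if "i \<le> k" "k < j" for k
    using A(5)[OF that] Psi_ps[of k] Psi_ps[of "k - 1"] that A(3,4) by simp
  ultimately show "psi_segment T A" unfolding psi_segment_def using A(1,2) by blast
qed

lemma head_Min_run: "psi_run T A \<Longrightarrow> \<exists>i j. i \<le> j \<and> A = {i..j} \<and> 1 \<le> i \<and> head (i - 1)"
proof -
  assume run: "psi_run T A"
  then obtain i j where A: "i \<le> j" "A = {i..j}" "1 \<le> i" "j \<le> n"
    "\<And>k. i \<le> k \<Longrightarrow> k < j \<Longrightarrow> sy k = sy (k - 1) \<and> ps k = ps (k - 1) + 1"
    unfolding psi_run_def psi_segment_iff by blast
  have "head (i - 1)"
  proof (rule ccontr)
    assume "\<not> head (i - 1)"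
    then have h: "2 \<le> i" "sy (i - 1) = sy (i - 1 - 1)" "ps (i - 1) = ps (i - 1 - 1) + 1"
      using A by (auto simp: head_def)
    have st: "sy k = sy (k - 1) \<and> ps k = ps (k - 1) + 1" if "i - 1 \<le> k" "k < j" for k
    proof (cases "k = i - 1")
      case True then show ?thesis using h by simp
    next
      case False then show ?thesis using A(5)[of k] that by simp
    qed
    have "i - 1 \<le> j" "1 \<le> i - 1" using A h by auto
    then have "psi_segment T {i - 1..j}" unfolding psi_segment_iff using A(4) st by blast
    then have "{i - 1..j} = {i..j}" using run A(2) unfolding psi_run_def by (metis atLeastatMost_subset_iff diff_le_self order_refl)
    moreover have "i - 1 \<in> {i - 1..j}" using A by auto
    ultimately show False using h by auto
  qed
  then show ?thesis using A by blast
qed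

lemma num_runs_heads: "num_psi_runs T = card {k. head k}"
proof -
  have "bij_betw (\<lambda>A. Min A - 1) {A. psi_run T A} {k. head k}"
    unfolding bij_betw_def
  proof (intro conjI)
    show "inj_on (\<lambda>A. Min A - 1) {A. psi_run T A}"
    proof (rule inj_onI)
      fix A B assume AB: "A \<in> {A. psi_run T A}" "B \<in> {A. psi_run T A}" "Min A - 1 = Min B - 1"
      then obtain i j i' j' where A: "i \<le> j" "A = {i..j}" "1 \<le> i" and B: "i' \<le> j'" "B = {i'..j'}" "1 \<le> i'"
        using head_Min_run by (metis mem_Collect_eq)
      have "Min A = i" "Min B = i'" using A B by (auto intro!: Min_eqI)
      then have "i = i'" using AB(3) A B by simp
      then have "A \<subseteq> B \<or> B \<subseteq> A" using A B by auto
      then show "A = B" using AB unfolding psi_run_def by auto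
    qed
    show "(\<lambda>A. Min A - 1) ` {A. psi_run T A} = {k. head k}"
    proof (intro equalityI subsetI)
      fix k assume "k \<in> (\<lambda>A. Min A - 1) ` {A. psi_run T A}"
      then obtain A where A: "psi_run T A" "k = Min A - 1" by auto
      then obtain i j where "i \<le> j" "A = {i..j}" "head (i - 1)" using head_Min_run by blast
      moreover from this have "Min A = i" by (auto intro!: Min_eqI)
      ultimately show "k \<in> {k. head k}" using A by simp
    next
      fix h assume "h \<in> {k. head k}"
      then have h: "head h" by simp
      define J where "J = {j. psi_segment T {h + 1..j}}"
      have Jsub: "J \<subseteq> {h + 1..n}"
      proof
        fix j assume "j \<in> J"
        then obtain i' j' where "i' \<le> j'" "{h + 1..j} = {i'..j'}" "1 \<le> i'" "j' \<le> n"
          unfolding J_def psi_segment_iff by blast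
        then show "j \<in> {h + 1..n}" by (auto simp: Icc_eq_Icc)
      qed
      have fin: "finite J" by (rule finite_subset[OF Jsub]) simp
      have "h + 1 \<in> J" using h unfolding J_def psi_segment_iff
        by (auto simp: head_def intro!: exI[of _ "h + 1"])
      then have ne: "J \<noteq> {}" by blast
      define m where "m = Max J"
      have mJ: "m \<in> J" unfolding m_def using fin ne by (rule Max_in)
      have hm: "h + 1 \<le> m" using mJ Jsub by auto
      have "psi_run T {h + 1..m}" unfolding psi_run_def
      proof (intro conjI allI impI)
        show "psi_segment T {h + 1..m}" using mJ by (simp add: J_def)
        fix B assume B: "psi_segment T B \<and> {h + 1..m} \<subseteq> B"
        then obtain i j where ij: "i \<le> j" "B = {i..j}" "1 \<le> i" "j \<le> n"
          "\<And>k. i \<le> k \<Longrightarrow> k < j \<Longrightarrow> sy k = sy (k - 1) \<and> ps k = ps (k - 1) + 1"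
          unfolding psi_segment_iff by blast
        have sub: "i \<le> h + 1" "m \<le> j" using B ij(2) hm by auto
        have "i = h + 1"
        proof (rule ccontr)
          assume "i \<noteq> h + 1"
          then have "i \<le> h" "h < j" using sub hm by auto
          then show False using ij(5)[of h] ij(3) h by (auto simp: head_def)
        qed
        moreover from this have "j \<in> J" using B ij(2) by (simp add: J_def)
        then have "j \<le> m" unfolding m_def using fin by simp
        ultimately show "B = {h + 1..m}" using sub ij(2) by simp
      qed
      moreover have "Min {h + 1..m} = h + 1" using hm by (auto intro!: Min_eqI)
      ultimately show "h \<in> (\<lambda>A. Min A - 1) ` {A. psi_run T A}"
        by (intro image_eqI[of _ _ "{h + 1..m}"]) auto
    qed
  qed
  then show ?thesis unfolding num_psi_runs_def by (rule bij_betw_same_card)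
qed


definition r :: nat where "r = card {k. head k}"
definition hs :: "nat list" where "hs = sorted_list_of_set {k. head k}"
definition pos :: "nat \<Rightarrow> nat" where "pos u = (if u < r then hs ! u else n)"

lemma finite_heads: "finite {k. head k}"
  by (rule finite_subset[of _ "{..<n}"]) (auto simp: head_def)

lemma hs: "length hs = r" "set hs = {k. head k}" "sorted_wrt (<) hs"
  unfolding hs_def r_def using finite_heads by (auto simp: length_sorted_list_of_set)

lemma pos_head: "u < r \<Longrightarrow> head (pos u)"
  using hs nth_mem[of u hs] by (auto simp: pos_def)

lemma pos_less_n: "u < r \<Longrightarrow> pos u < n"
  using pos_head[of u] by (simp add: head_def)

lemma pos_less: "u < v \<Longrightarrow> v \<le> r \<Longrightarrow> pos u < pos v"
proof (cases "v < r")
  case True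
  assume "u < v"
  then show ?thesis using True hs(1) sorted_wrt_nth_less[OF hs(3), of u v] by (simp add: pos_def)
next
  case False
  assume "u < v" "v \<le> r"
  then show ?thesis using False pos_less_n[of u] by (simp add: pos_def)
qed

lemma pos_mono: "u \<le> v \<Longrightarrow> v \<le> r \<Longrightarrow> pos u \<le> pos v"
  using pos_less[of u v] by (cases "u = v") auto

lemma pos_le_n: "pos u \<le> n"
  using pos_less_n[of u] by (cases "u < r") (auto simp: pos_def)

lemma pos_r: "pos r = n" by (simp add: pos_def)

lemma head_pos: "head k \<Longrightarrow> \<exists>u<r. k = pos u"
  using hs by (metis in_set_conv_nth mem_Collect_eq pos_def)

lemma r1: "1 \<le> r" "r \<le> n"
proof -
  have "head 0" using n1 by (simp add: head_def)
  then show "1 \<le> r" unfolding r_def using finite_heads by (metis (mono_tags) One_nat_def Suc_leI card_gt_0_iff empty_iff mem_Collect_eq)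
  have "card {k. head k} \<le> card {..<n}" by (intro card_mono) (auto simp: head_def)
  then show "r \<le> n" by (simp add: r_def)
qed

lemma pos_0: "pos 0 = 0"
proof -
  have "head 0" using n1 by (simp add: head_def)
  then obtain u where "u < r" "0 = pos u" using head_pos by blast
  then show ?thesis using pos_mono[of 0 u] by simp
qed

lemma in_run:
  assumes "k < n" obtains u where "u < r" "pos u \<le> k" "k < pos (u + 1)"
proof -
  let ?U = "{u. u < r \<and> pos u \<le> k}"
  have f: "finite ?U" by simp
  have "0 \<in> ?U" using pos_0 r1 by simp
  then have ne: "?U \<noteq> {}" by blast
  let ?u = "Max ?U"
  have m: "?u \<in> ?U" using f ne by (rule Max_in)
  have "k < pos (?u + 1)"
  proof (rule ccontr)
    assume a: "\<not> k < pos (?u + 1)"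
    have "?u + 1 < r"
    proof (rule ccontr)
      assume "\<not> ?u + 1 < r"
      then have "?u + 1 = r" using m by simp
      then show False using a pos_r assms by simp
    qed
    then have "?u + 1 \<in> ?U" using a by simp
    then have "?u + 1 \<le> ?u" using f by (rule Max_ge[rotated])
    then show False by simp
  qed
  then show ?thesis using that m by blast
qed

definition su :: "nat \<Rightarrow> nat" where "su u = sy (pos u)"
definition vu :: "nat \<Rightarrow> nat" where "vu u = ps (pos u)"

lemma within_run:
  assumes "u < r" "pos u \<le> k" "k < pos (u + 1)"
  shows "sy k = su u \<and> ps k = vu u + (k - pos u)"
  using assms(2,3)
proof (induction k rule: dec_induct)
  case base then show ?case by (simp add: su_def vu_def)
next
  case (step k)
  have "Suc k < n" using step pos_le_n[of "u + 1"] by linarith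
  moreover have "\<not> head (Suc k)"
  proof
    assume "head (Suc k)"
    then obtain v where v: "v < r" "Suc k = pos v" using head_pos by blast
    then have "u < v" using step(1) pos_mono[of v u] assms(1) by (metis less_imp_le_nat not_less not_less_eq_eq le_trans)
    then have "pos (u + 1) \<le> pos v" using v by (intro pos_mono) auto
    then show False using step v by simp
  qed
  ultimately have "sy (Suc k) = sy k \<and> ps (Suc k) = ps k + 1" by (simp add: head_def)
  then show ?case using step by (simp add: Suc_diff_le)
qed

lemma run_order: "u < v \<Longrightarrow> v < r \<Longrightarrow> su u < su v \<or> su u = su v \<and> vu u < vu v"
  unfolding su_def vu_def by (rule sy_ps_mono) (auto intro: pos_less pos_less_n)

definition F :: "nat \<Rightarrow> nat \<Rightarrow> nat" where
  "F c x = card {k. k < n \<and> (sy k < c \<or> sy k = c \<and> ps k < x)}"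

lemma F_iff: "k < n \<Longrightarrow> sy k < c \<or> sy k = c \<and> ps k < x \<longleftrightarrow> k < F c x"
  unfolding F_def
proof (rule initial_segment_card)
  fix k k' assume k: "k' \<le> k" "k < n" "sy k < c \<or> sy k = c \<and> ps k < x"
  show "sy k' < c \<or> sy k' = c \<and> ps k' < x"
    using sy_ps_mono[of k' k] k by (cases "k' = k") auto
qed

lemma F_le: "F c x \<le> n"
  using card_mono[of "{..<n}" "{k. k < n \<and> (sy k < c \<or> sy k = c \<and> ps k < x)}"] by (auto simp: F_def)

definition fst_run :: "nat \<Rightarrow> nat" where "fst_run c = card {u. u < r \<and> su u < c}"
definition nxt_run :: "nat \<Rightarrow> nat \<Rightarrow> nat" where
  "nxt_run c x = card {u. u < r \<and> (su u < c \<or> su u = c \<and> vu u < x)}"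

lemma fst_run_iff: "u < r \<Longrightarrow> su u < c \<longleftrightarrow> u < fst_run c"
  unfolding fst_run_def
proof (rule initial_segment_card)
  fix k k' assume k: "k' \<le> k" "k < r" "su k < c"
  show "su k' < c" using run_order[of k' k] k by (cases "k' = k") auto
qed

lemma nxt_run_iff: "u < r \<Longrightarrow> su u < c \<or> su u = c \<and> vu u < x \<longleftrightarrow> u < nxt_run c x"
  unfolding nxt_run_def
proof (rule initial_segment_card)
  fix k k' assume k: "k' \<le> k" "k < r" "su k < c \<or> su k = c \<and> vu k < x"
  show "su k' < c \<or> su k' = c \<and> vu k' < x" using run_order[of k' k] k by (cases "k' = k") auto
qed

lemma run_counts: "fst_run c \<le> nxt_run c x" "nxt_run c x \<le> r"
proof -
  show "fst_run c \<le> nxt_run c x" unfolding fst_run_def nxt_run_def by (intro card_mono) auto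
  show "nxt_run c x \<le> r" using card_mono[of "{..<r}" "{u. u < r \<and> (su u < c \<or> su u = c \<and> vu u < x)}"]
    by (auto simp: nxt_run_def)
qed

lemma F_eq:
  "F c x = (if nxt_run c x \<le> fst_run c then pos (fst_run c)
     else pos (nxt_run c x - 1) + min (pos (nxt_run c x) - pos (nxt_run c x - 1)) (x - vu (nxt_run c x - 1)))"
proof -
  let ?U = "nxt_run c x" and ?f = "fst_run c"
  show ?thesis
  proof (cases "?U \<le> ?f")
    case True
    then have U: "?U = ?f" using run_counts(1)[of c x] by simp
    have "F c x = pos ?f" unfolding F_def
    proof (rule card_initial[OF pos_le_n])
      fix k assume "k < n"
      then obtain u where u: "u < r" "pos u \<le> k" "k < pos (u + 1)" by (rule in_run)
      note wr = within_run[OF u]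
      show "sy k < c \<or> sy k = c \<and> ps k < x \<longleftrightarrow> k < pos ?f"
      proof (cases "u < ?f")
        case True
        then have "pos (u + 1) \<le> pos ?f" using run_counts[of c x] U by (intro pos_mono) auto
        then show ?thesis using fst_run_iff[OF u(1)] True wr u by auto
      next
        case False
        then have "pos ?f \<le> pos u" using u by (intro pos_mono) auto
        then show ?thesis using nxt_run_iff[OF u(1), of c x] fst_run_iff[OF u(1), of c] False U wr u by auto
      qed
    qed
    then show ?thesis using True by simp
  next
    case False
    let ?v = "?U - 1"
    have v: "?v < r" "?v + 1 = ?U" "?v < ?U" "\<not> ?v < ?f" using False run_counts[of c x] by auto
    have sv: "su ?v = c" "vu ?v < x" using nxt_run_iff[OF v(1), of c x] fst_run_iff[OF v(1), of c] v by auto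
    let ?R = "pos ?v + min (pos ?U - pos ?v) (x - vu ?v)"
    have pv: "pos ?v \<le> pos ?U" using run_counts[of c x] by (intro pos_mono) auto
    have "F c x = ?R" unfolding F_def
    proof (rule card_initial)
      show "?R \<le> n" using pos_le_n[of ?U] pv by linarith
      fix k assume k: "k < n"
      then obtain u where u: "u < r" "pos u \<le> k" "k < pos (u + 1)" by (rule in_run)
      note wr = within_run[OF u]
      consider "u < ?v" | "u = ?v" | "?v < u" by linarith
      then show "sy k < c \<or> sy k = c \<and> ps k < x \<longleftrightarrow> k < ?R"
      proof cases
        case 1
        then have "pos (u + 1) \<le> pos ?v" using v by (intro pos_mono) auto
        then have kv: "k < pos ?v" using u by simp
        have "pos ?v < F c x" using F_iff[of "pos ?v" c x] sv pos_less_n[OF v(1)] by (simp add: su_def vu_def)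
        then show ?thesis using F_iff[OF k, of c x] kv by simp
      next
        case 2
        then have *: "sy k = c" "ps k = vu ?v + (k - pos ?v)" "pos ?v \<le> k" "k < pos ?U"
          using wr sv u v by simp_all
        have "k < ?R \<longleftrightarrow> k - pos ?v < min (pos ?U - pos ?v) (x - vu ?v)" using *(3) by linarith
        also have "\<dots> \<longleftrightarrow> ps k < x" unfolding min_less_iff_conj using * sv(2) by linarith
        finally show ?thesis using *(1) by simp
      next
        case 3
        then have "pos ?U \<le> pos u" using u v by (intro pos_mono) auto
        moreover have "\<not> u < ?U" using 3 by simp
        ultimately show ?thesis using nxt_run_iff[OF u(1), of c x] wr u pv by auto
      qed
    qed
    then show ?thesis using False by simp
  qed
qed


definition loP :: "nat list \<Rightarrow> nat" where "loP P = card {k. k < n \<and> suf k < P}"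
definition hiP :: "nat list \<Rightarrow> nat" where "hiP P = card {k. k < n \<and> (suf k < P \<or> prefix P (suf k))}"

lemma prefix_imp_le: "prefix P xs \<Longrightarrow> P \<le> (xs :: nat list)"
proof -
  assume "prefix P xs"
  then obtain zs where "xs = P @ zs" by (rule prefixE)
  moreover have "P \<le> P @ zs" by (induction P) auto
  ultimately show ?thesis by simp
qed

lemma loP_iff: "k < n \<Longrightarrow> suf k < P \<longleftrightarrow> k < loP P"
  unfolding loP_def by (rule initial_segment_card) (use suf_mono le_less_trans in blast)+

lemma hiP_iff: "k < n \<Longrightarrow> suf k < P \<or> prefix P (suf k) \<longleftrightarrow> k < hiP P"
  unfolding hiP_def
proof (rule initial_segment_card)
  fix k k' assume k: "k' \<le> k" "k < n" "suf k < P \<or> prefix P (suf k)"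
  show "suf k' < P \<or> prefix P (suf k')"
  proof (rule disjCI)
    assume np: "\<not> prefix P (suf k')"
    show "suf k' < P"
    proof (cases "suf k < P")
      case True then show ?thesis using suf_mono[OF k(1,2)] by simp
    next
      case False
      then have "prefix P (suf k)" using k by simp
      then have "\<not> P \<le> suf k'" using prefix_between[of P P "suf k" "suf k'"] suf_mono[OF k(1,2)] np by auto
      then show ?thesis by simp
    qed
  qed
qed

lemma hi_lo_occ: "hiP P - loP P = occ T P"
proof -
  have "{k. k < n \<and> (suf k < P \<or> prefix P (suf k))} = {k. k < n \<and> suf k < P} \<union> {k. k < n \<and> prefix P (suf k)}"
    by auto
  moreover have "{k. k < n \<and> suf k < P} \<inter> {k. k < n \<and> prefix P (suf k)} = {}"
    using prefix_imp_le by fastforce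
  ultimately have "hiP P = loP P + card {k. k < n \<and> prefix P (suf k)}"
    unfolding hiP_def loP_def by (simp add: card_Un_disjoint)
  moreover have "bij_betw (\<lambda>k. SA T (k + 1)) {k. k < n \<and> prefix P (suf k)} {i \<in> {1..n}. prefix P (suffix_at T i)}"
    unfolding bij_betw_def
  proof
    show "inj_on (\<lambda>k. SA T (k + 1)) {k. k < n \<and> prefix P (suf k)}"
      by (rule inj_onI) (use SA_inj in auto)
    show "(\<lambda>k. SA T (k + 1)) ` {k. k < n \<and> prefix P (suf k)} = {i \<in> {1..n}. prefix P (suffix_at T i)}"
    proof (intro equalityI subsetI)
      fix i assume "i \<in> (\<lambda>k. SA T (k + 1)) ` {k. k < n \<and> prefix P (suf k)}"
      then show "i \<in> {i \<in> {1..n}. prefix P (suffix_at T i)}" using SA_range by (auto simp: suf_def)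
    next
      fix i assume "i \<in> {i \<in> {1..n}. prefix P (suffix_at T i)}"
      then have i: "i \<in> {1..n}" "prefix P (suffix_at T i)" by auto
      note si = SA_inv_range[OF i(1)]
      show "i \<in> (\<lambda>k. SA T (k + 1)) ` {k. k < n \<and> prefix P (suf k)}"
        using si i by (intro image_eqI[of _ _ "SA_inv T i - 1"]) (auto simp: suf_def)
    qed
  qed
  ultimately show ?thesis using bij_betw_same_card occ_eq_card[of T P] by fastforce
qed

lemma hiP_le: "hiP P \<le> n" "loP P \<le> n"
  using card_mono[of "{..<n}" "{k. k < n \<and> (suf k < P \<or> prefix P (suf k))}"]
    card_mono[of "{..<n}" "{k. k < n \<and> suf k < P}"]
  by (auto simp: hiP_def loP_def)

lemma loP_Nil: "loP [] = 0" by (simp add: loP_def)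
lemma hiP_Nil: "hiP [] = n" by (simp add: hiP_def)

text \<open>\<open>\<Psi>\<close> is cyclic but occurrences are not, so the step fails for the terminator in front of a nonempty pattern.\<close>

lemma backward_step:
  assumes "c \<noteq> last T \<or> P = []"
  shows "loP (c # P) = F c (loP P)" "hiP (c # P) = F c (hiP P)"
proof -
  have main: "(suf k < c # P \<longleftrightarrow> sy k < c \<or> sy k = c \<and> ps k < loP P) \<and>
      (suf k < c # P \<or> prefix (c # P) (suf k) \<longleftrightarrow> sy k < c \<or> sy k = c \<and> ps k < hiP P)" if k: "k < n" for k
  proof (cases "SA T (k + 1) = n")
    case True
    then have sk: "suf k = [last T]" "sy k = last T" using suf_last[OF k] sy_last_iff[OF k] by auto
    show ?thesis
    proof (cases "c = last T")
      case True
      then show ?thesis using assms sk loP_Nil hiP_Nil ps_less[OF k] by simp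
    next
      case False
      then show ?thesis using sk by auto
    qed
  next
    case False
    then have "SA T (k + 1) < n" using SA_range[OF k] by auto
    note sc = suf_Cons[OF k this]
    show ?thesis unfolding sc using loP_iff[OF ps_less[OF k], of P] hiP_iff[OF ps_less[OF k], of P] by auto
  qed
  show "loP (c # P) = F c (loP P)" unfolding loP_def[of "c # P"] F_def using main
    by (intro arg_cong[of _ _ card]) blast
  show "hiP (c # P) = F c (hiP P)" unfolding hiP_def[of "c # P"] F_def using main
    by (intro arg_cong[of _ _ card]) blast
qed

lemma occ_zero:
  assumes "c \<notin> set T \<or> c = last T \<and> P \<noteq> [] \<or> occ T P = 0"
  shows "occ T (c # P) = 0"
proof -
  have "\<not> prefix (c # P) (suffix_at T i)" if i: "i \<in> {1..n}" for i
  proof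
    assume p: "prefix (c # P) (suffix_at T i)"
    obtain k where k: "k < n" "SA T (k + 1) = i"
      using SA_inv_range[OF i] by (intro that[of "SA_inv T i - 1"]) auto
    have p: "prefix (c # P) (suf k)" using p k by (simp add: suf_def)
    then have c: "sy k = c" by (auto simp: sy_def prefix_def)
    from assms show False
    proof (elim disjE)
      assume "c \<notin> set T" then show False using c sy_in[OF k(1)] by simp
    next
      assume a: "c = last T \<and> P \<noteq> []"
      then have "SA T (k + 1) = n" using c sy_last_iff[OF k(1)] by simp
      then have "suf k = [last T]" using suf_last[OF k(1)] by simp
      then show False using p a by simp
    next
      assume a: "occ T P = 0"
      show False
      proof (cases "SA T (k + 1) = n")
        case True
        then have "suf k = [last T]" using suf_last[OF k(1)] by simp
        then have "P = []" using p by simp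
        then show False using a hi_lo_occ[of P] loP_Nil hiP_Nil by simp
      next
        case False
        then have "SA T (k + 1) < n" using SA_range[OF k(1)] by auto
        from suf_Cons[OF k(1) this] have "prefix P (suf (ps k))" using p by simp
        moreover have "loP P = hiP P \<or> hiP P < loP P" using a hi_lo_occ[of P] by linarith
        ultimately show False
          using loP_iff[OF ps_less[OF k(1)], of P] hiP_iff[OF ps_less[OF k(1)], of P] prefix_imp_le[of P "suf (ps k)"] by auto
      qed
    qed
  qed
  then show ?thesis unfolding occ_eq_card by (simp add: card_eq_0_iff)
qed


definition ds :: "nat list" where "ds = sorted_list_of_set (set T)"
definition d :: nat where "d = card (set T)"
definition sid :: "nat \<Rightarrow> nat" where "sid c = card {c' \<in> set T. c' < c}"

lemma ds: "length ds = d" "set ds = set T" "sorted_wrt (<) ds"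
  unfolding ds_def d_def by (auto simp: length_sorted_list_of_set)

lemma ds_less_iff: "t < d \<Longrightarrow> t' < d \<Longrightarrow> ds ! t < ds ! t' \<longleftrightarrow> t < t'"
  using sorted_wrt_nth_less[OF ds(3)] ds(1) by (metis linorder_neqE_nat order_less_asym)

lemma ds_in: "t < d \<Longrightarrow> ds ! t \<in> set T"
  using ds nth_mem by metis

lemma sid_ds: "t < d \<Longrightarrow> sid (ds ! t) = t"
proof -
  assume t: "t < d"
  have "{c' \<in> set T. c' < ds ! t} = (\<lambda>i. ds ! i) ` {..<t}"
  proof (intro equalityI subsetI)
    fix c assume "c \<in> {c' \<in> set T. c' < ds ! t}"
    then have "c \<in> set ds" "c < ds ! t" unfolding ds(2) by auto
    then obtain i where "i < d" "c = ds ! i" "c < ds ! t" using ds(1) by (metis in_set_conv_nth)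
    then show "c \<in> (\<lambda>i. ds ! i) ` {..<t}" using ds_less_iff[of i t] t by auto
  next
    fix c assume "c \<in> (\<lambda>i. ds ! i) ` {..<t}"
    then show "c \<in> {c' \<in> set T. c' < ds ! t}" using t ds_in ds_less_iff by auto
  qed
  moreover have "inj_on (\<lambda>i. ds ! i) {..<t}"
    using t ds_less_iff by (intro inj_onI) (metis lessThan_iff less_trans linorder_neqE_nat less_irrefl)
  ultimately show ?thesis unfolding sid_def by (simp add: card_image)
qed

lemma ds_sid: "c \<in> set T \<Longrightarrow> sid c < d \<and> ds ! sid c = c"
  using ds sid_ds by (metis in_set_conv_nth)

lemma sid_less_iff: "c \<in> set T \<Longrightarrow> c' \<in> set T \<Longrightarrow> sid c < sid c' \<longleftrightarrow> c < c'"
  using ds_less_iff[of "sid c" "sid c'"] ds_sid by simp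

lemma sid_eq_iff: "c \<in> set T \<Longrightarrow> c' \<in> set T \<Longrightarrow> sid c = sid c' \<longleftrightarrow> c = c'"
  using ds_sid by metis

lemma d1: "1 \<le> d"
  unfolding d_def by (simp add: Suc_le_eq card_gt_0_iff)

lemma sid_last: "c \<in> set T \<Longrightarrow> sid c = 0 \<longleftrightarrow> c = last T"
proof -
  assume c: "c \<in> set T"
  have "last T \<in> set T" by simp
  moreover have "sid (last T) = 0" unfolding sid_def using last_le by (auto simp: card_eq_0_iff not_less)
  ultimately show ?thesis using sid_eq_iff[OF c] by metis
qed

lemma su_in: "u < r \<Longrightarrow> su u \<in> set T"
  unfolding su_def by (rule sy_in[OF pos_less_n])

lemma d_le_r: "d \<le> r"
proof -
  have "set T \<subseteq> su ` {..<r}"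
  proof
    fix c assume "c \<in> set T"
    then obtain i where i: "i < n" "c = T ! i" by (metis in_set_conv_nth)
    then have "i + 1 \<in> {1..n}" by simp
    note si = SA_inv_range[OF this]
    define k where "k = SA_inv T (i + 1) - 1"
    have k: "k < n" "SA T (k + 1) = i + 1" using si by (auto simp: k_def)
    then have "sy k = c" using sy_nth[OF k(1)] i by simp
    moreover from k(1) obtain u where "u < r" "pos u \<le> k" "k < pos (u + 1)" by (rule in_run)
    ultimately show "c \<in> su ` {..<r}" using within_run[of u k] by auto
  qed
  then have "card (set T) \<le> card (su ` {..<r})" by (intro card_mono) auto
  also have "\<dots> \<le> card {..<r}" by (intro card_image_le) simp
  finally show ?thesis by (simp add: d_def)
qed

lemma set_T: "c \<in> set T \<Longrightarrow> 1 \<le> c \<and> c \<le> \<sigma>"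
  using Ttext by (auto simp: is_text_def)

lemma vu_less: "u < r \<Longrightarrow> vu u < n"
  unfolding vu_def by (rule ps_less[OF pos_less_n])

end

lemma trie_ok_cong:
  assumes "\<And>c i. c < 11 \<Longrightarrow> W c i = W' c i"
  shows "trie_ok w W L \<beta> d0 Smp lo hi = trie_ok w W' L \<beta> d0 Smp lo hi"
proof -
  have h: "hstep w W c = hstep w W' c" if "c + 2 < 11" for c
    using assms[of c] assms[of "c + 1"] assms[of "c + 2"] that by (auto simp: hstep_def fun_eq_iff)
  have s: "slot w W = slot w W'" by (simp add: slot_def fun_eq_iff h)
  have "W 6 = W' 6" "W 7 = W' 7" "W 8 = W' 8" "W 9 = W' 9" "W 10 = W' 10" using assms by auto
  then show ?thesis unfolding trie_ok_def s by (simp only:)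
qed

definition pred_tables ::
  "nat \<Rightarrow> nat \<Rightarrow> nat \<Rightarrow> nat \<Rightarrow> (nat \<Rightarrow> nat) \<Rightarrow> (nat \<Rightarrow> nat) \<Rightarrow> nat \<Rightarrow> nat \<Rightarrow> nat \<Rightarrow> (nat \<Rightarrow> nat) \<Rightarrow> (nat \<Rightarrow> nat \<Rightarrow> nat) \<Rightarrow> nat \<Rightarrow> nat \<Rightarrow> bool" where
  "pred_tables N NB e w bk key L \<beta> T tp W f g \<longleftrightarrow>
     (\<forall>j<NB. (tp j = 0 \<longrightarrow> keyed.st N bk (j + 1) - keyed.st N bk j \<le> g) \<and>
       (tp j \<noteq> 0 \<longrightarrow> 1 \<le> L \<and> 1 \<le> \<beta> \<and> 2 * L * (\<beta> + 1) < 2 ^ w \<and> tp j - 1 + L < 2 ^ w \<and> L \<le> 2 ^ T \<and>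
          2 ^ \<beta> * (\<beta> + 1) \<le> w \<and>
         (\<forall>x. (\<forall>u<N. bk u = j \<longrightarrow> key u div 2 ^ e = x div 2 ^ e) \<longrightarrow>
           (\<exists>Smp lo hi. trie_ok w W L \<beta> (tp j - 1) Smp lo hi \<and> x div 2 ^ (\<beta> * L) \<in> trie_prefixes L \<beta> Smp 0 \<and>
              keyed.st N bk j \<le> lo (card {y \<in> Smp. y < x}) \<and>
              lo (card {y \<in> Smp. y < x}) \<le> keyed.ans N bk key j x \<and>
              keyed.ans N bk key j x \<le> hi (card {y \<in> Smp. y < x}) \<and>
              hi (card {y \<in> Smp. y < x}) \<le> keyed.st N bk (j + 1) \<and>
              hi (card {y \<in> Smp. y < x}) - lo (card {y \<in> Smp. y < x}) \<le> g))))"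

lemma pow2_gt: "16 \<le> w \<Longrightarrow> 6 * w + 4 < (2::nat) ^ w"
  by (induction w rule: dec_induct) auto

lemma pred_tables_exist:
  assumes k: "keyed N NB e bk key" and R: "N \<le> R" "R < 2 ^ w" "1 \<le> f" "1 \<le> w"
    and keys: "\<forall>u<N. key u < 2 ^ w" and ew: "e \<le> w"
  shows "\<exists>L \<beta> T tp W g. L \<le> e + 1 \<and> \<beta> \<le> e + 1 \<and> (w < 16 \<longrightarrow> L = 0 \<and> \<beta> = 0) \<and>
    (\<forall>j. tp j \<le> R) \<and> (\<forall>j\<ge>NB. tp j = 0) \<and> (\<forall>c i. W c i < 2 ^ w) \<and> (\<forall>c i. R div f \<le> i \<longrightarrow> W c i = 0) \<and>
    g < 2 ^ T * f \<and> pred_tables N NB e w bk key L \<beta> T tp W f g \<and>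
    (w < 16 \<and> T = 16 \<or> 16 \<le> w \<and> 2 ^ T \<le> 2 * (64 * L + 1) \<and> real L \<le> 4 * real e / log 2 (real w) + 1)"
proof (cases "w < 16")
  case True
  have "(2::nat) ^ w \<le> 2 ^ 16" using True by (intro power_increasing) auto
  then have N: "N < 2 ^ 16 * 1" using R by linarith
  also have "(2::nat) ^ 16 * 1 \<le> 2 ^ 16 * f" using R(3) by (rule mult_le_mono2)
  finally have N: "N < 2 ^ 16 * f" .
  have "keyed.st N bk (j + 1) - keyed.st N bk j \<le> N" for j
    using keyed.st_le[OF k, of "j + 1"] by simp
  then have "pred_tables N NB e w bk key 0 0 16 (\<lambda>_. 0) (\<lambda>_ _. 0) f N" by (simp add: pred_tables_def)
  then show ?thesis using True N
    by (intro exI[of _ 0] exI[of _ 16] exI[of _ "\<lambda>_. 0"] exI[of _ "\<lambda>_ _. 0"] exI[of _ N]) auto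
next
  case False
  then have w16: "16 \<le> w" by simp
  obtain a where a: "2 ^ a \<le> w" "w < 2 ^ (a + 1)" using ex_power_ivl1[of 2 w] w16 by auto
  have a4: "4 \<le> a"
  proof (rule ccontr)
    assume "\<not> 4 \<le> a"
    then have "(2::nat) ^ (a + 1) \<le> 2 ^ 4" by (intro power_increasing) auto
    then show False using a(2) w16 by simp
  qed
  define b where "b = a div 2"
  have b: "2 \<le> b" "a + 1 \<le> 4 * b" "2 * b \<le> a" using a4 unfolding b_def by auto
  define \<beta> where "\<beta> = min b (e + 1)"
  define L where "L = e div \<beta> + 1"
  have \<beta>1: "1 \<le> \<beta>" "\<beta> \<le> b" using b by (auto simp: \<beta>_def)
  have "\<beta> + 1 \<le> 2 ^ \<beta>" using less_exp[of \<beta>] by (simp add: Suc_le_eq)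
  then have "2 ^ \<beta> * (\<beta> + 1) \<le> 2 ^ \<beta> * 2 ^ \<beta>" by (rule mult_le_mono2)
  also have "\<dots> = 2 ^ (2 * \<beta>)" by (simp add: mult_2 power_add)
  also have "\<dots> \<le> 2 ^ a" using \<beta>1(2) b(3) by (intro power_increasing) auto
  finally have bw: "2 ^ \<beta> * (\<beta> + 1) \<le> w" using a(1) by linarith
  have "e = \<beta> * (e div \<beta>) + e mod \<beta>" by simp
  moreover have "e mod \<beta> < \<beta>" using \<beta>1 by simp
  ultimately have eL: "e \<le> \<beta> * L" unfolding L_def distrib_left by linarith
  have Le: "L \<le> e + 1" unfolding L_def by simp
  interpret trie_data N NB e bk key w f R L \<beta>
  proof (intro trie_data.intro k trie_data_axioms.intro)
    show "1 \<le> L" by (simp add: L_def)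
  qed (use R keys \<beta>1 bw eL in auto)
  obtain tp W where tp: "\<And>j. tp j \<le> R" "\<And>j. tp j \<noteq> 0 \<Longrightarrow> j \<in> X0" "\<And>c i. W c i < 2 ^ w"
    "\<And>c i. R div f \<le> i \<Longrightarrow> W c i = 0"
    "\<And>j. j \<in> X0 \<Longrightarrow> tp j \<noteq> 0 \<and> tp j - 1 + L \<le> R \<and> trie_ok w W L \<beta> (tp j - 1) (Smp j) (lo j) (hi j)"
    using tables_exist by blast
  obtain T where T: "64 * L + 1 \<le> 2 ^ T" "2 ^ T \<le> 2 * (64 * L + 1)" using pow2_between[of "64 * L + 1"] by auto
  have "64 * L * f < (64 * L + 1) * f" using R(3) by simp
  also have "\<dots> \<le> 2 ^ T * f" using T(1) by (rule mult_le_mono1)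
  finally have g: "g < 2 ^ T * f" by (simp add: g_def)
  have Lb: "2 * L * (\<beta> + 1) < 2 ^ w"
  proof -
    have "L * \<beta> \<le> 2 * e + 1"
    proof -
      have "L * \<beta> = e div \<beta> * \<beta> + \<beta>" by (simp add: L_def)
      moreover have "e div \<beta> * \<beta> \<le> e" by simp
      moreover have "\<beta> \<le> e + 1" by (simp add: \<beta>_def)
      ultimately show ?thesis by linarith
    qed
    then have "2 * L * (\<beta> + 1) \<le> 6 * w + 4" using Le ew by (simp add: algebra_simps)
    moreover note pow2_gt[OF w16]
    ultimately show ?thesis by linarith
  qed
  have "pred_tables N NB e w bk key L \<beta> T tp W f g" unfolding pred_tables_def
  proof (intro allI impI conjI)
    fix j assume j: "j < NB" and "tp j = 0"
    then have "j \<notin> X0" using tp(5)[of j] by auto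
    then show "st (j + 1) - st j \<le> g" using j by (simp add: X0_def)
  next
    fix j assume "j < NB" "tp j \<noteq> 0"
    then have j: "j \<in> X0" by (intro tp(2))
    show "tp j - 1 + L < 2 ^ w" using tp(5)[OF j] R(2) by linarith
    show "L \<le> 2 ^ T" using T(1) by linarith
    fix x assume "\<forall>u<N. bk u = j \<longrightarrow> key u div 2 ^ e = x div 2 ^ e"
    then show "\<exists>Smp lo hi. trie_ok w W L \<beta> (tp j - 1) Smp lo hi \<and> x div 2 ^ (\<beta> * L) \<in> trie_prefixes L \<beta> Smp 0 \<and>
              st j \<le> lo (card {y \<in> Smp. y < x}) \<and> lo (card {y \<in> Smp. y < x}) \<le> ans j x \<and>
              ans j x \<le> hi (card {y \<in> Smp. y < x}) \<and> hi (card {y \<in> Smp. y < x}) \<le> st (j + 1) \<and>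
              hi (card {y \<in> Smp. y < x}) - lo (card {y \<in> Smp. y < x}) \<le> g"
      using tp(5)[OF j] sample_interval[OF j] prefix_0[OF j, of x]
      by (intro exI[of _ "Smp j"] exI[of _ "lo j"] exI[of _ "hi j"]) auto
  qed (use L1 \<beta>1 bw Lb in auto)
  moreover have "real L \<le> 4 * real e / log 2 (real w) + 1"
  proof (cases "e + 1 \<le> b")
    case True
    then have "L = 1" by (simp add: L_def \<beta>_def)
    moreover have "0 \<le> log 2 (real w)" using w16 by simp
    ultimately show ?thesis by simp
  next
    case False
    then have "\<beta> = b" by (simp add: \<beta>_def)
    then have "real L = real (e div b) + 1" by (simp add: L_def)
    also have "real (e div b) \<le> real e / real b" by (rule of_nat_div_le_of_nat)
    also have "real e / real b = 4 * real e / (4 * real b)" by simp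
    also have "\<dots> \<le> 4 * real e / log 2 (real w)"
    proof (rule divide_left_mono)
      have "w \<le> 2 ^ (a + 1)" using a(2) by (rule less_imp_le)
      then have "real w \<le> real (2 ^ (a + 1))" by (rule of_nat_mono)
      also have "\<dots> = 2 ^ (a + 1)" by (rule of_nat_power[where n = "a + 1", of 2, unfolded of_nat_numeral])
      also have "\<dots> = 2 powr real (a + 1)" by (rule powr_realpow[symmetric]) simp
      finally have "log 2 (real w) \<le> real (a + 1)" using w16 by (simp add: log_le_iff)
      then show "log 2 (real w) \<le> 4 * real b" using b(2) by linarith
      have "0 < log 2 (real w)" using w16 by simp
      then show "0 < 4 * real b * log 2 (real w)" using b by (intro mult_pos_pos) auto
    qed simp
    finally show ?thesis by simp
  qed
  moreover have "\<forall>j\<ge>NB. tp j = 0" using tp(2) by (force simp: X0_def)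
  moreover have "\<beta> \<le> e + 1" by (simp add: \<beta>_def)
  ultimately show ?thesis using False w16 Le tp T g
    by (intro exI[of _ L] exI[of _ \<beta>] exI[of _ T] exI[of _ tp] exI[of _ W] exI[of _ g]) auto
qed

context layout
begin

definition pred_ok :: "nat \<Rightarrow> nat \<Rightarrow> nat \<Rightarrow> nat \<Rightarrow> nat \<Rightarrow> (nat \<Rightarrow> nat) \<Rightarrow> (nat \<Rightarrow> nat) \<Rightarrow> nat \<Rightarrow> bool" where
  "pred_ok pb wb N NB e bk key T \<longleftrightarrow> keyed N NB e bk key \<and> (\<forall>u<N. A pb u = key u) \<and>
     (\<forall>j\<le>NB. A (pb + 1) j = keyed.st N bk j) \<and> A (pb + 5) 0 = e \<and> NB < 2 ^ w \<and>
     (\<exists>g. g < 2 ^ T * f \<and> pred_tables N NB e w bk key (A (pb + 3) 0) (A (pb + 4) 0) T (A (pb + 2)) (Wx wb) f g)"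

lemma wp_pred_search_ok:
  assumes ok: "pred_ok pb wb N NB e bk key T" and h: "hdr s" "pb + 5 < 17" "wb + 10 < 22"
    and j: "s 14 = j" "s 15 = x" "j < NB" "x < 2 ^ q"
    and x: "\<And>u. u < N \<Longrightarrow> bk u = j \<Longrightarrow> key u div 2 ^ e = x div 2 ^ e"
  shows "wpl (pred_search pb wb) s (\<lambda>t s'. t \<le> 2 * T \<and> frame 16 s s' \<and> s' 16 = keyed.ans N bk key j x)"
proof -
  interpret keyed N NB e bk key using ok by (simp add: pred_ok_def)
  have st: "A (pb + 1) j = st j" "A (pb + 1) (j + 1) = st (j + 1)" using ok j(3) by (auto simp: pred_ok_def)
  have key: "u < N \<Longrightarrow> A pb u = key u" for u using ok by (simp add: pred_ok_def)
  obtain g where g: "g < 2 ^ T * f"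
    "pred_tables N NB e w bk key (A (pb + 3) 0) (A (pb + 4) 0) T (A (pb + 2)) (Wx wb) f g"
    using ok unfolding pred_ok_def by blast
  note pt = g(2)[unfolded pred_tables_def, rule_format, OF j(3)]
  show ?thesis
  proof (rule wp_pred_search[OF h j(1,2) _ j(4) _ _ _ g(1)])
    show "j + 1 < 2 ^ w" using ok j(3) by (simp add: pred_ok_def)
    show "A (pb + 1) j \<le> ans j x" "ans j x \<le> A (pb + 1) (j + 1)" unfolding st by (rule st_le_ans)+
    show "A pb i < x \<longleftrightarrow> i < ans j x" if "A (pb + 1) j \<le> i" "i < A (pb + 1) (j + 1)" for i
      using key_ans[of j i x] that in_bucket[of j i] key[of i] unfolding st by simp
    show "A (pb + 1) (j + 1) - A (pb + 1) j \<le> g" if "A (pb + 2) j = 0" unfolding st using pt that by blast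
    assume tp: "A (pb + 2) j \<noteq> 0"
    note p2 = conjunct2[OF pt, rule_format, OF tp]
    have "\<forall>u<N. bk u = j \<longrightarrow> key u div 2 ^ e = x div 2 ^ e" using x by blast
    with p2 show "\<exists>Smp lo hi L \<beta>. L = A (pb + 3) 0 \<and> \<beta> = A (pb + 4) 0 \<and>
      trie_ok w (Wx wb) L \<beta> (A (pb + 2) j - 1) Smp lo hi \<and> 1 \<le> L \<and> 1 \<le> \<beta> \<and>
      2 * L * (\<beta> + 1) < 2 ^ w \<and> A (pb + 2) j - 1 + L < 2 ^ w \<and> L \<le> 2 ^ T \<and> 2 ^ \<beta> * (\<beta> + 1) \<le> w \<and>
      x div 2 ^ (\<beta> * L) \<in> trie_prefixes L \<beta> Smp 0 \<and>
      A (pb + 1) j \<le> lo (card {y \<in> Smp. y < x}) \<and> lo (card {y \<in> Smp. y < x}) \<le> ans j x \<and>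
      ans j x \<le> hi (card {y \<in> Smp. y < x}) \<and> hi (card {y \<in> Smp. y < x}) \<le> A (pb + 1) (j + 1) \<and>
      hi (card {y \<in> Smp. y < x}) - lo (card {y \<in> Smp. y < x}) \<le> g" unfolding st by simp
  qed
qed

end

section \<open>The counting program\<close>

text \<open>
  The width \<open>q\<close> of a packed field is a power of two stored in the first field, hence the lowest 1-bit of the first word;
  an odd first word signals unpacked memory.
\<close>

definition init_prog :: cmd where
  "init_prog =
     Asg 7 (Ld 39 (Cn 0) 0) ;;
     Asg 7 (Bin And (V 7) (Bin Sub (Cn 0) (V 7))) ;;
     Asg 3 (Bin Less (Cn 1) (V 7)) ;;
     Asg 4 (Bin Sub (Cn 1) (V 3)) ;;
     Asg 2 (Bin Mul (V 3) (V 7)) ;;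
     Asg 5 (Bin Sub (Bin Shl (Cn 1) (Bin Add (V 2) (Bin Mul (V 4) (V 0)))) (Cn 1)) ;;
     Asg 6 (rd 1 (Cn 0)) ;;
     Asg 8 (Cn 0) ;;
     Asg 9 (rd 2 (Cn 0)) ;;
     Asg 10 (V 1)"

definition step_prog :: "nat \<Rightarrow> cmd" where
  "step_prog v =
     Asg 14 (Bin Add (V 13) (Bin Shr (V v) (rd 16 (Cn 0)))) ;;
     Asg 15 (V v) ;;
     pred_search 11 11 ;;
     Ite (Bin Less (rd 12 (V 13)) (V 16))
       (Asg 17 (Bin Sub (rd 4 (V 16)) (rd 4 (Bin Sub (V 16) (Cn 1)))) ;;
        Asg 18 (Bin Sub (V 15) (rd 11 (Bin Sub (V 16) (Cn 1)))) ;;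
        Ite (Bin Less (V 17) (V 18)) (Asg 18 (V 17)) skip ;;
        Asg v (Bin Add (rd 4 (Bin Sub (V 16) (Cn 1))) (V 18)))
       (Asg v (rd 4 (rd 12 (V 13))))"

definition reset_prog :: cmd where "reset_prog = Asg 8 (Cn 0) ;; Asg 9 (Cn 0)"

definition body_prog :: cmd where
  "body_prog =
     Asg 10 (Bin Sub (V 10) (Cn 1)) ;;
     Asg 11 (In (V 10)) ;;
     Asg 14 (Bin Shr (V 11) (rd 10 (Cn 0))) ;;
     Asg 15 (V 11) ;;
     pred_search 5 0 ;;
     Asg 12 (V 16) ;;
     Ite (eqE (rd 5 (V 12)) (V 11))
       (Ite (Bin Or (Bin Less (Cn 0) (V 12)) (eqE (Bin Add (V 10) (Cn 1)) (V 1)))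
         (Asg 13 (Bin Mul (V 12) (rd 3 (Cn 0))) ;; step_prog 8 ;; step_prog 9)
         reset_prog)
       reset_prog"

definition count_prog :: cmd where
  "count_prog = init_prog ;; Wh (V 10) body_prog ;; Asg 0 (Bin Sub (V 9) (V 8))"

lemma and_complement: "u < 2 ^ k \<Longrightarrow> u AND (2 ^ k - 1 - u) = (0::nat)"
proof (induction k arbitrary: u)
  case (Suc k)
  have h: "u div 2 < 2 ^ k" using Suc.prems by simp
  have gen: "b < 2 \<Longrightarrow> a < K \<Longrightarrow> 2 * K - 1 - (2 * a + b) = (1 - b) + 2 * (K - 1 - a)" for a b K :: nat
    by linarith
  have "2 ^ Suc k - 1 - u = (1 - u mod 2) + 2 ^ 1 * (2 ^ k - 1 - u div 2)"
    using gen[of "u mod 2" "u div 2" "2 ^ k"] h by simp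
  then have "u AND (2 ^ Suc k - 1 - u) = (u AND (1 - u mod 2)) + 2 ^ 1 * ((u div 2 ^ 1) AND (2 ^ k - 1 - u div 2))"
    using and_split[of "1 - u mod 2" 1 u "2 ^ k - 1 - u div 2"] by simp
  also have "u AND (1 - u mod 2) = 0"
    using and_low_mask[of u 1] by (cases "u mod 2 = 0") auto
  finally show ?case using Suc.IH[OF h] by simp
qed simp

lemma lowest_bit:
  assumes "v = 2 ^ g * (2 * u + 1)" "v < (2::nat) ^ w"
  shows "v AND (2 ^ w - v) = 2 ^ g"
proof -
  have "(2::nat) ^ g * 1 \<le> 2 ^ g * (2 * u + 1)" by (rule mult_le_mono2) simp
  then have "(2::nat) ^ g < 2 ^ w" using assms by linarith
  then have gw: "g < w" by simp
  define k where "k = w - g - 1"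
  have w: "(2::nat) ^ w = 2 ^ g * (2 * 2 ^ k)"
    using gw by (simp add: k_def flip: power_add power_Suc)
  then have "2 ^ g * (2 * u + 1) < 2 ^ g * (2 * 2 ^ k)" using assms by simp
  then have "2 * u + 1 < 2 * 2 ^ k" unfolding nat_mult_less_cancel_disj by simp
  then have u: "u < 2 ^ k" by linarith
  have "2 ^ w - v = 2 ^ g * (2 * 2 ^ k - (2 * u + 1))" unfolding w assms(1) by (simp only: diff_mult_distrib2)
  also have "2 * 2 ^ k - (2 * u + 1) = 1 + 2 ^ 1 * (2 ^ k - 1 - u)" using u by simp
  finally have "v AND (2 ^ w - v) = v AND (0 + 2 ^ g * (1 + 2 ^ 1 * (2 ^ k - 1 - u)))" by simp
  also have "\<dots> = (v AND 0) + 2 ^ g * ((v div 2 ^ g) AND (1 + 2 ^ 1 * (2 ^ k - 1 - u)))"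
    by (rule and_split) simp
  also have "v div 2 ^ g = 2 * u + 1" using assms(1) by simp
  also have "(2 * u + 1) AND (1 + 2 ^ 1 * (2 ^ k - 1 - u)) =
      ((2 * u + 1) AND 1) + 2 ^ 1 * (((2 * u + 1) div 2 ^ 1) AND (2 ^ k - 1 - u))"
    by (rule and_split) simp
  also have "(2 * u + 1) AND 1 = 1" using and_low_mask[of "2 * u + 1" 1] by simp
  also have "(2 * u + 1) div 2 ^ 1 = u" by simp
  finally show ?thesis using and_complement[OF u] by simp
qed

text \<open>
  Arrays 0 to 4 are the width, \<open>f\<close>, \<open>n\<close>, the number \<open>nb\<close> of blocks per symbol and the run heads; the predecessor
  structures for the symbols and for the run heads start at 5 and 11.
\<close>

locale csa = layout w P M pk q f A Wt + csa_text \<sigma> T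
  for w P M pk q f A Wt \<sigma> T +
  fixes e1 e2 nb TT :: nat
  assumes sn: "\<sigma> < 2 ^ q" "n < 2 ^ q"
    and A0: "pk \<Longrightarrow> \<exists>g. q = 2 ^ g \<and> g < q \<and> 1 \<le> g" "pk \<Longrightarrow> A 0 0 = q" "\<not> pk \<Longrightarrow> A 0 0 = 1"
    and hdrs: "A 1 0 = f" "A 2 0 = n" "A 3 0 = nb"
    and A4: "u \<le> r \<Longrightarrow> A 4 u = pos u"
    and A5: "A 5 u = (if u < d then ds ! u else 0)"
    and nb: "nb = n div 2 ^ e2 + 1" "d * nb \<le> r"
    and ok1: "pred_ok 5 0 d (\<sigma> div 2 ^ e1 + 1) e1 (\<lambda>t. ds ! t div 2 ^ e1) (\<lambda>t. ds ! t) TT"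
    and ok2: "pred_ok 11 11 r (d * nb) e2 (\<lambda>u. sid (su u) * nb + vu u div 2 ^ e2) vu TT"
    and P: "set P \<subseteq> {1..\<sigma>}" "length P < 2 ^ w" "P \<noteq> []"
begin

lemma lsb_M0: "M 0 AND (2 ^ w - M 0) = (if pk then q else 1)" "M 0 \<noteq> 0"
proof -
  have "\<exists>g u. M 0 = 2 ^ g * (2 * u + 1) \<and> 2 ^ g = (if pk then q else 1)"
  proof (cases pk)
    case True
    obtain g where g: "q = 2 ^ g" "g < q" using A0(1)[OF True] by blast
    have "M 0 = (\<Sum>j<17 * f. A (j mod 17) (j div 17) * (2 ^ q) ^ j)" using packed_A[OF True, of 0] by simp
    also have "17 * f = Suc (17 * f - 1)" using f1 by simp
    also have "(\<Sum>j<Suc (17 * f - 1). A (j mod 17) (j div 17) * (2 ^ q) ^ j) =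
      A 0 0 + 2 ^ q * (\<Sum>j<17 * f - 1. A (Suc j mod 17) (Suc j div 17) * (2 ^ q) ^ j)"
      by (simp only: sum.lessThan_Suc_shift) (simp add: sum_distrib_left mult.left_commute)
    finally obtain X where X: "M 0 = q + 2 ^ q * X" using A0(2)[OF True] by blast
    have "(2::nat) ^ q = 2 ^ g * (2 * 2 ^ (q - g - 1))"
    proof -
      have "q = g + Suc (q - g - 1)" using g(2) by simp
      then show ?thesis by (metis power_add power_Suc)
    qed
    then have "M 0 = 2 ^ g * (2 * (2 ^ (q - g - 1) * X) + 1)" using X g(1) by (simp add: algebra_simps)
    then show ?thesis using True g(1) by auto
  next
    case False
    then have "M 0 = 2 ^ 0 * (2 * 0 + 1)" using unpacked_A[OF False, of 0 0] A0(3) by simp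
    then show ?thesis using False by (metis power_0)
  qed
  then obtain g u where gu: "M 0 = 2 ^ g * (2 * u + 1)" "2 ^ g = (if pk then q else 1)" by blast
  show "M 0 AND (2 ^ w - M 0) = (if pk then q else 1)" using lowest_bit[OF gu(1) M_less] gu(2) by simp
  show "M 0 \<noteq> 0" using gu(1) by simp
qed

lemma wp_init:
  assumes "s 0 = w" "s 1 = length P"
  shows "wpl init_prog s (\<lambda>t s'. t = 0 \<and> hdr s' \<and> s' 1 = length P \<and> s' 8 = 0 \<and> s' 9 = n \<and> s' 10 = length P)"
proof -
  define b where "b = (if pk then q else 1)"
  have q2: "pk \<Longrightarrow> 2 \<le> q"
  proof -
    assume pk
    then obtain g where "q = 2 ^ g" "1 \<le> g" using A0(1) by blast
    then show "2 \<le> q" using power_increasing[of 1 g "2::nat"] by simp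
  qed
  have qw: "pk \<Longrightarrow> q < w" using eval_stride(2) q1 by fastforce
  have e1: "eval s (Ld 39 (Cn 0) 0) = M 0" by simp
  have e2: "eval (s(7 := M 0)) (Bin And (V 7) (Bin Sub (Cn 0) (V 7))) = b"
  proof -
    have "(2 ^ w - M 0) mod 2 ^ w = 2 ^ w - M 0" using lsb_M0(2) by (intro mod_less) simp
    then show ?thesis using lsb_M0(1) by (simp add: b_def)
  qed
  have e3: "eval (s(7 := M 0, 7 := b)) (Bin Less (Cn 1) (V 7)) = of_bool pk"
    using q2 by (auto simp: b_def)
  let ?s3 = "s(7 := M 0, 7 := b, 3 := of_bool pk)"
  have e4: "eval ?s3 (Bin Sub (Cn 1) (V 3)) = of_bool (\<not> pk)"
  proof -
    have "apply_op w Sub 1 (of_bool pk) = 1 - of_bool pk"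
      using one_less_power[of "2::nat" w] by (intro apply_Sub) auto
    then show ?thesis by (simp del: apply_op.simps(2))
  qed
  let ?s4 = "?s3(4 := of_bool (\<not> pk))"
  have e5: "eval ?s4 (Bin Mul (V 3) (V 7)) = (if pk then q else 0)"
    using pow_q_le[OF less_exp[of q]] by (auto simp: b_def)
  let ?s5 = "?s4(2 := (if pk then q else 0))"
  have e6: "eval ?s5 (Bin Sub (Bin Shl (Cn 1) (Bin Add (V 2) (Bin Mul (V 4) (V 0)))) (Cn 1)) = 2 ^ q - 1"
  proof (cases pk)
    case True
    have "(2::nat) ^ q < 2 ^ w" using qw[OF True] by (intro power_strict_increasing) auto
    moreover have "apply_op w Sub (2 ^ q) 1 = 2 ^ q - 1" using calculation by (intro apply_Sub) auto
    moreover have "q < 2 ^ w" using qw[OF True] w_less by linarith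
    ultimately show ?thesis using True by (simp del: apply_op.simps(2))
  next
    case False
    then show ?thesis using unpacked w_less assms by simp
  qed
  let ?s6 = "?s5(5 := 2 ^ q - 1)"
  have e7: "eval ?s6 (rd 1 (Cn 0)) = f" using hdrs(1) by (subst eval_rd) auto
  let ?s7 = "?s6(6 := f)"
  have h7: "hdr ?s7" using assms by (simp add: hdr_def)
  have e8: "eval (?s7(8 := 0)) (rd 2 (Cn 0)) = n" using h7 by (subst eval_rd_hdr) (auto simp: hdrs)
  have e9: "eval ?s7 (Cn 0) = 0" by simp
  show ?thesis unfolding init_prog_def
    apply (rule wp_Sq, rule wp_Asg, unfold e1)
    apply (rule wp_Sq, rule wp_Asg, unfold e2)
    apply (rule wp_Sq, rule wp_Asg, unfold e3)
    apply (rule wp_Sq, rule wp_Asg, unfold e4)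
    apply (rule wp_Sq, rule wp_Asg, unfold e5)
    apply (rule wp_Sq, rule wp_Asg, unfold e6)
    apply (rule wp_Sq, rule wp_Asg, unfold e7)
    apply (rule wp_Sq, rule wp_Asg, unfold e9)
    apply (rule wp_Sq, rule wp_Asg, unfold e8)
    apply (rule wp_Asg)
    using h7 assms by (simp add: hdr_def)
qed

lemma rq: "r < 2 ^ q" "r < 2 ^ w" "n < 2 ^ w" "\<sigma> < 2 ^ w"
  using r1 sn pow_q_le by auto

lemma bucket2_iff:
  assumes "t < d" "x \<le> n" "u < r"
  shows "sid (su u) * nb + vu u div 2 ^ e2 < t * nb + x div 2 ^ e2 \<longleftrightarrow>
      sid (su u) < t \<or> sid (su u) = t \<and> vu u div 2 ^ e2 < x div 2 ^ e2"
    "sid (su u) * nb + vu u div 2 ^ e2 = t * nb + x div 2 ^ e2 \<longleftrightarrow>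
      sid (su u) = t \<and> vu u div 2 ^ e2 = x div 2 ^ e2"
proof -
  have a: "vu u div 2 ^ e2 < nb" unfolding nb(1) using vu_less[OF assms(3)] by (simp add: le_imp_less_Suc div_le_mono)
  have b: "x div 2 ^ e2 < nb" unfolding nb(1) using assms(2) by (simp add: le_imp_less_Suc div_le_mono)
  have lt: "i * nb + a' < i' * nb + b'" if "i < i'" "a' < nb" for i i' a' b'
  proof -
    have "(i + 1) * nb \<le> i' * nb" using that by (intro mult_le_mono1) simp
    then show ?thesis using that(2) by simp
  qed
  have c: "sid (su u) = t \<Longrightarrow> sid (su u) * nb = t * nb" by simp
  show "sid (su u) * nb + vu u div 2 ^ e2 < t * nb + x div 2 ^ e2 \<longleftrightarrow>
      sid (su u) < t \<or> sid (su u) = t \<and> vu u div 2 ^ e2 < x div 2 ^ e2"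
    "sid (su u) * nb + vu u div 2 ^ e2 = t * nb + x div 2 ^ e2 \<longleftrightarrow>
      sid (su u) = t \<and> vu u div 2 ^ e2 = x div 2 ^ e2"
    using lt[of "sid (su u)" t "vu u div 2 ^ e2" "x div 2 ^ e2"]
      lt[of t "sid (su u)" "x div 2 ^ e2" "vu u div 2 ^ e2"] a b c by linarith+
qed

lemma ans2_eq:
  assumes "c \<in> set T" "x \<le> n"
  shows "keyed.ans r (\<lambda>u. sid (su u) * nb + vu u div 2 ^ e2) vu (sid c * nb + x div 2 ^ e2) x = nxt_run c x"
    "keyed.st r (\<lambda>u. sid (su u) * nb + vu u div 2 ^ e2) (sid c * nb) = fst_run c"
proof -
  interpret K: keyed r "d * nb" e2 "\<lambda>u. sid (su u) * nb + vu u div 2 ^ e2" vu using ok2 by (simp add: pred_ok_def)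
  have t: "sid c < d" using ds_sid[OF assms(1)] by simp
  have "(sid (su u) * nb + vu u div 2 ^ e2 < sid c * nb + x div 2 ^ e2 \<or>
         sid (su u) * nb + vu u div 2 ^ e2 = sid c * nb + x div 2 ^ e2 \<and> vu u < x) \<longleftrightarrow>
         (su u < c \<or> su u = c \<and> vu u < x)" if u: "u < r" for u
  proof -
    note b = bucket2_iff[OF t assms(2) u]
    have s: "sid (su u) < sid c \<longleftrightarrow> su u < c" "sid (su u) = sid c \<longleftrightarrow> su u = c"
      using sid_less_iff[OF su_in[OF u] assms(1)] sid_eq_iff[OF su_in[OF u] assms(1)] by auto
    have v: "vu u div 2 ^ e2 < x div 2 ^ e2 \<or> vu u div 2 ^ e2 = x div 2 ^ e2 \<and> vu u < x \<longleftrightarrow> vu u < x"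
    proof
      assume "vu u < x"
      then have "vu u div 2 ^ e2 \<le> x div 2 ^ e2" by (intro div_le_mono) simp
      then show "vu u div 2 ^ e2 < x div 2 ^ e2 \<or> vu u div 2 ^ e2 = x div 2 ^ e2 \<and> vu u < x" using \<open>vu u < x\<close> by auto
    qed (metis div_le_mono leD leI)
    show ?thesis unfolding b s using v by blast
  qed
  then show "K.ans (sid c * nb + x div 2 ^ e2) x = nxt_run c x"
    unfolding K.ans_def nxt_run_def by (intro arg_cong[of _ _ card]) blast
  have "sid (su u) * nb + vu u div 2 ^ e2 < sid c * nb \<longleftrightarrow> su u < c" if u: "u < r" for u
    using bucket2_iff(1)[OF t, of 0 u] u sid_less_iff[OF su_in[OF u] assms(1)] by simp
  then show "K.st (sid c * nb) = fst_run c"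
    unfolding K.st_def fst_run_def by (intro arg_cong[of _ _ card]) blast
qed

lemma wp_step:
  assumes h: "hdr s" "c \<in> set T" "s 13 = sid c * nb" "s v \<le> n" "v = 8 \<or> v = 9"
  shows "wpl (step_prog v) s (\<lambda>t s'. t \<le> 2 * TT \<and> hdr s' \<and> (\<forall>i<14. i \<noteq> v \<longrightarrow> s' i = s i) \<and> s' v = F c (s v))"
proof -
  define x where "x = s v"
  have xn: "x \<le> n" using h by (simp add: x_def)
  let ?j = "sid c * nb + x div 2 ^ e2"
  have v: "v < 14" "6 < v" "v \<noteq> 13" using h by auto
  have t: "sid c < d" using ds_sid[OF h(2)] by simp
  have xb: "x div 2 ^ e2 < nb" unfolding nb(1) using xn by (simp add: le_imp_less_Suc div_le_mono)
  have j: "?j < d * nb"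
  proof -
    have "(sid c + 1) * nb \<le> d * nb" using t by (intro mult_le_mono1) simp
    then show ?thesis using xb by simp
  qed
  have jw: "?j < 2 ^ w" using j nb(2) rq(2) by linarith
  have A16: "A 16 0 = e2" using ok2 by (simp add: pred_ok_def)
  have e14: "eval s (Bin Add (V 13) (Bin Shr (V v) (rd 16 (Cn 0)))) = ?j"
    using h jw A16 by (simp add: eval_rd_hdr x_def)
  let ?s1 = "s(14 := ?j)"
  have e15: "eval ?s1 (V v) = x" using v by (simp add: x_def)
  let ?s2 = "s(14 := ?j, 15 := x)"
  let ?U = "nxt_run c x" and ?f = "fst_run c"
  have Ur: "?U \<le> r" by (rule run_counts)
  have search: "wpl (pred_search 11 11) ?s2 (\<lambda>t s'. t \<le> 2 * TT \<and> frame 16 ?s2 s' \<and> s' 16 = ?U)"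
  proof -
    have "wpl (pred_search 11 11) ?s2 (\<lambda>t s'. t \<le> 2 * TT \<and> frame 16 ?s2 s' \<and>
        s' 16 = keyed.ans r (\<lambda>u. sid (su u) * nb + vu u div 2 ^ e2) vu ?j x)"
    proof (rule wp_pred_search_ok[OF ok2])
      show "x < 2 ^ q" using xn sn by linarith
      fix u assume "u < r" "sid (su u) * nb + vu u div 2 ^ e2 = ?j"
      then show "vu u div 2 ^ e2 = x div 2 ^ e2" using bucket2_iff(2)[OF t xn] by blast
    qed (use h j in auto)
    then show ?thesis using ans2_eq(1)[OF h(2) xn] by simp
  qed
  have fr: "A 12 (sid c * nb) = ?f"
  proof -
    have "sid c * nb \<le> d * nb" using t by (intro mult_le_mono1) simp
    then show ?thesis using ok2 ans2_eq(2)[OF h(2) xn] by (simp add: pred_ok_def)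
  qed
  have fr_le: "?f \<le> r" using run_counts[of c x] by linarith
  have A11: "A 11 u = vu u" if "u < r" for u using ok2 that by (simp add: pred_ok_def)
  show ?thesis unfolding step_prog_def
    apply (rule wp_Sq, rule wp_Asg, unfold e14)
    apply (rule wp_Sq, rule wp_Asg, unfold e15)
    apply (rule wp_Sq)
  proof (rule wp_mono[OF search], goal_cases)
    case (1 t s')
    then have t: "t \<le> 2 * TT" and fm: "frame 16 ?s2 s'" and s16: "s' 16 = ?U" by auto
    have sv: "\<And>i. i < 14 \<Longrightarrow> s' i = s i" "s' 15 = x" using fm by (auto simp: frame_def)
    have h': "hdr s'" using hdr_frame[OF fm] h(1) by simp
    have s13: "s' 13 = sid c * nb" using sv h(3) by simp
    have e12: "eval s' (rd 12 (V 13)) = ?f" using h' s13 fr by (simp add: eval_rd_hdr)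
    show ?case
    proof (rule wp_Ite)
      assume "eval s' (Bin Less (rd 12 (V 13)) (V 16)) \<noteq> 0"
      then have lt: "?f < ?U" using e12 s16 by (simp split: if_splits)
      let ?v = "?U - 1"
      have vr: "?v < r" using lt Ur by linarith
      have sub1: "eval s'' (Bin Sub (V 16) (Cn 1)) = ?v" if "s'' 16 = ?U" for s''
      proof -
        have "apply_op w Sub ?U 1 = ?v" using lt Ur rq by (intro apply_Sub) auto
        then show ?thesis using that by (simp del: apply_op.simps(2))
      qed
      have rd4: "eval s'' (rd 4 (Bin Sub (V 16) (Cn 1))) = pos ?v" if "s'' 16 = ?U" "hdr s''" for s''
        using eval_rd_hdr[OF that(2), of 4 "Bin Sub (V 16) (Cn 1)"] sub1[of s'', OF that(1)] A4[of ?v] vr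
        by (simp only: less_imp_le)
      have rd4': "eval s'' (rd 4 (V 16)) = pos ?U" if "s'' 16 = ?U" "hdr s''" for s''
        using that Ur by (simp add: eval_rd_hdr A4)
      have rd11: "eval s'' (rd 11 (Bin Sub (V 16) (Cn 1))) = vu ?v" if "s'' 16 = ?U" "hdr s''" for s''
        using eval_rd_hdr[OF that(2), of 11 "Bin Sub (V 16) (Cn 1)"] sub1[of s'', OF that(1)] A11[of ?v] vr
        by (simp only:)
      have pw: "pos ?U < 2 ^ w" "pos ?v \<le> pos ?U" using pos_le_n[of ?U] rq Ur pos_mono[of ?v ?U] by auto
      have vx: "vu ?v < x"
        using nxt_run_iff[OF vr, of c x] fst_run_iff[OF vr, of c] lt by auto
      let ?len = "pos ?U - pos ?v" and ?dx = "x - vu ?v"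
      have e17: "eval s' (Bin Sub (rd 4 (V 16)) (rd 4 (Bin Sub (V 16) (Cn 1)))) = ?len"
        unfolding ev.simps(3)[of _ _ _ _ Sub "rd 4 (V 16)"] rd4[of s', OF s16 h'] rd4'[of s', OF s16 h'] using pw by (intro apply_Sub) auto
      let ?s3 = "s'(17 := ?len)"
      have e18: "eval ?s3 (Bin Sub (V 15) (rd 11 (Bin Sub (V 16) (Cn 1)))) = ?dx"
      proof -
        have "apply_op w Sub x (vu ?v) = ?dx" using vx xn rq by (intro apply_Sub) auto
        then show ?thesis unfolding ev.simps(3)[of _ _ _ _ Sub "V 15"] using rd11[of ?s3] s16 h' sv(2) by (simp del: apply_op.simps(2))
      qed
      let ?R = "pos ?v + min ?len ?dx"
      have R: "F c x = ?R" unfolding F_eq using lt by simp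
      have Rw: "?R < 2 ^ w" using pw by linarith
      have fin: "wpl (Asg v (Bin Add (rd 4 (Bin Sub (V 16) (Cn 1))) (V 18))) s''
          (\<lambda>t' s'. t' = 0 \<and> hdr s' \<and> (\<forall>i<14. i \<noteq> v \<longrightarrow> s' i = s i) \<and> s' v = F c (s v))"
        if "s'' 16 = ?U" "hdr s''" "s'' 18 = min ?len ?dx" "\<forall>i<14. s'' i = s i" for s''
      proof (rule wp_Asg)
        have "apply_op w Add (pos ?v) (min ?len ?dx) = ?R" using Rw by (rule apply_Add)
        then have "eval s'' (Bin Add (rd 4 (Bin Sub (V 16) (Cn 1))) (V 18)) = ?R"
          unfolding ev.simps(3)[of _ _ _ _ Add] rd4[of s'', OF that(1,2)] using that by simp
        then show "0 = 0 \<and> hdr (s''(v := eval s'' (Bin Add (rd 4 (Bin Sub (V 16) (Cn 1))) (V 18)))) \<and>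
          (\<forall>i<14. i \<noteq> v \<longrightarrow> (s''(v := eval s'' (Bin Add (rd 4 (Bin Sub (V 16) (Cn 1))) (V 18)))) i = s i) \<and>
          (s''(v := eval s'' (Bin Add (rd 4 (Bin Sub (V 16) (Cn 1))) (V 18)))) v = F c (s v)"
          using that v R by (simp add: x_def)
      qed
      show "wpl (Asg 17 (Bin Sub (rd 4 (V 16)) (rd 4 (Bin Sub (V 16) (Cn 1)))) ;;
        Asg 18 (Bin Sub (V 15) (rd 11 (Bin Sub (V 16) (Cn 1)))) ;;
        Ite (Bin Less (V 17) (V 18)) (Asg 18 (V 17)) skip ;;
        Asg v (Bin Add (rd 4 (Bin Sub (V 16) (Cn 1))) (V 18))) s'
        (\<lambda>t'. (\<lambda>s'. 0 + (0 + (t + t')) \<le> 2 * TT \<and> hdr s' \<and> (\<forall>i<14. i \<noteq> v \<longrightarrow> s' i = s i) \<and> s' v = F c (s v)))"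
        apply (rule wp_Sq, rule wp_Asg, unfold e17)
        apply (rule wp_Sq, rule wp_Asg, unfold e18)
        apply (rule wp_Sq, rule wp_Ite)
         apply (rule wp_Asg)
         apply (rule wp_mono[OF fin])
             apply (use s16 h' sv t in \<open>auto split: if_splits\<close>)[5]
        apply (rule wp_skip)
        apply (rule wp_mono[OF fin])
            apply (use s16 h' sv t in \<open>auto split: if_splits\<close>)[5]
        done
    next
      assume "eval s' (Bin Less (rd 12 (V 13)) (V 16)) = 0"
      then have "?U \<le> ?f" using e12 s16 by (simp split: if_splits)
      then have R: "F c x = pos ?f" unfolding F_eq by simp
      have "eval s' (rd 4 (rd 12 (V 13))) = pos ?f" using h' e12 fr_le by (simp add: eval_rd_hdr A4)
      then show "wpl (Asg v (rd 4 (rd 12 (V 13)))) s'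
        (\<lambda>t'. (\<lambda>s'. 0 + (0 + (t + t')) \<le> 2 * TT \<and> hdr s' \<and> (\<forall>i<14. i \<noteq> v \<longrightarrow> s' i = s i) \<and> s' v = F c (s v)))"
        using R h' sv t v by (intro wp_Asg) (simp add: x_def)
    qed
  qed
qed


definition inv :: "nat \<Rightarrow> nat \<Rightarrow> nat list \<Rightarrow> bool" where
  "inv l h Q \<longleftrightarrow> l = loP Q \<and> h = hiP Q \<or> l = h \<and> l \<le> n \<and> occ T Q = 0"

lemma inv_le: "inv l h Q \<Longrightarrow> l \<le> n \<and> h \<le> n"
  using hiP_le by (auto simp: inv_def)

lemma inv_occ: "inv l h Q \<Longrightarrow> h - l = occ T Q"
  using hi_lo_occ by (auto simp: inv_def)

lemma inv_step: "inv l h Q \<Longrightarrow> c \<noteq> last T \<or> Q = [] \<Longrightarrow> inv (F c l) (F c h) (c # Q)"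
  using backward_step[of c Q] occ_zero[of c Q] F_le unfolding inv_def by auto

lemma inv_reset: "c \<notin> set T \<or> c = last T \<and> Q \<noteq> [] \<Longrightarrow> inv 0 0 (c # Q)"
  using occ_zero[of c Q] unfolding inv_def by auto

definition ix :: "nat \<Rightarrow> nat" where "ix c = card {t. t < d \<and> ds ! t < c}"

lemma ix_eq: "keyed.ans d (\<lambda>t. ds ! t div 2 ^ e1) (\<lambda>t. ds ! t) (c div 2 ^ e1) c = ix c"
proof -
  interpret K: keyed d "\<sigma> div 2 ^ e1 + 1" e1 "\<lambda>t. ds ! t div 2 ^ e1" "\<lambda>t. ds ! t"
    using ok1 by (simp add: pred_ok_def)
  have "y div b < c div b \<or> y div b = c div b \<and> y < c \<longleftrightarrow> y < c" for y b
  proof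
    assume "y < c"
    then have "y div b \<le> c div b" by (intro div_le_mono) simp
    then show "y div b < c div b \<or> y div b = c div b \<and> y < c" using \<open>y < c\<close> by auto
  qed (metis div_le_mono leD leI)
  then show ?thesis unfolding K.ans_def ix_def by simp
qed

lemma ix_in: "c \<in> set T \<Longrightarrow> ix c = sid c"
proof -
  assume c: "c \<in> set T"
  note s = ds_sid[OF c]
  have "{t. t < d \<and> ds ! t < c} = {..<sid c}"
    using s ds_less_iff[of _ "sid c"] by auto
  then show ?thesis by (simp add: ix_def)
qed

lemma A5_ix: "1 \<le> c \<Longrightarrow> A 5 (ix c) = c \<longleftrightarrow> c \<in> set T"
  using A5[of "ix c"] ds_in[of "ix c"] ix_in[of c] ds_sid[of c] by (auto split: if_splits)

lemma wp_reset: "(\<And>s'. s' = s(8 := 0, 9 := 0) \<Longrightarrow> Q 0 s') \<Longrightarrow> wpl reset_prog s Q"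
  unfolding reset_prog_def by (intro wp_Sq wp_Asg) simp

lemma wp_body:
  assumes h: "hdr s" "s 1 = length P" "s 10 = Suc k" "Suc k \<le> length P" "inv (s 8) (s 9) (drop (Suc k) P)"
  shows "wpl body_prog s (\<lambda>t s'. t \<le> 6 * TT \<and> hdr s' \<and> s' 1 = length P \<and> s' 10 = k \<and> inv (s' 8) (s' 9) (drop k P))"
proof -
  let ?c = "P ! k" and ?Q = "drop (Suc k) P"
  have dr: "drop k P = ?c # ?Q" using h(4) by (simp add: Cons_nth_drop_Suc)
  have "?c \<in> set P" using h(4) by simp
  then have c: "1 \<le> ?c" "?c \<le> \<sigma>" using P(1) by auto
  have cq: "?c < 2 ^ q" using c sn by linarith
  have kw: "Suc k < 2 ^ w" using h(4) P(2) by linarith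
  have e10: "eval s (Bin Sub (V 10) (Cn 1)) = k"
  proof -
    have "apply_op w Sub (Suc k) 1 = Suc k - 1" using kw by (intro apply_Sub) auto
    then show ?thesis using h(3) by (simp del: apply_op.simps(2))
  qed
  have e11: "eval (s(10 := k)) (In (V 10)) = ?c" using h(4) by simp
  let ?s2 = "s(10 := k, 11 := ?c)"
  let ?j = "?c div 2 ^ e1"
  have A10: "A 10 0 = e1" using ok1 by (simp add: pred_ok_def)
  have e14: "eval ?s2 (Bin Shr (V 11) (rd 10 (Cn 0))) = ?j"
    using h(1) A10 by (simp add: eval_rd_hdr)
  have e15: "eval (?s2(14 := ?j)) (V 11) = ?c" by simp
  let ?s3 = "?s2(14 := ?j, 15 := ?c)"
  have search: "wpl (pred_search 5 0) ?s3 (\<lambda>t s'. t \<le> 2 * TT \<and> frame 16 ?s3 s' \<and> s' 16 = ix ?c)"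
  proof -
    have "wpl (pred_search 5 0) ?s3 (\<lambda>t s'. t \<le> 2 * TT \<and> frame 16 ?s3 s' \<and>
      s' 16 = keyed.ans d (\<lambda>t. ds ! t div 2 ^ e1) (\<lambda>t. ds ! t) ?j ?c)"
      by (rule wp_pred_search_ok[OF ok1]) (use h cq c in \<open>auto simp: div_le_mono le_imp_less_Suc\<close>)
    then show ?thesis by (simp only: ix_eq)
  qed
  show ?thesis unfolding body_prog_def
    apply (rule wp_Sq, rule wp_Asg, unfold e10)
    apply (rule wp_Sq, rule wp_Asg, unfold e11)
    apply (rule wp_Sq, rule wp_Asg, unfold e14)
    apply (rule wp_Sq, rule wp_Asg, unfold e15)
    apply (rule wp_Sq)
  proof (rule wp_mono[OF search], goal_cases)
    case (1 t s')
    then have t: "t \<le> 2 * TT" and fm: "frame 16 ?s3 s'" and s16: "s' 16 = ix ?c" by auto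
    define s4 where "s4 = s'(12 := ix ?c)"
    have h4: "hdr s4" using hdr_frame[OF fm] h(1) by (simp add: s4_def)
    have sv: "s4 1 = length P" "s4 8 = s 8" "s4 9 = s 9" "s4 10 = k" "s4 11 = ?c" "s4 12 = ix ?c"
      using fm h by (auto simp: frame_def s4_def)
    have e12: "eval s' (V 16) = ix ?c" using s16 by simp
    have g1: "eval s4 (eqE (rd 5 (V 12)) (V 11)) \<noteq> 0 \<longleftrightarrow> ?c \<in> set T"
      unfolding eval_eqE using h4 sv A5_ix[OF c(1)] by (simp add: eval_rd_hdr)
    have g2: "eval s4 (Bin Or (Bin Less (Cn 0) (V 12)) (eqE (Bin Add (V 10) (Cn 1)) (V 1))) \<noteq> 0 \<longleftrightarrow> ?c \<noteq> last T \<or> ?Q = []"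
      if cT: "?c \<in> set T"
    proof -
      have "eval s4 (Bin Add (V 10) (Cn 1)) = Suc k" using sv kw by simp
      then have "eval s4 (eqE (Bin Add (V 10) (Cn 1)) (V 1)) \<noteq> 0 \<longleftrightarrow> Suc k = length P"
        unfolding eval_eqE using sv by simp
      moreover have "eval s4 (Bin Less (Cn 0) (V 12)) \<noteq> 0 \<longleftrightarrow> ?c \<noteq> last T"
        using sv ix_in[OF cT] sid_last[OF cT] by (auto split: if_splits)
      moreover have "Suc k = length P \<longleftrightarrow> ?Q = []" using h(4) by auto
      moreover have "eval s4 (Bin Or a b) \<noteq> 0 \<longleftrightarrow> eval s4 a \<noteq> 0 \<or> eval s4 b \<noteq> 0" for a b
        by (simp add: or_eq_0_iff)
      ultimately show ?thesis by blast
    qed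
    have reset: "wpl reset_prog s4 (\<lambda>t' s'. t' = 0 \<and> hdr s' \<and> s' 1 = length P \<and> s' 10 = k \<and> inv (s' 8) (s' 9) (drop k P))"
      if "?c \<notin> set T \<or> ?c = last T \<and> ?Q \<noteq> []"
      by (rule wp_reset) (use h4 sv inv_reset[OF that] dr in auto)
    have steps: "wpl (Asg 13 (Bin Mul (V 12) (rd 3 (Cn 0))) ;; step_prog 8 ;; step_prog 9) s4
        (\<lambda>t' s'. t' \<le> 4 * TT \<and> hdr s' \<and> s' 1 = length P \<and> s' 10 = k \<and> inv (s' 8) (s' 9) (drop k P))"
      if cT: "?c \<in> set T" and cl: "?c \<noteq> last T \<or> ?Q = []"
    proof -
      have "sid ?c < d" using ds_sid[OF cT] by simp
      then have "sid ?c * nb \<le> d * nb" by (intro mult_le_mono1) simp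
      then have "sid ?c * nb < 2 ^ w" using nb(2) rq(2) by linarith
      then have e13: "eval s4 (Bin Mul (V 12) (rd 3 (Cn 0))) = sid ?c * nb"
        using h4 sv ix_in[OF cT] hdrs(3) by (simp add: eval_rd_hdr)
      let ?s5 = "s4(13 := sid ?c * nb)"
      note il = inv_le[OF h(5)]
      have w8: "wpl (step_prog 8) ?s5 (\<lambda>t s'. t \<le> 2 * TT \<and> hdr s' \<and> (\<forall>i<14. i \<noteq> 8 \<longrightarrow> s' i = ?s5 i) \<and> s' 8 = F ?c (?s5 8))"
        by (rule wp_step) (use h4 cT il sv in auto)
      show ?thesis
        apply (rule wp_Sq, rule wp_Asg, unfold e13)
        apply (rule wp_Sq)
      proof (rule wp_mono[OF w8], goal_cases)
        case (1 t6 s6)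
        then have s6: "t6 \<le> 2 * TT" "hdr s6" "\<And>i. i < 14 \<Longrightarrow> i \<noteq> 8 \<Longrightarrow> s6 i = ?s5 i" "s6 8 = F ?c (s 8)"
          using sv by auto
        have w9: "wpl (step_prog 9) s6 (\<lambda>t s'. t \<le> 2 * TT \<and> hdr s' \<and> (\<forall>i<14. i \<noteq> 9 \<longrightarrow> s' i = s6 i) \<and> s' 9 = F ?c (s6 9))"
          by (rule wp_step) (use s6 cT il sv in auto)
        show ?case
        proof (rule wp_mono[OF w9], goal_cases)
          case (1 t7 s7)
          then have s7: "t7 \<le> 2 * TT" "hdr s7" "s7 1 = s6 1" "s7 10 = s6 10" "s7 8 = s6 8" "s7 9 = F ?c (s6 9)"
            by auto
          have "inv (s7 8) (s7 9) (drop k P)"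
            unfolding dr using inv_step[OF h(5) cl] s7 s6 sv by simp
          then show ?case using s6 s7 sv by simp
        qed
      qed
    qed
    show ?case
      apply (rule wp_Sq, rule wp_Asg, unfold e12, fold s4_def)
      apply (rule wp_Ite)
       apply (drule g1[THEN iffD1])
       apply (rule wp_Ite)
      subgoal premises p
        by (rule wp_mono[OF steps[OF p(1) g2[OF p(1), THEN iffD1, OF p(2)]]]) (use t in auto)
      subgoal premises p
      proof -
        have "?c = last T \<and> ?Q \<noteq> []" using g2[OF p(1)] p(2) by blast
        then show ?thesis by (intro wp_mono[OF reset]) (use t in auto)
      qed
      subgoal premises p
      proof -
        have "?c \<notin> set T" using g1 p by blast
        then show ?thesis by (intro wp_mono[OF reset]) (use t in auto)
      qed
      done
  qed
qed

lemma wp_count: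
  assumes "s 0 = w" "s 1 = length P"
  shows "wpl count_prog s (\<lambda>t s'. t \<le> length P * (6 * TT + 1) \<and> s' 0 = occ T P)"
proof -
  define I where "I k s' \<longleftrightarrow> k \<le> length P \<and> hdr s' \<and> s' 1 = length P \<and> s' 10 = k \<and> inv (s' 8) (s' 9) (drop k P)" for k s'
  have loop: "wpl (Wh (V 10) body_prog) s1 (\<lambda>t s'. t \<le> length P * (6 * TT + 1) \<and> hdr s' \<and> inv (s' 8) (s' 9) P)"
    if "I (length P) s1" for s1
  proof (rule wp_Wh[where I = I and k = "length P" and B = "6 * TT"])
    show "I (length P) s1" by (rule that)
    fix k s' assume I: "I k s'" "eval s' (V 10) \<noteq> 0"
    then obtain k' where k: "k = Suc k'" by (cases k) (auto simp: I_def)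
    show "k > 0 \<and> wpl body_prog s' (\<lambda>t s'. t \<le> 6 * TT \<and> I (k - 1) s')"
      using wp_mono[OF wp_body[of s' k'], of "\<lambda>t s'. t \<le> 6 * TT \<and> I (k - 1) s'"] I k by (auto simp: I_def)
  next
    fix t k s' assume "I k s'" "eval s' (V 10) = 0" "t \<le> length P * (6 * TT + 1)"
    then show "t \<le> length P * (6 * TT + 1) \<and> hdr s' \<and> inv (s' 8) (s' 9) P" by (auto simp: I_def)
  qed simp
  have init: "inv 0 n []" using loP_Nil hiP_Nil by (simp add: inv_def)
  show ?thesis unfolding count_prog_def
    apply (rule wp_Sq)
  proof (rule wp_mono[OF wp_init[OF assms]], goal_cases)
    case (1 t s1)
    then have I: "I (length P) s1" and t0: "t = 0" using init by (auto simp: I_def)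
    show ?case
      apply (rule wp_Sq)
    proof (rule wp_mono[OF loop[OF I]], goal_cases)
      case (1 t2 s2)
      then have s2: "hdr s2" "inv (s2 8) (s2 9) P" "t2 \<le> length P * (6 * TT + 1)" by auto
      have "eval s2 (Bin Sub (V 9) (V 8)) = occ T P"
      proof -
        have "loP P \<le> hiP P" unfolding loP_def hiP_def by (intro card_mono) auto
        then have "s2 8 \<le> s2 9" using s2(2) by (auto simp: inv_def)
        moreover have "s2 9 < 2 ^ w" using inv_le[OF s2(2)] rq by linarith
        ultimately have "apply_op w Sub (s2 9) (s2 8) = s2 9 - s2 8" by (rule apply_Sub)
        then show ?thesis using inv_occ[OF s2(2)] by (simp del: apply_op.simps(2))
      qed
      then show ?case using s2(3) t0 by (intro wp_Asg) simp
    qed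
  qed
qed

end

section \<open>The r-CSA\<close>

lemma block_exponent:
  assumes "1 \<le> y" "1 \<le> X"
  shows "\<exists>e. X div 2 ^ e + 1 \<le> y \<and> (e = 0 \<or> 2 ^ e * y \<le> 2 * (X::nat))"
proof -
  have "X div 2 ^ X + 1 \<le> y" using assms less_exp[of X] by simp
  then have ex: "\<exists>e. X div 2 ^ e + 1 \<le> y" by blast
  define e where "e = (LEAST e. X div 2 ^ e + 1 \<le> y)"
  have e: "X div 2 ^ e + 1 \<le> y" unfolding e_def by (rule LeastI_ex[OF ex])
  have "2 ^ e * y \<le> 2 * X" if "e \<noteq> 0"
  proof -
    have "e - 1 < e" using that by simp
    then have "\<not> X div 2 ^ (e - 1) + 1 \<le> y" unfolding e_def by (rule not_less_Least)
    then have "y \<le> X div 2 ^ (e - 1)" by simp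
    then have "2 ^ (e - 1) * y \<le> 2 ^ (e - 1) * (X div 2 ^ (e - 1))" by (rule mult_le_mono2)
    also have "\<dots> \<le> X" by simp
    finally have "2 * (2 ^ (e - 1) * y) \<le> 2 * X" by (rule mult_le_mono2)
    moreover have "2 ^ e * y = 2 * (2 ^ (e - 1) * y)" using that by (cases e) auto
    ultimately show ?thesis by linarith
  qed
  then show ?thesis using e by (intro exI[of _ e] conjI) auto
qed

lemma pred_tables_mono:
  assumes "pred_tables N NB e w bk key L \<beta> T tp W f g" "T \<le> T'"
    "\<And>j. j < NB \<Longrightarrow> tp j = tp' j" "\<And>c i. c < 11 \<Longrightarrow> W c i = W' c i"
  shows "pred_tables N NB e w bk key L \<beta> T' tp' W' f g"
proof -
  have "(2::nat) ^ T \<le> 2 ^ T'" using assms(2) by simp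
  moreover have "trie_ok w W = trie_ok w W'" by (intro ext) (rule trie_ok_cong[OF assms(4)])
  ultimately show ?thesis using assms(1,3) unfolding pred_tables_def by (auto intro: le_trans)
qed

lemma search_time:
  assumes "1 \<le> (Y::real)" "2 ^ e \<le> 4 * Y"
    "w < 16 \<and> T = 16 \<or> 16 \<le> w \<and> 2 ^ T \<le> 2 * (64 * L + 1) \<and> real L \<le> 4 * real e / log 2 (real w) + 1"
  shows "real T \<le> 16 * lg (log (real w) Y)"
proof (cases "w < 16")
  case True
  then have "T = 16" using assms(3) by simp
  then show ?thesis by (simp add: lg_def)
next
  case False
  then have T: "2 ^ T \<le> 2 * (64 * L + 1)" "real L \<le> 4 * real e / log 2 (real w) + 1" using assms(3) by auto
  let ?X = "log (real w) Y"
  have lw: "4 \<le> log 2 (real w)"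
  proof -
    have "log 2 (2 ^ 4) \<le> log 2 (real w)" using False by (subst log_le_cancel_iff) auto
    moreover have "log 2 ((2::real) ^ 4) = 4" by (subst log_nat_power) auto
    ultimately show ?thesis by linarith
  qed
  have X: "?X = log 2 Y / log 2 (real w)" using False assms(1) by (intro log_base_change) auto
  have Y0: "0 \<le> log 2 Y" using assms(1) by simp
  have X0: "0 \<le> ?X" unfolding X using Y0 lw by simp
  have "real e = log 2 (2 ^ e)" by simp
  also have "\<dots> \<le> log 2 (4 * Y)" using assms(1,2) by (subst log_le_cancel_iff) auto
  also have "\<dots> = log 2 (2 ^ 2) + log 2 Y" using assms(1) by (simp add: log_mult)
  also have "log 2 ((2::real) ^ 2) = 2" by (subst log_nat_power) auto
  finally have e: "real e \<le> 2 + log 2 Y" by simp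
  have "4 * real e / log 2 (real w) \<le> 4 * (2 + log 2 Y) / log 2 (real w)"
    using e lw by (intro divide_right_mono) auto
  also have "\<dots> = 8 / log 2 (real w) + 4 * ?X" unfolding X using lw by (simp add: field_simps)
  also have "8 / log 2 (real w) \<le> 8 / 4" using lw by (intro divide_left_mono) auto
  finally have L: "real L \<le> 4 * ?X + 3" using T(2) by simp
  have "(2::real) ^ T = real (2 ^ T)" by simp
  also have "\<dots> \<le> real (2 * (64 * L + 1))" using T(1) by (rule of_nat_mono)
  also have "\<dots> \<le> 1024 * (?X + 1)" using L X0 by simp
  finally have T2: "2 ^ T \<le> 1024 * (?X + 1)" .
  have "real T = log 2 (2 ^ T)" by simp
  also have "\<dots> \<le> log 2 (1024 * (?X + 1))" using T2 X0 by (subst log_le_cancel_iff) auto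
  also have "\<dots> = log 2 (2 ^ 10) + log 2 (?X + 1)"
    using X0 log_mult[of 2 1024 "?X + 1"] by (simp del: distrib_left_numeral)
  also have "log 2 ((2::real) ^ 10) = 10" by (subst log_nat_power) auto
  finally have "real T \<le> 10 + log 2 (?X + 1)" .
  moreover have "log 2 (?X + 1) \<le> 1 + lg ?X"
  proof (cases "?X \<le> 1")
    case True
    then have "log 2 (?X + 1) \<le> log 2 2" using X0 by (subst log_le_cancel_iff) auto
    then show ?thesis by (simp add: lg_def)
  next
    case F: False
    have "log 2 (?X + 1) \<le> log 2 (2 * ?X)" using F by (subst log_le_cancel_iff) auto
    also have "\<dots> = 1 + log 2 ?X" using F by (subst log_mult) auto
    finally show ?thesis by (simp add: lg_def)
  qed
  moreover have "1 \<le> lg ?X" by (simp add: lg_def)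
  ultimately show ?thesis by linarith
qed

lemma cmd_below_count_prog: "cmd_below 40 count_prog"
  by (simp add: count_prog_def init_prog_def body_prog_def step_prog_def reset_prog_def pred_search_def
      trie_search_def level_search_def bsearch_def word_search_def skip_def eqE_def rd_def pcount_def
      fields_def repunit_def base_pred_def stride_def all_ones_def slotE_def hash_step_def)

context csa_text
begin

lemma keyed_symbols: "keyed d (\<sigma> div 2 ^ e + 1) e (\<lambda>t. ds ! t div 2 ^ e) (\<lambda>t. ds ! t)"
proof
  show "ds ! u div 2 ^ e \<le> ds ! v div 2 ^ e" if "u \<le> v" "v < d" for u v
    using that ds_less_iff[of u v] by (cases "u = v") (auto intro!: div_le_mono)
  show "ds ! u < ds ! v" if "u < v" "v < d" for u v using that ds_less_iff[of u v] by simp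
  show "ds ! u div 2 ^ e < \<sigma> div 2 ^ e + 1" if "u < d" for u
    using set_T[OF ds_in[OF that]] by (simp add: le_imp_less_Suc div_le_mono)
qed

lemma keyed_runs:
  assumes "nb = n div 2 ^ e + 1"
  shows "keyed r (d * nb) e (\<lambda>u. sid (su u) * nb + vu u div 2 ^ e) vu"
proof
  have vb: "vu u div 2 ^ e < nb" if "u < r" for u
    unfolding assms using vu_less[OF that] by (simp add: le_imp_less_Suc div_le_mono)
  have eq: "sid (su u) = sid (su v) \<and> vu u div 2 ^ e = vu v div 2 ^ e"
    if "sid (su u) * nb + vu u div 2 ^ e = sid (su v) * nb + vu v div 2 ^ e" "u < r" "v < r" for u v
  proof -
    have "(sid (su u) * nb + vu u div 2 ^ e) div nb = sid (su u)" "(sid (su v) * nb + vu v div 2 ^ e) div nb = sid (su v)"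
      using vb[OF that(2)] vb[OF that(3)] by simp_all
    then have "sid (su u) = sid (su v)" using that(1) by simp
    then show ?thesis using that(1) by simp
  qed
  show "sid (su u) * nb + vu u div 2 ^ e \<le> sid (su v) * nb + vu v div 2 ^ e" if uv: "u \<le> v" "v < r" for u v
  proof (cases "su u = su v")
    case True
    then have "vu u \<le> vu v" using run_order[of u v] uv by (cases "u = v") auto
    then show ?thesis using True by (simp add: div_le_mono)
  next
    case False
    then have "su u < su v" using run_order[of u v] uv by (cases "u = v") auto
    then have "sid (su u) < sid (su v)" using sid_less_iff[of "su u" "su v"] su_in uv by simp
    then have "(sid (su u) + 1) * nb \<le> sid (su v) * nb" by (intro mult_le_mono1) simp
    then show ?thesis using vb[of u] uv by simp
  qed
  show "vu u < vu v" if "u < v" "v < r" "sid (su u) * nb + vu u div 2 ^ e = sid (su v) * nb + vu v div 2 ^ e" for u v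
  proof -
    have "su u = su v" using eq[OF that(3)] that(1,2) sid_eq_iff[of "su u" "su v"] su_in by simp
    then show ?thesis using run_order[OF that(1,2)] by simp
  qed
  show "sid (su u) * nb + vu u div 2 ^ e < d * nb" if "u < r" for u
  proof -
    have "sid (su u) < d" using ds_sid[OF su_in[OF that]] by simp
    then have "(sid (su u) + 1) * nb \<le> d * nb" by (intro mult_le_mono1) simp
    then show ?thesis using vb[OF that] by simp
  qed
  show "vu u div 2 ^ e = vu v div 2 ^ e" if "u < r" "v < r" "sid (su u) * nb + vu u div 2 ^ e = sid (su v) * nb + vu v div 2 ^ e" for u v
    using eq[OF that(3,1,2)] by simp
qed

lemma d_le_sigma: "d \<le> \<sigma>"
proof -
  have "card (set T) \<le> card {1..\<sigma>}" using Ttext by (intro card_mono) (auto simp: is_text_def)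
  then show ?thesis by (simp add: d_def)
qed

lemma block_exponents:
  "\<exists>e1 e2. \<sigma> div 2 ^ e1 + 1 \<le> r \<and> d * (n div 2 ^ e2 + 1) \<le> r \<and> 2 ^ e1 * r \<le> 4 * (\<sigma> * n) \<and> 2 ^ e2 * r \<le> 4 * (\<sigma> * n) \<and>
    2 ^ e1 \<le> 2 * \<sigma> \<and> 2 ^ e2 \<le> 2 * n"
proof -
  have s1: "1 \<le> \<sigma>" using d1 d_le_sigma by linarith
  have sn: "\<sigma> \<le> \<sigma> * n" "n \<le> \<sigma> * n" using s1 n1 by simp_all
  have r4: "r \<le> 4 * (\<sigma> * n)" using sn r1(2) by linarith
  obtain e1 where e1: "\<sigma> div 2 ^ e1 + 1 \<le> r" "e1 = 0 \<or> 2 ^ e1 * r \<le> 2 * \<sigma>"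
    using block_exponent[OF r1(1) s1] by blast
  define y where "y = r div d"
  have y1: "1 \<le> y" unfolding y_def using d_le_r d1 by (simp add: Suc_le_eq div_greater_zero_iff)
  obtain e2 where e2: "n div 2 ^ e2 + 1 \<le> y" "e2 = 0 \<or> 2 ^ e2 * y \<le> 2 * n"
    using block_exponent[OF y1 n1] by blast
  have "d * (n div 2 ^ e2 + 1) \<le> d * y" using e2(1) by (rule mult_le_mono2)
  also have "\<dots> \<le> r" by (simp add: y_def)
  finally have nb: "d * (n div 2 ^ e2 + 1) \<le> r" .
  have "2 ^ e1 * r \<le> 4 * (\<sigma> * n)"
    using e1(2)
  proof
    assume "2 ^ e1 * r \<le> 2 * \<sigma>"
    then show ?thesis using sn by linarith
  qed (use r4 in simp)
  moreover have "2 ^ e2 * r \<le> 4 * (\<sigma> * n)"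
    using e2(2)
  proof
    assume "2 ^ e2 * y \<le> 2 * n"
    have "r < d * y + d" unfolding y_def using d1 by (metis dividend_less_times_div less_le_trans zero_less_one add.commute)
    moreover have "d * 1 \<le> d * y" using y1 by (rule mult_le_mono2)
    ultimately have "r \<le> 2 * d * y" by linarith
    then have "2 ^ e2 * r \<le> 2 ^ e2 * (2 * d * y)" by (rule mult_le_mono2)
    also have "\<dots> = 2 * d * (2 ^ e2 * y)" by simp
    also have "\<dots> \<le> 2 * \<sigma> * (2 * n)" using \<open>2 ^ e2 * y \<le> 2 * n\<close> d_le_sigma by (intro mult_le_mono[of "2 * d"]) simp_all
    finally show ?thesis by simp
  qed (use r4 in simp)
  moreover have "2 ^ e1 \<le> 2 * \<sigma>"
    using e1(2)
  proof
    assume "2 ^ e1 * r \<le> 2 * \<sigma>"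
    moreover have "2 ^ e1 * 1 \<le> 2 ^ e1 * r" using r1(1) by (rule mult_le_mono2)
    ultimately show ?thesis by linarith
  qed (use s1 in simp)
  moreover have "2 ^ e2 \<le> 2 * n"
    using e2(2)
  proof
    assume "2 ^ e2 * y \<le> 2 * n"
    moreover have "2 ^ e2 * 1 \<le> 2 ^ e2 * y" using y1 by (rule mult_le_mono2)
    ultimately show ?thesis by linarith
  qed (use n1 in simp)
  ultimately show ?thesis using e1(1) nb by blast
qed

lemma field_width: "\<exists>g bl q0. q0 = 2 ^ g \<and> 1 \<le> g \<and> (k + 4) * bl \<le> q0 \<and> q0 \<le> 2 * ((k + 4) * bl) \<and> n < 2 ^ bl \<and> 1 \<le> bl \<and>
    real bl \<le> 2 * lg (real n)"
proof -
  obtain a where a: "2 ^ a \<le> n" "n < 2 ^ (a + 1)" using ex_power_ivl1[of 2 n] n1 by auto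
  have "1 * 1 \<le> (k + 4) * (a + 1)" by (intro mult_le_mono) auto
  then obtain g where g: "(k + 4) * (a + 1) \<le> 2 ^ g" "2 ^ g \<le> 2 * ((k + 4) * (a + 1))" using pow2_between[of "(k + 4) * (a + 1)"] by auto
  have "1 \<le> g"
  proof (rule ccontr)
    assume "\<not> 1 \<le> g"
    then have "g = 0" by simp
    then have "(k + 4) * (a + 1) \<le> 1" using g(1) by simp
    moreover have "4 * 1 \<le> (k + 4) * (a + 1)" by (intro mult_le_mono) auto
    ultimately show False by linarith
  qed
  moreover have "real (a + 1) \<le> 2 * lg (real n)"
  proof -
    have "real (2 ^ a) \<le> real n" using a(1) by (rule of_nat_mono)
    then have "log 2 (2 ^ a) \<le> log 2 (real n)" using n1 by (subst log_le_cancel_iff) auto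
    then have "real a \<le> log 2 (real n)" by simp
    then show ?thesis by (simp add: lg_def)
  qed
  ultimately show ?thesis using g a(2) by (intro exI[of _ g] exI[of _ "a + 1"] exI[of _ "2 ^ g"]) auto
qed


lemma data_structure_exists:
  assumes nw: "n < 2 ^ w" and sw: "\<sigma> < 2 ^ w" and sk: "\<sigma> \<le> n ^ k"
  shows "\<exists>D TT. real (length D) \<le> 10608 * (real k + 4) * (real r * lg (real n)) \<and>
    real TT \<le> 16 * lg (log (real w) (real \<sigma> * real n / real r)) \<and>
    (\<forall>P. set P \<subseteq> {1..\<sigma>} \<and> P \<noteq> [] \<and> length P < 2 ^ w \<longrightarrow>
      (\<exists>t s'. bs w P (mem (init_config w D P)) count_prog ((\<lambda>_. 0)(0 := w, 1 := length P)) t s' \<and>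
        t \<le> length P * (6 * TT + 1) \<and> s' 0 = occ T P))"
proof -
  have w1: "1 \<le> w" using nw n1 by (cases w) auto
  obtain e1 e2 where e: "\<sigma> div 2 ^ e1 + 1 \<le> r" "d * (n div 2 ^ e2 + 1) \<le> r"
    "2 ^ e1 * r \<le> 4 * (\<sigma> * n)" "2 ^ e2 * r \<le> 4 * (\<sigma> * n)" "2 ^ e1 \<le> 2 * \<sigma>" "2 ^ e2 \<le> 2 * n"
    using block_exponents by blast
  define nb where "nb = n div 2 ^ e2 + 1"
  obtain g bl q0 where q0: "q0 = 2 ^ g" "1 \<le> g" "(k + 4) * bl \<le> q0" "q0 \<le> 2 * ((k + 4) * bl)" "n < 2 ^ bl"
    "1 \<le> bl" "real bl \<le> 2 * lg (real n)" using field_width by blast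
  define pk where "pk \<longleftrightarrow> 17 * q0 \<le> w"
  define q where "q = (if pk then q0 else w)"
  define f where "f = (if pk then min (w div (17 * q0)) (r + 1) else 1)"
  have q0_4: "4 \<le> q0" "k * bl < q0" "bl < q0"
  proof -
    have "4 * 1 \<le> (k + 4) * bl" using q0(6) by (intro mult_le_mono) auto
    then show "4 \<le> q0" using q0(3) by linarith
    have "(k + 4) * bl = k * bl + 4 * bl" by (simp add: distrib_right)
    then show "k * bl < q0" "bl < q0" using q0(3,6) by linarith+
  qed
  have q1: "1 \<le> q" using q0_4 w1 by (simp add: q_def)
  have f1: "1 \<le> f"
  proof (cases pk)
    case True
    then have "17 * q0 div (17 * q0) \<le> w div (17 * q0)" unfolding pk_def by (rule div_le_mono)
    then show ?thesis using q0_4 True by (simp add: f_def)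
  qed (simp add: f_def)
  have fr: "f \<le> r + 1" using r1 by (simp add: f_def)
  have packed: "17 * q * f \<le> w" if pk
  proof -
    have "17 * q * f \<le> 17 * q0 * (w div (17 * q0))" using that by (simp add: q_def f_def)
    also have "\<dots> \<le> w" by simp
    finally show ?thesis .
  qed
  have bl_q: "2 ^ bl < (2::nat) ^ q0" using q0_4 by (intro power_strict_increasing) auto
  have "n + 1 < 2 ^ q0" using q0(5) bl_q by linarith
  then have nq: "n + 1 < 2 ^ q" if pk using that by (simp add: q_def)
  have n_q: "n < 2 ^ q" using nq nw by (cases pk) (auto simp: q_def)
  have sq: "\<sigma> < 2 ^ q"
  proof (cases pk)
    case True
    have "n ^ k \<le> (2 ^ bl) ^ k" using q0(5) by (intro power_mono) auto
    also have "\<dots> = 2 ^ (k * bl)" by (simp only: power_mult[symmetric] mult.commute)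
    also have "\<dots> < 2 ^ q0" using q0_4 by (intro power_strict_increasing) auto
    finally show ?thesis using sk True by (simp add: q_def)
  qed (use sw in \<open>simp add: q_def\<close>)
  have f_q: "f < 2 ^ q"
  proof (cases pk)
    case True
    then show ?thesis using nq fr r1 by linarith
  next
    case False
    then show ?thesis using w1 one_less_power[of "2::nat" w] by (simp add: f_def q_def)
  qed
  have eq: "e1 \<le> q" "e2 \<le> q"
  proof -
    have "(2::nat) ^ e1 < 2 ^ Suc q" "(2::nat) ^ e2 < 2 ^ Suc q" using e(5,6) sq n_q by simp_all
    then have "e1 < Suc q" "e2 < Suc q" by (simp_all only: power_strict_increasing_iff one_less_numeral_iff semiring_norm)
    then show "e1 \<le> q" "e2 \<le> q" by simp_all
  qed
  have qw: "q \<le> w" using packed f1 by (auto simp: q_def pk_def)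
  have rw: "r < 2 ^ w" using r1 nw by linarith
  have rq: "r < 2 ^ q" using r1 n_q by linarith
  let ?bk1 = "\<lambda>t. ds ! t div 2 ^ e1" and ?key1 = "\<lambda>t. ds ! t"
  let ?bk2 = "\<lambda>u. sid (su u) * nb + vu u div 2 ^ e2"
  let ?NB1 = "\<sigma> div 2 ^ e1 + 1" and ?NB2 = "d * nb"
  note k1 = keyed_symbols[of e1] and k2 = keyed_runs[OF nb_def]
  have key1: "\<forall>u<d. ds ! u < 2 ^ w" using set_T[OF ds_in] sw le_less_trans by blast
  have key2: "\<forall>u<r. vu u < 2 ^ w" using vu_less nw less_trans by blast
  have ew: "e1 \<le> w" "e2 \<le> w" using eq qw by auto
  obtain L1 b1 T1 tp1 W1 g1 where t1: "L1 \<le> e1 + 1" "b1 \<le> e1 + 1" "w < 16 \<longrightarrow> L1 = 0 \<and> b1 = 0"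
    "\<forall>j. tp1 j \<le> r" "\<forall>j\<ge>?NB1. tp1 j = 0" "\<forall>c i. W1 c i < 2 ^ w" "\<forall>c i. r div f \<le> i \<longrightarrow> W1 c i = 0"
    "g1 < 2 ^ T1 * f" "pred_tables d ?NB1 e1 w ?bk1 ?key1 L1 b1 T1 tp1 W1 f g1"
    "w < 16 \<and> T1 = 16 \<or> 16 \<le> w \<and> 2 ^ T1 \<le> 2 * (64 * L1 + 1) \<and> real L1 \<le> 4 * real e1 / log 2 (real w) + 1"
    using pred_tables_exist[OF k1 d_le_r rw f1 w1 key1 ew(1)] by (elim exE conjE) (rule that; assumption)
  obtain L2 b2 T2 tp2 W2 g2 where t2: "L2 \<le> e2 + 1" "b2 \<le> e2 + 1" "w < 16 \<longrightarrow> L2 = 0 \<and> b2 = 0"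
    "\<forall>j. tp2 j \<le> r" "\<forall>j\<ge>?NB2. tp2 j = 0" "\<forall>c i. W2 c i < 2 ^ w" "\<forall>c i. r div f \<le> i \<longrightarrow> W2 c i = 0"
    "g2 < 2 ^ T2 * f" "pred_tables r ?NB2 e2 w ?bk2 vu L2 b2 T2 tp2 W2 f g2"
    "w < 16 \<and> T2 = 16 \<or> 16 \<le> w \<and> 2 ^ T2 \<le> 2 * (64 * L2 + 1) \<and> real L2 \<le> 4 * real e2 / log 2 (real w) + 1"
    using pred_tables_exist[OF k2 order_refl rw f1 w1 key2 ew(2)] by (elim exE conjE) (rule that; assumption)
  define TT where "TT = max T1 T2"
  define st1 where "st1 = keyed.st d ?bk1"
  define st2 where "st2 = keyed.st r ?bk2"
  define Fs where "Fs = [\<lambda>_. if pk then q else 1, \<lambda>_. f, \<lambda>_. n, \<lambda>_. nb, pos,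
    \<lambda>u. if u < d then ds ! u else 0, st1, tp1, \<lambda>_. L1, \<lambda>_. b1, \<lambda>_. e1,
    \<lambda>u. if u < r then vu u else 0, st2, tp2, \<lambda>_. L2, \<lambda>_. b2, \<lambda>_. e2]"
  define A where "A c i = (if i \<le> r then (Fs ! c) i else 0)" for c i :: nat
  define Wt where "Wt c = (if c < 11 then W1 c else W2 (c - 11))" for c :: nat
  have lens: "length Fs = 17" by (simp add: Fs_def)
  have small: "x \<le> e' + 1 \<Longrightarrow> e' \<le> q \<Longrightarrow> w < 16 \<longrightarrow> x = 0 \<Longrightarrow> x < 2 ^ q" for x e' :: nat
  proof (cases "w < 16")
    case False
    assume x: "x \<le> e' + 1" "e' \<le> q"
    have "2 \<le> q" using q0_4 False by (simp add: q_def)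
    then have "q + 1 < (2::nat) ^ q" by (induction q rule: dec_induct) auto
    then show ?thesis using x by linarith
  qed simp
  have nbr: "nb \<le> r"
  proof -
    have "1 * nb \<le> d * nb" using d1 by (rule mult_le_mono1)
    then show ?thesis using e(2) by (simp add: nb_def)
  qed
  have Fs_less: "\<forall>F\<in>set Fs. \<forall>i. F i < 2 ^ q"
  proof -
    have "(if pk then q else 1) < 2 ^ q" using q1 less_exp[of q] one_less_power[of "2::nat" q] by auto
    moreover have "pos i < 2 ^ q" for i using pos_le_n[of i] n_q by linarith
    moreover have "st1 i < 2 ^ q" "st2 i < 2 ^ q" for i
      unfolding st1_def st2_def using keyed.st_le[OF k1, of i] keyed.st_le[OF k2, of i] d_le_r rq by linarith+
    moreover have "tp1 i < 2 ^ q" "tp2 i < 2 ^ q" for i using t1(4) t2(4) rq le_less_trans by blast+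
    moreover have "(if u < d then ds ! u else 0) < 2 ^ q" for u using set_T[OF ds_in[of u]] sq by auto
    moreover have "(if u < r then vu u else 0) < 2 ^ q" for u using vu_less[of u] n_q by auto
    moreover have "L1 < 2 ^ q" "b1 < 2 ^ q" "L2 < 2 ^ q" "b2 < 2 ^ q"
      using small[OF t1(1) eq(1)] small[OF t1(2) eq(1)] small[OF t2(1) eq(2)] small[OF t2(2) eq(2)] t1(3) t2(3) by auto
    moreover have "e1 < 2 ^ q" "e2 < 2 ^ q" using eq less_exp[of q] by linarith+
    moreover have "nb < 2 ^ q" using nbr rq by linarith
    ultimately show ?thesis using f_q n_q unfolding Fs_def by auto
  qed
  have A_less: "A c i < 2 ^ q" if "c < 17" for c i
    using Fs_less nth_mem[of c Fs] lens that by (auto simp: A_def)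
  have A_zero: "A c i = 0" if "r < i" for c i using that by (simp add: A_def)
  have Wt_less: "Wt c i < 2 ^ w" for c i using t1(6) t2(6) by (simp add: Wt_def)
  have Wt_zero: "Wt c i = 0" if "r div f \<le> i" for c i using t1(7) t2(7) that by (simp add: Wt_def)
  have "\<exists>D. length D \<le> 2652 * (r * q0) \<and> (\<forall>P. layout w (mem (init_config w D P)) pk q f A Wt)"
  proof (cases pk)
    case True
    then have qq: "q = q0" by (simp add: q_def)
    have "\<exists>D. length D = (if r < f then 17 * q * (r + 1) else 39 * (r div f + 1) * w) \<and>
      (\<forall>P. layout w (mem (init_config w D P)) True q f A Wt)"
      by (rule layout_packed) (use q1 f1 packed[OF True] f_q A_less Wt_less A_zero Wt_zero in auto)
    moreover have "(if r < f then 17 * q * (r + 1) else 39 * (r div f + 1) * w) \<le> 2652 * (r * q0)"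
    proof (cases "r < f")
      case rf: True
      have "q * (r + 1) \<le> q * (2 * r)" using r1 by (intro mult_le_mono2) simp
      then show ?thesis using rf qq by simp
    next
      case rf: False
      then have fw: "f = w div (17 * q0)" using True by (auto simp: f_def min_def split: if_splits)
      have "w < 17 * q0 * f + 17 * q0" unfolding fw using q0_4 by (intro dividend_less_times_div[of "17 * q0" w, THEN less_le_trans]) auto
      moreover have "17 * q0 * 1 \<le> 17 * q0 * f" using f1 by (rule mult_le_mono2)
      ultimately have "w \<le> 34 * q0 * f" by linarith
      then have "39 * (r div f + 1) * w \<le> 39 * (r div f + 1) * (34 * q0 * f)" by (rule mult_le_mono2)
      also have "\<dots> = 1326 * q0 * (f * (r div f) + f)" by (simp add: algebra_simps)
      also have "\<dots> \<le> 1326 * q0 * (2 * r)"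
      proof (rule mult_le_mono2)
        have "f * (r div f) \<le> r" by simp
        then show "f * (r div f) + f \<le> 2 * r" using rf by linarith
      qed
      finally show ?thesis using rf by (simp add: mult_ac)
    qed
    ultimately show ?thesis using True by metis
  next
    case False
    then have qq: "q = w" "f = 1" by (auto simp: q_def f_def)
    have "\<exists>D. length D = 39 * (r + 1) * w \<and> (\<forall>P. layout w (mem (init_config w D P)) False w 1 A Wt)"
      by (rule layout_unpacked) (use w1 A_less qq Wt_less A_zero Wt_zero in auto)
    moreover have "39 * (r + 1) * w \<le> 2652 * (r * q0)"
    proof -
      have "39 * (r + 1) * w \<le> 39 * (2 * r) * (17 * q0)"
        using r1 False by (intro mult_le_mono) (auto simp: pk_def)
      then show ?thesis by simp
    qed
    ultimately show ?thesis using False qq by metis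
  qed
  then obtain D where D: "length D \<le> 2652 * (r * q0)" "\<And>P. layout w (mem (init_config w D P)) pk q f A Wt" by blast
  have len: "real (length D) \<le> 10608 * (real k + 4) * (real r * lg (real n))"
  proof -
    have "real q0 \<le> real (2 * ((k + 4) * bl))" using q0(4) by (rule of_nat_mono)
    also have "\<dots> = 2 * (real k + 4) * real bl" by simp
    also have "\<dots> \<le> 2 * (real k + 4) * (2 * lg (real n))" using q0(7) by (intro mult_left_mono) auto
    finally have "real r * real q0 \<le> real r * (2 * (real k + 4) * (2 * lg (real n)))"
      by (rule mult_left_mono) simp
    moreover have "real (length D) \<le> real (2652 * (r * q0))" using D(1) by (rule of_nat_mono)
    moreover have "real (2652 * (r * q0)) = 2652 * (real r * real q0)" by simp
    ultimately have "real (length D) \<le> 2652 * (real r * (2 * (real k + 4) * (2 * lg (real n))))" by linarith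
    then show ?thesis by (simp add: algebra_simps)
  qed
  let ?Y = "real \<sigma> * real n / real r"
  have Y1: "1 \<le> ?Y"
  proof -
    have "r \<le> \<sigma> * n" using r1(2) d1 d_le_sigma by (metis One_nat_def le_trans mult_le_mono1 nat_mult_1)
    then have "real r \<le> real (\<sigma> * n)" by (rule of_nat_mono)
    then show ?thesis using r1(1) by (simp add: field_simps)
  qed
  have Ye: "2 ^ e' \<le> 4 * ?Y" if "2 ^ e' * r \<le> 4 * (\<sigma> * n)" for e'
  proof -
    have "real (2 ^ e' * r) \<le> real (4 * (\<sigma> * n))" using that by (rule of_nat_mono)
    then show ?thesis using r1(1) by (simp add: field_simps)
  qed
  have time: "real TT \<le> 16 * lg (log (real w) ?Y)"
    using search_time[OF Y1 Ye[OF e(3)] t1(10)] search_time[OF Y1 Ye[OF e(4)] t2(10)] by (simp add: TT_def max_def)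
  have run: "\<exists>t s'. bs w P (mem (init_config w D P)) count_prog ((\<lambda>_. 0)(0 := w, 1 := length P)) t s' \<and>
        t \<le> length P * (6 * TT + 1) \<and> s' 0 = occ T P"
    if P: "set P \<subseteq> {1..\<sigma>}" "P \<noteq> []" "length P < 2 ^ w" for P
  proof -
    define M where "M = mem (init_config w D P)"
    interpret lay: layout w P M pk q f A Wt unfolding M_def by (rule D(2))
    have pT: "(2::nat) ^ T1 * f \<le> 2 ^ TT * f" "(2::nat) ^ T2 * f \<le> 2 ^ TT * f" by (simp_all add: TT_def)
    have ok1: "lay.pred_ok 5 0 d ?NB1 e1 ?bk1 ?key1 TT"
      unfolding lay.pred_ok_def
    proof (intro conjI exI[of _ g1])
      show "g1 < 2 ^ TT * f" using t1(8) pT(1) by linarith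
      have "A (5 + 3) 0 = L1" "A (5 + 4) 0 = b1" by (simp_all add: A_def Fs_def)
      then show "pred_tables d ?NB1 e1 w ?bk1 ?key1 (A (5 + 3) 0) (A (5 + 4) 0) TT (A (5 + 2)) (\<lambda>c. Wt (0 + c)) f g1"
        by (simp only:) (rule pred_tables_mono[OF t1(9)], use e(1) in \<open>auto simp: TT_def A_def Fs_def Wt_def\<close>)
    qed (use k1 d_le_r e(1) rw in \<open>auto simp: A_def Fs_def st1_def\<close>)
    have ok2: "lay.pred_ok 11 11 r ?NB2 e2 ?bk2 vu TT"
      unfolding lay.pred_ok_def
    proof (intro conjI exI[of _ g2])
      show "g2 < 2 ^ TT * f" using t2(8) pT(2) by linarith
      have "A (11 + 3) 0 = L2" "A (11 + 4) 0 = b2" by (simp_all add: A_def Fs_def)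
      then show "pred_tables r ?NB2 e2 w ?bk2 vu (A (11 + 3) 0) (A (11 + 4) 0) TT (A (11 + 2)) (\<lambda>c. Wt (11 + c)) f g2"
        by (simp only:) (rule pred_tables_mono[OF t2(9)], use e(2) in \<open>auto simp: TT_def A_def Fs_def Wt_def nb_def\<close>)
    qed (use k2 e(2) rw in \<open>auto simp: A_def Fs_def st2_def nb_def\<close>)
    interpret csa w P M pk q f A Wt \<sigma> T e1 e2 nb TT
    proof unfold_locales
      show "\<exists>g. q = 2 ^ g \<and> g < q \<and> 1 \<le> g" if pk
        using that q0(1,2) less_exp[of g] by (auto simp: q_def)
      show "lay.pred_ok 5 0 d ?NB1 e1 ?bk1 ?key1 TT" by (rule ok1)
      show "lay.pred_ok 11 11 r ?NB2 e2 ?bk2 vu TT" by (rule ok2)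
    qed (use sq n_q e(2) P d_le_r in \<open>auto simp: A_def Fs_def nb_def q_def\<close>)
    have "lay.wpl count_prog ((\<lambda>_. 0)(0 := w, 1 := length P)) (\<lambda>t s'. t \<le> length P * (6 * TT + 1) \<and> s' 0 = occ T P)"
      by (rule wp_count) auto
    then show ?thesis unfolding wp_def M_def by blast
  qed
  show ?thesis using len time run by blast
qed

end

theorem theorem4p1:
  fixes k :: nat
  shows "\<exists>(prog :: instr list) (C :: real). \<forall>(w :: nat) (\<sigma> :: nat) (n :: nat) (r :: nat) (T :: nat list).
    is_text \<sigma> T \<and> n = length T \<and> r = num_psi_runs T \<and>
    n < 2 ^ w \<and> \<sigma> < 2 ^ w \<and> \<sigma> \<le> n ^ k \<longrightarrow>
    (\<exists>D :: bool list.
      real (length D) \<le> C * (real r * lg (real n)) \<and>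
      (\<forall>(m :: nat) (P :: nat list).
        m = length P \<and> 1 \<le> m \<and> m < 2 ^ w \<and> set P \<subseteq> {1..\<sigma>} \<longrightarrow>
        outputs_within w prog D P (occ T P)
          (C * (real m * lg (log (real w) (real \<sigma> * real n / real r))))))"
proof -
  define K where "K = real (cmd_size count_prog)"
  define C where "C = 10608 * (real k + 4) + 98 * K"
  have K0: "0 \<le> K" by (simp add: K_def)
  have lg1: "1 \<le> lg x" for x by (simp add: lg_def)
  have "\<exists>D :: bool list. real (length D) \<le> C * (real r * lg (real n)) \<and>
      (\<forall>m P. m = length P \<and> 1 \<le> m \<and> m < 2 ^ w \<and> set P \<subseteq> {1..\<sigma>} \<longrightarrow>
        outputs_within w (comp_cmd 40 count_prog 0) D P (occ T P)
          (C * (real m * lg (log (real w) (real \<sigma> * real n / real r)))))"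
    if T: "is_text \<sigma> T" "n = length T" "r = num_psi_runs T" "n < 2 ^ w" "\<sigma> < 2 ^ w" "\<sigma> \<le> n ^ k" for w \<sigma> n r T
  proof -
    interpret csa_text \<sigma> T by unfold_locales (rule T(1))
    have r: "csa_text.r T = r" using num_runs_heads T(3) by (simp add: r_def)
    let ?l = "lg (log (real w) (real \<sigma> * real n / real r))"
    obtain D TT where D: "real (length D) \<le> 10608 * (real k + 4) * (real r * lg (real n))"
      "real TT \<le> 16 * ?l"
      "\<And>P. set P \<subseteq> {1..\<sigma>} \<Longrightarrow> P \<noteq> [] \<Longrightarrow> length P < 2 ^ w \<Longrightarrow>
      (\<exists>t s'. bs w P (mem (init_config w D P)) count_prog ((\<lambda>_. 0)(0 := w, 1 := length P)) t s' \<and>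
        t \<le> length P * (6 * TT + 1) \<and> s' 0 = occ T P)"
      using data_structure_exists[of w k] T(4-6) unfolding T(2) r by blast
    have "10608 * (real k + 4) * (real r * lg (real n)) \<le> C * (real r * lg (real n))"
      using K0 lg1[of "real n"] by (intro mult_right_mono) (auto simp: C_def)
    then have len: "real (length D) \<le> C * (real r * lg (real n))" using D(1) by linarith
    have "outputs_within w (comp_cmd 40 count_prog 0) D P (occ T P) (C * (real (length P) * ?l))"
      if P: "1 \<le> length P" "length P < 2 ^ w" "set P \<subseteq> {1..\<sigma>}" for P
    proof -
      have "P \<noteq> []" using P(1) by auto
      from D(3)[OF P(3) this P(2)] obtain t s' where
        ts: "bs w P (mem (init_config w D P)) count_prog ((\<lambda>_. 0)(0 := w, 1 := length P)) t s'"
        "t \<le> length P * (6 * TT + 1)" "s' 0 = occ T P" by blast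
      let ?m = "real (length P)"
      have "real t \<le> real (length P * (6 * TT + 1))" using ts(2) by (rule of_nat_mono)
      also have "\<dots> = ?m * (6 * real TT + 1)" by (simp add: algebra_simps)
      also have "\<dots> \<le> ?m * (97 * ?l)" using D(2) lg1[of "log (real w) (real \<sigma> * real n / real r)"]
        by (intro mult_left_mono) auto
      finally have "real t \<le> 97 * (?m * ?l)" by simp
      moreover have "1 * 1 \<le> ?m * ?l" using P(1) lg1 by (intro mult_mono) auto
      ultimately have "real t + 1 \<le> 98 * (?m * ?l)" by linarith
      then have "K * (real t + 1) \<le> K * (98 * (?m * ?l))" using K0 by (rule mult_left_mono)
      also have "\<dots> \<le> C * (?m * ?l)"
      proof -
        have "98 * K \<le> C" by (simp add: C_def)
        then have "98 * K * (?m * ?l) \<le> C * (?m * ?l)" using \<open>1 * 1 \<le> ?m * ?l\<close> by (intro mult_right_mono) auto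
        then show ?thesis by (simp add: mult_ac)
      qed
      finally have "real (cmd_size count_prog) * (real t + 1) \<le> C * (?m * ?l)" by (simp add: K_def)
      then show ?thesis by (intro outputs_withinI[OF ts(1) cmd_below_count_prog _ ts(3)]) auto
    qed
    then show ?thesis using len by blast
  qed
  then show ?thesis by (intro exI[of _ "comp_cmd 40 count_prog 0"] exI[of _ C]) blast
qed

end
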